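(* Let $d\ge 2$, let $r\in\mathbb N$ be an even number and let $1<p<\infty$. There is a constant $C(r,d,p)>0$, depending only on $r$, $d$ and $p$, such that for every $m\in\mathbb N$ and every cubature formula $(\xi,\Lambda)$ with $m$ knots $\xi=(\xi^1,\dots,\xi^m)$, $\xi^\mu\in[0,1)^d$, and weights $\Lambda=(\lambda_1,\dots,\lambda_m)$, $$\tilde D^{r}_{p,1}(\xi,\Lambda)\ \ge\ C(r,d,p)\, m^{-r}(\log m)^{(d-1)/2}.$$
   Context: A cubature formula $(\xi,\Lambda)$ with $m$ knots consists of points $\xi^1,\dots,\xi^m\in[0,1)^d$ and real weights $\lambda_1,\dots,\lambda_m$ (no positivity or normalization is assumed). Hat functions. For $u>0$, $x\in\mathbb R$, let $h^1(x,u):=\chi_{[-u/2,u/2)}(x)$ (characteristic function) and, for $r\ge2$, $h^r(\cdot,u):=h^{r-1}(\cdot,u)\ast h^1(\cdot,u)$, where $(f\ast g)(x)=\int_{\mathbb R}f(x-y)g(y)\,dy$. For $\mathbf x\in\mathbb R^d$, $\mathbf z\in[0,1)^d$, $\mathbf u\in(0,1/2]^d$ let $h^r(\mathbf x,\mathbf z,\mathbf u):=\prod_{j=1}^d h^r(x_j-z_j,u_j)$, and let $\tilde h^r(\mathbf x,\mathbf z,\mathbf u):=\sum_{\mathbf n\in\mathbb Z^d}h^r(\mathbf n+\mathbf x,\mathbf z,\mathbf u)$ be its periodization in $\mathbf x$ with period $1$ in each variable. Periodic $r$-smooth $L_{\mathbf p}$-discrepancy. For $1\le p_1,p_2\le\infty$,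 $$\tilde D^{r}_{p_1,p_2}(\xi,\Lambda):=\left\|\,\Big\|\int_{[0,1)^d}\tilde h^r(\mathbf x,\mathbf z,\mathbf u)\,d\mathbf x-\sum_{\mu=1}^m\lambda_\mu\tilde h^r(\xi^\mu,\mathbf z,\mathbf u)\Big\|_{p_1}\right\|_{p_2},$$ where the inner $L_{p_1}$ norm is in $\mathbf z$ over $[0,1)^d$ and the outer $L_{p_2}$ norm is in $\mathbf u$ over $(0,1/2]^d$, both with respect to Lebesgue measure. *)

theory Defs
  imports "HOL-Analysis.Analysis" "HOL-Probability.Essential_Supremum"
begin

definition unit_cube :: "(real ^ 'n) set" where
  "unit_cube = {z. \<forall>j. 0 \<le> z $ j \<and> z $ j < 1}"

definition scale_cube :: "(real ^ 'n) set" where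
  "scale_cube = {u. \<forall>j. 0 < u $ j \<and> u $ j \<le> 1 / 2}"

definition convolve :: "(real \<Rightarrow> real) \<Rightarrow> (real \<Rightarrow> real) \<Rightarrow> real \<Rightarrow> real" where
  "convolve f g x = (LINT y|lborel. f (x - y) * g y)"

text \<open>The hat functions are indexed by $r \ge 1$; the value at $r = 0$ is a dummy.\<close>

fun hat1 :: "nat \<Rightarrow> real \<Rightarrow> real \<Rightarrow> real" where
  "hat1 0 x u = 0"
| "hat1 (Suc 0) x u = indicator {- u / 2..<u / 2} x"
| "hat1 (Suc (Suc r)) x u = convolve (\<lambda>t. hat1 (Suc r) t u) (\<lambda>t. hat1 (Suc 0) t u) x"

definition hat :: "nat \<Rightarrow> real ^ 'n \<Rightarrow> real ^ 'n \<Rightarrow> real ^ 'n \<Rightarrow> real" where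
  "hat r x z u = (\<Prod>j\<in>UNIV. hat1 r (x $ j - z $ j) (u $ j))"

text \<open>For positive \<open>u\<close>, only finitely many terms of the following sum are nonzero.\<close>

definition periodic_hat :: "nat \<Rightarrow> real ^ 'n \<Rightarrow> real ^ 'n \<Rightarrow> real ^ 'n \<Rightarrow> real" where
  "periodic_hat r x z u =
     (\<Sum>\<^sub>\<infinity>n\<in>(UNIV :: (int ^ 'n) set). hat r ((\<chi> j. real_of_int (n $ j)) + x) z u)"

text \<open>A cubature formula with \<open>m\<close> knots is given by the restrictions of \<open>\<xi>\<close> and \<open>\<Lambda>\<close> to
  \<open>{1..m}\<close>; the other values are irrelevant.\<close>

definition cubature_error ::
  "nat \<Rightarrow> nat \<Rightarrow> (nat \<Rightarrow> real ^ 'n) \<Rightarrow> (nat \<Rightarrow> real) \<Rightarrow> real ^ 'n \<Rightarrow> real ^ 'n \<Rightarrow> real" where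
  "cubature_error r m \<xi> \<Lambda> z u =
     (LINT x:unit_cube|lborel. periodic_hat r x z u)
       - (\<Sum>\<mu>=1..m. \<Lambda> \<mu> * periodic_hat r (\<xi> \<mu>) z u)"

text \<open>Norms are taken in \<open>[0, \<infinity>]\<close>, so that no integrability side conditions arise.
  The power is only meant for exponents \<open>a > 0\<close>.\<close>

definition ennpowr :: "ennreal \<Rightarrow> real \<Rightarrow> ennreal" where
  "ennpowr x a = (if x = \<infinity> then \<infinity> else ennreal (enn2real x powr a))"

definition Lp_norm :: "'a measure \<Rightarrow> ennreal \<Rightarrow> ('a \<Rightarrow> ennreal) \<Rightarrow> ennreal" where
  "Lp_norm M p f =
     (if p = \<infinity> then esssup M f
      else ennpowr (\<integral>\<^sup>+ x. ennpowr (f x) (enn2real p) \<partial>M) (1 / enn2real p))"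

definition periodic_discrepancy ::
  "nat \<Rightarrow> ennreal \<Rightarrow> ennreal \<Rightarrow> nat \<Rightarrow> (nat \<Rightarrow> real ^ 'n) \<Rightarrow> (nat \<Rightarrow> real) \<Rightarrow> ennreal" where
  "periodic_discrepancy r p\<^sub>1 p\<^sub>2 m \<xi> \<Lambda> =
     Lp_norm (restrict_space lborel scale_cube) p\<^sub>2
       (\<lambda>u. Lp_norm (restrict_space lborel unit_cube) p\<^sub>1
              (\<lambda>z. ennreal \<bar>cubature_error r m \<xi> \<Lambda> z u\<bar>))"

end

theory Submission
  imports Defs
begin

text \<open>The cubature error is tested against a function \<open>g\<close> on the cube that does not depend on the
  scale \<open>u\<close>. Fix \<open>n\<close> with \<open>2 m \<le> 2^n \<le> 4 m\<close>. For every shape \<open>s\<close> with \<open>s\<^sub>1 + \<dots> + s\<^sub>d = n\<close>, at least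
  half of the \<open>2^n\<close> dyadic boxes of shape \<open>s\<close> contain no knot, and \<open>g\<close> is the sum over all these
  empty boxes of tensor products of one-dimensional atoms. An atom is chosen such that convolving it
  with the periodic hat and averaging over \<open>u\<close> gives a nonnegative bump supported in its dyadic
  interval; this needs no Fourier analysis, because convolving an \<open>r\<close>-th derivative with \<open>h\<^sup>r\<close> is an
  \<open>r\<close>-th central difference, of which, for even \<open>r\<close>, the average over \<open>u\<close> keeps only the middle
  term and a multiple of the mean. Hence the knots do not contribute and the pairing is of order
  \<open>n^(d-1) 2^(-r n)\<close>.

  By duality it remains to bound the moments of \<open>g\<close> by those of a sum of \<open>n^(d-1)\<close> independent
  terms. Up to a small constant, an atom is a product of Rademacher functions on its interval, so in
  each variable the sum over the levels is a sum of martingale differences. Flipping one binary digit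
  changes the sign of a difference and leaves the previous ones unchanged, which yields a type 2
  inequality for even moments; iterating it over \<open>d - 1\<close> variables gives the bound
  \<open>n^((d-1)/2)\<close>.\<close>

section \<open>Convolution with hat functions\<close>

text \<open>The range (0, 1/2] of the scale makes the averaging over \<open>u\<close> exact. The
  \<open>r\<close>-th central difference at \<open>x\<close> samples the points x + j u with integer
  \<open>j\<close>, because \<open>r\<close> is even; for j > 0 the samples at x + j u and x - j u
  together sweep an interval of length \<open>j\<close>, a whole number of periods, and see only the
  mean. What remains is the value at \<open>x\<close> minus the mean. A bump has to vanish off its
  interval, so this lost mean must be restored, and that is the origin of the constant term in an
  atom.

  The averaged pairing with \<open>g\<close> is then exactly the cubature error of the sum of the
  bumps over the empty boxes, whatever the size and sign of the weights. The price is that atoms,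
  unlike bumps, are not localized. Their constant terms are small enough, (1/2)^((r+1)t) at level
  \<open>t\<close>, to be summed over all positions and levels at bounded cost.

  Only moments of order at least p/(p-1) matter. The cube has measure at most 1, so an even integer
  exponent 2 N may be used instead, and binomial expansions replace the usual square function
  estimates.\<close>

definition bounded_borel :: "(real \<Rightarrow> real) \<Rightarrow> bool" where
  "bounded_borel f \<longleftrightarrow> f \<in> borel_measurable borel \<and> (\<exists>B. \<forall>x. \<bar>f x\<bar> \<le> B)"

text \<open>The three properties are proved together because the induction step needs all of them.
  Convolution with the indicator of a window of length \<open>u\<close> multiplies the supremum by
  at most \<open>u\<close>, so \<open>u \<le> 1\<close> keeps the bound 1 at every order.\<close>

lemma hat1_Suc_props:
  assumes "0 < u" "u \<le> 1"
  shows "(\<lambda>x. hat1 (Suc k) x u) \<in> borel_measurable borel \<and>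
     (\<forall>x. 0 \<le> hat1 (Suc k) x u \<and> hat1 (Suc k) x u \<le> 1) \<and>
     (\<forall>x. hat1 (Suc k) x u \<noteq> 0 \<longrightarrow> \<bar>x\<bar> \<le> real (Suc k) * u / 2)"
proof (induction k)
  case 0
  show ?case by (auto simp: indicator_def abs_le_iff split: if_splits)
next
  case (Suc k)
  let ?h = "\<lambda>x. hat1 (Suc k) x u"
  have m[measurable]: "?h \<in> borel_measurable borel" using Suc by simp
  have b: "0 \<le> ?h x" "?h x \<le> 1" "?h x \<noteq> 0 \<Longrightarrow> \<bar>x\<bar> \<le> real (Suc k) * u / 2" for x
    using Suc by auto
  have eq: "hat1 (Suc (Suc k)) x u = (LINT y|lborel. ?h (x - y) * indicator {- u / 2..<u / 2} y)" for x
    by (simp add: convolve_def)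
  have bd: "(LINT y|lborel. ?h (x - y) * indicator {- u / 2..<u / 2} y) \<le> 1" for x
  proof -
    have "(LINT y|lborel. ?h (x - y) * indicator {- u / 2..<u / 2} y)
        \<le> (LINT y|lborel. indicator {- u / 2..<u / 2} y)"
    proof (rule integral_mono_AE')
      show "integrable lborel (indicator {- u / 2..<u / 2} :: real \<Rightarrow> real)"
        by (rule integrable_real_indicator) (use assms(1) in simp_all)
    qed (use b(1,2) in \<open>auto simp: indicator_def\<close>)
    also have "\<dots> = u" using assms by simp
    finally show ?thesis using assms by simp
  qed
  have supp: "\<bar>x\<bar> \<le> real (Suc (Suc k)) * u / 2" if "hat1 (Suc (Suc k)) x u \<noteq> 0" for x
  proof (rule ccontr)
    assume "\<not> ?thesis"
    hence "?h (x - y) * indicator {- u / 2..<u / 2} y = 0" for y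
      using b(3)[of "x - y"] by (auto simp: indicator_def field_simps abs_if split: if_splits)
    hence "(\<lambda>y. ?h (x - y) * indicator {- u / 2..<u / 2} y) = (\<lambda>_. 0)" by (rule ext)
    hence "hat1 (Suc (Suc k)) x u = 0" unfolding eq by (simp only: Bochner_Integration.integral_zero)
    thus False using that by contradiction
  qed
  have "(\<lambda>x. hat1 (Suc (Suc k)) x u) \<in> borel_measurable borel"
    unfolding eq by measurable
  moreover have "0 \<le> hat1 (Suc (Suc k)) x u" for x
    unfolding eq by (intro integral_nonneg_AE) (use b in auto)
  ultimately show ?case using bd supp eq by metis
qed

lemma
  assumes "0 < u" "u \<le> 1" "1 \<le> k"
  shows hat1_measurable: "(\<lambda>x. hat1 k x u) \<in> borel_measurable borel"
    and hat1_nonneg: "0 \<le> hat1 k x u"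
    and hat1_le_1: "hat1 k x u \<le> 1"
    and hat1_support: "hat1 k x u \<noteq> 0 \<Longrightarrow> \<bar>x\<bar> \<le> real k * u / 2"
  using hat1_Suc_props[OF assms(1,2), of "k - 1"] assms(3) by auto

lemma integrable_bounded_support:
  fixes f :: "real \<Rightarrow> real"
  assumes "f \<in> borel_measurable borel" "\<And>x. \<bar>f x\<bar> \<le> B" "\<And>x. f x \<noteq> 0 \<Longrightarrow> \<bar>x\<bar> \<le> R"
  shows "integrable lborel f"
proof (rule Bochner_Integration.integrable_bound)
  show "integrable lborel (\<lambda>x. B * indicator {-R..R} x)"
    by (rule integrable_mult_right, rule integrable_real_indicator) (simp_all add: emeasure_lborel_Icc_eq)
  show "AE x in lborel. norm (f x) \<le> norm (B * indicator {-R..R} x)"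
  proof (rule AE_I2)
    fix x
    have "0 \<le> B" using assms(2)[of 0] by linarith
    then show "norm (f x) \<le> norm (B * indicator {-R..R} x)"
      using assms(2)[of x] assms(3)[of x] by (cases "f x = 0") (auto simp: indicator_def abs_le_iff)
  qed
qed (use assms in simp)

lemma convolve_hat1_integrable:
  assumes "0 < u" "u \<le> 1" "1 \<le> k" "bounded_borel G"
  shows "integrable lborel (\<lambda>y. hat1 k (x - y) u * G y)"
proof -
  obtain B where B: "\<And>x. \<bar>G x\<bar> \<le> B" and [measurable]: "G \<in> borel_measurable borel"
    using assms(4) by (auto simp: bounded_borel_def)
  note [measurable] = hat1_measurable[OF assms(1-3)]
  show ?thesis
  proof (rule integrable_bounded_support[where B = B and R = "\<bar>x\<bar> + real k * u / 2"])
    show "\<bar>hat1 k (x - y) u * G y\<bar> \<le> B" for y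
      using mult_mono[OF hat1_le_1[OF assms(1-3), of "x - y"] B[of y]] hat1_nonneg[OF assms(1-3), of "x - y"]
      by (auto simp: abs_mult)
    show "\<bar>y\<bar> \<le> \<bar>x\<bar> + real k * u / 2" if "hat1 k (x - y) u * G y \<noteq> 0" for y
      using hat1_support[OF assms(1-3), of "x - y"] that by (auto simp: abs_le_iff field_simps abs_if split: if_splits)
  qed measurable
qed

text \<open>Convolution is associative, and convolving with \<open>hat1 1\<close> integrates over a
  sliding window. The reflection in the convolution turns the half-open indicator into a window open
  on the left, the kind of interval used in \<open>antiderivative\<close>.\<close>

lemma convolve_hat1_Suc:
  assumes u: "0 < u" "u \<le> 1" and k: "1 \<le> k" and G: "bounded_borel G"
  shows "convolve (\<lambda>t. hat1 (Suc k) t u) G x =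
    (LINT y|lborel. indicator {x - u/2<..x + u/2} y * convolve (\<lambda>t. hat1 k t u) G y)"
proof -
  obtain B where B: "\<And>x. \<bar>G x\<bar> \<le> B" and [measurable]: "G \<in> borel_measurable borel"
    using G by (auto simp: bounded_borel_def)
  note [measurable] = hat1_measurable[OF u k]
  obtain k' where k': "k = Suc k'" using k by (cases k) auto
  define f where "f = (\<lambda>t y. hat1 k (x - y - t) u * indicator {- u / 2..<u / 2} t * G y)"
  \<comment> \<open>A rectangle of finite measure that contains the support of \<open>f\<close>; it
    gives the integrability for Fubini.\<close>
  define A where "A = {- 1..1::real} \<times> {x - 1 - real k * u / 2..x + 1 + real k * u / 2}"
  have B0: "0 \<le> B" using B[of 0] by linarith
  have int: "integrable (lborel \<Otimes>\<^sub>M lborel) (case_prod f)"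
  proof (rule Bochner_Integration.integrable_bound)
    show "integrable (lborel \<Otimes>\<^sub>M lborel) (\<lambda>z. B * indicator A z)"
      unfolding A_def
      by (intro integrable_mult_right integrable_real_indicator)
         (auto simp: lborel.emeasure_pair_measure_Times ennreal_mult_less_top emeasure_lborel_Icc_eq)
    show "case_prod f \<in> borel_measurable (lborel \<Otimes>\<^sub>M lborel)"
      unfolding f_def by measurable
    have "\<bar>f t y\<bar> \<le> \<bar>B * indicator A (t, y)\<bar>" for t y
    proof (cases "f t y = 0")
      case False
      hence t: "- u / 2 \<le> t" "t < u / 2" "hat1 k (x - y - t) u \<noteq> 0"
        by (auto simp: f_def indicator_def split: if_splits)
      have "\<bar>x - y - t\<bar> \<le> real k * u / 2" by (rule hat1_support[OF u k t(3)])
      moreover have "\<bar>t\<bar> \<le> 1" using t u by linarith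
      ultimately have "(t, y) \<in> A" unfolding A_def mem_Times_iff atLeastAtMost_iff fst_conv snd_conv by linarith
      moreover have "\<bar>f t y\<bar> \<le> B"
        unfolding f_def using t
          mult_mono[OF hat1_le_1[OF u k, of "x - y - t"] B[of y]] hat1_nonneg[OF u k, of "x - y - t"]
        by (auto simp: abs_mult)
      ultimately show ?thesis using B0 by simp
    qed simp
    thus "AE z in lborel \<Otimes>\<^sub>M lborel. norm (case_prod f z) \<le> norm (B * indicator A z)"
      by (intro AE_I2) auto
  qed
  have "convolve (\<lambda>t. hat1 (Suc k) t u) G x = (LINT y|lborel. LINT t|lborel. f t y)"
    unfolding convolve_def f_def
    by (intro Bochner_Integration.integral_cong) (auto simp: k' convolve_def)
  also have "\<dots> = (LINT t|lborel. LINT y|lborel. f t y)"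
    by (rule lborel_pair.Fubini_integral[OF int])
  also have "\<dots> = (LINT t|lborel. indicator {- u / 2..<u / 2} t * convolve (\<lambda>t. hat1 k t u) G (x - t))"
  proof (intro Bochner_Integration.integral_cong refl)
    fix t
    have "(LINT y|lborel. f t y) = (LINT y|lborel. indicator {- u / 2..<u / 2} t * (hat1 k (x - t - y) u * G y))"
      unfolding f_def by (intro Bochner_Integration.integral_cong) (auto simp: algebra_simps)
    thus "(LINT y|lborel. f t y) = indicator {- u / 2..<u / 2} t * convolve (\<lambda>t. hat1 k t u) G (x - t)"
      unfolding convolve_def by (simp only: integral_mult_right_zero)
  qed
  also have "\<dots> = (LINT y|lborel. indicator {- u / 2..<u / 2} (x - y) * convolve (\<lambda>t. hat1 k t u) G y)"
    using lborel_integral_real_affine[of "-1" "\<lambda>t. indicator {- u / 2..<u / 2} t * convolve (\<lambda>t. hat1 k t u) G (x - t)" x]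
    by simp
  also have "\<dots> = (LINT y|lborel. indicator {x - u/2<..x + u/2} y * convolve (\<lambda>t. hat1 k t u) G y)"
    by (intro Bochner_Integration.integral_cong) (auto simp: indicator_def)
  finally show ?thesis .
qed

lemma convolve_hat1_1:
  "convolve (\<lambda>t. hat1 1 t u) G x = (LINT y|lborel. indicator {x - u/2<..x + u/2} y * G y)"
  unfolding convolve_def
  by (intro Bochner_Integration.integral_cong) (auto simp: indicator_def)

lemma convolve_hat1_const:
  assumes u: "0 < u" "u \<le> 1" and k: "1 \<le> k"
  shows "convolve (\<lambda>t. hat1 k t u) (\<lambda>_. 1) x = u ^ k"
  using k
proof (induction k arbitrary: x rule: nat_induct_at_least)
  case base
  show ?case unfolding convolve_hat1_1 using u by simp
next
  case (Suc n)
  have "convolve (\<lambda>t. hat1 (Suc n) t u) (\<lambda>_. 1) x = (LINT y|lborel. indicator {x - u/2<..x + u/2} y * u ^ n)"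
    by (subst convolve_hat1_Suc[OF u Suc(1)]) (auto simp: bounded_borel_def Suc)
  thus ?case using u by simp
qed

section \<open>Iterated antiderivatives and central differences\<close>

definition antiderivative :: "(real \<Rightarrow> real) \<Rightarrow> (real \<Rightarrow> real) \<Rightarrow> bool" where
  "antiderivative F G \<longleftrightarrow> bounded_borel F \<and> (\<forall>a b. a \<le> b \<longrightarrow> (LINT t|lborel. indicator {a<..b} t * F t) = G b - G a)"

text \<open>Integral identities take the place of derivatives because the innermost function is in
  the end a step function, whose primitive is not differentiable at the jumps.\<close>

inductive iterated_antiderivative :: "nat \<Rightarrow> (real \<Rightarrow> real) \<Rightarrow> (real \<Rightarrow> real) \<Rightarrow> bool" where
  zero: "bounded_borel F \<Longrightarrow> iterated_antiderivative 0 F F"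
| Suc: "iterated_antiderivative k F G \<Longrightarrow> antiderivative G H \<Longrightarrow> iterated_antiderivative (Suc k) F H"

fun central_diff :: "real \<Rightarrow> nat \<Rightarrow> (real \<Rightarrow> real) \<Rightarrow> real \<Rightarrow> real" where
  "central_diff u 0 G x = G x"
| "central_diff u (Suc k) G x = central_diff u k G (x + u / 2) - central_diff u k G (x - u / 2)"

lemma bounded_borel_integrable_Ioc: "bounded_borel F \<Longrightarrow> integrable lborel (\<lambda>t. indicator {a<..b} t * F t)"
proof -
  assume "bounded_borel F"
  then obtain B where B: "\<And>x. \<bar>F x\<bar> \<le> B" and [measurable]: "F \<in> borel_measurable borel"
    by (auto simp: bounded_borel_def)
  show ?thesis
  proof (rule integrable_bounded_support[where B = B and R = "\<bar>a\<bar> + \<bar>b\<bar>"])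
    show "\<bar>indicator {a<..b} t * F t\<bar> \<le> B" for t
      using B[of t] by (auto simp: indicator_def)
  qed (auto simp: indicator_def split: if_splits)
qed

lemma bounded_borel_shift: "bounded_borel F \<Longrightarrow> bounded_borel (\<lambda>x. F (c * x + e))"
  by (auto simp: bounded_borel_def)

lemma bounded_borel_diff: assumes "bounded_borel F" "bounded_borel G" shows "bounded_borel (\<lambda>x. F x - G x)"
proof -
  obtain A B where "\<And>x. \<bar>F x\<bar> \<le> A" "\<And>x. \<bar>G x\<bar> \<le> B" using assms by (auto simp: bounded_borel_def)
  hence "\<bar>F x - G x\<bar> \<le> A + B" for x by (meson abs_triangle_ineq4 add_mono order_trans)
  thus ?thesis using assms by (auto simp: bounded_borel_def)
qed

lemma bounded_borel_scale: assumes "bounded_borel F" shows "bounded_borel (\<lambda>x. c * F x)"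
proof -
  obtain A where "\<And>x. \<bar>F x\<bar> \<le> A" using assms by (auto simp: bounded_borel_def)
  hence "\<bar>c * F x\<bar> \<le> \<bar>c\<bar> * A" for x by (auto simp: abs_mult mult_left_mono)
  thus ?thesis using assms by (auto simp: bounded_borel_def)
qed

lemma antiderivative_diff:
  assumes "antiderivative F G" "antiderivative F' G'"
  shows "antiderivative (\<lambda>x. F x - F' x) (\<lambda>x. G x - G' x)"
  unfolding antiderivative_def
proof (intro conjI allI impI)
  show "bounded_borel (\<lambda>x. F x - F' x)" using assms by (auto simp: antiderivative_def intro: bounded_borel_diff)
  fix a b :: real assume "a \<le> b"
  then show "(LINT t|lborel. indicator {a<..b} t * (F t - F' t)) = G b - G' b - (G a - G' a)"
    using assms by (simp add: antiderivative_def right_diff_distrib bounded_borel_integrable_Ioc)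
qed

lemma antiderivative_scale:
  assumes "antiderivative F G"
  shows "antiderivative (\<lambda>x. c * F x) (\<lambda>x. c * G x)"
  unfolding antiderivative_def
proof (intro conjI allI impI)
  show "bounded_borel (\<lambda>x. c * F x)" using assms by (auto simp: antiderivative_def intro: bounded_borel_scale)
  fix a b :: real assume ab: "a \<le> b"
  have "(LINT t|lborel. indicator {a<..b} t * (c * F t)) = (LINT t|lborel. c * (indicator {a<..b} t * F t))"
    by (intro Bochner_Integration.integral_cong) auto
  also have "\<dots> = c * (G b - G a)"
    using assms ab by (simp only: antiderivative_def integral_mult_right_zero)
  finally show "(LINT t|lborel. indicator {a<..b} t * (c * F t)) = c * G b - c * G a"
    by (simp add: right_diff_distrib)
qed

lemma antiderivative_affine:
  assumes "antiderivative F G" "0 < c"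
  shows "antiderivative (\<lambda>x. F (c * x + e)) (\<lambda>x. G (c * x + e) / c)"
  unfolding antiderivative_def
proof (intro conjI allI impI)
  show "bounded_borel (\<lambda>x. F (c * x + e))" using assms by (auto simp: antiderivative_def bounded_borel_shift)
  fix a b :: real assume ab: "a \<le> b"
  have "G (c * b + e) - G (c * a + e) = (LINT t|lborel. indicator {c*a+e<..c*b+e} t * F t)"
    using assms ab by (auto simp: antiderivative_def)
  also have "\<dots> = c * (LINT t|lborel. indicator {c*a+e<..c*b+e} (e + c * t) * F (e + c * t))"
    using lborel_integral_real_affine[of c "\<lambda>t. indicator {c*a+e<..c*b+e} t * F t" e] assms by simp
  also have "(LINT t|lborel. indicator {c*a+e<..c*b+e} (e + c * t) * F (e + c * t)) =
      (LINT t|lborel. indicator {a<..b} t * F (c * t + e))"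
    using assms(2)
    by (intro Bochner_Integration.integral_cong) (auto simp: indicator_def add.commute)
  finally show "(LINT t|lborel. indicator {a<..b} t * F (c * t + e)) = G (c * b + e) / c - G (c * a + e) / c"
    using assms(2) by (simp add: field_simps)
qed

lemma central_diff_0 [simp]: "central_diff u 0 G = G"
  by (rule ext) simp

lemma central_diff_Suc': "central_diff u (Suc k) G = (\<lambda>x. central_diff u k G (x + u / 2) - central_diff u k G (x - u / 2))"
  by (rule ext) simp

lemma antiderivative_central_diff: "antiderivative F G \<Longrightarrow> antiderivative (central_diff u k F) (central_diff u k G)"
proof (induction k)
  case (Suc k)
  from antiderivative_diff[OF antiderivative_affine[OF Suc.IH[OF Suc.prems], of 1 "u/2"] antiderivative_affine[OF Suc.IH[OF Suc.prems], of 1 "-u/2"]]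
  show ?case by (simp add: central_diff_Suc')
qed simp

lemma iterated_antiderivative_diff: 
  assumes "iterated_antiderivative k F G" "iterated_antiderivative k F' G'" 
  shows "iterated_antiderivative k (\<lambda>x. F x - F' x) (\<lambda>x. G x - G' x)"
  using assms
proof (induction arbitrary: F' G' rule: iterated_antiderivative.induct)
  case (zero F)
  from zero.prems show ?case by cases (use zero in \<open>auto intro: iterated_antiderivative.zero bounded_borel_diff\<close>)
next
  case (Suc k F G H)
  from Suc.prems show ?case by cases (use Suc in \<open>auto intro: iterated_antiderivative.Suc antiderivative_diff\<close>)
qed

lemma iterated_antiderivative_affine:
  assumes "iterated_antiderivative k F G" "0 < c"
  shows "iterated_antiderivative k (\<lambda>x. F (c * x + e)) (\<lambda>x. (1 / c) ^ k * G (c * x + e))"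
  using assms
proof (induction rule: iterated_antiderivative.induct)
  case (zero F)
  have "iterated_antiderivative 0 (\<lambda>x. F (c * x + e)) (\<lambda>x. F (c * x + e))"
    by (intro iterated_antiderivative.zero bounded_borel_shift zero)
  thus ?case by simp
next
  case (Suc k F G H)
  show ?case
    using iterated_antiderivative.Suc[OF Suc.IH[OF Suc.prems] antiderivative_scale[OF antiderivative_affine[OF Suc.hyps(2) Suc.prems, of e]]]
    by (simp add: power_one_over field_simps)
qed

text \<open>Each of the \<open>k\<close> factors \<open>hat1 1\<close> integrates over a window of
  length \<open>u\<close>; applied to a function with a known antiderivative, this is one central
  difference. So \<open>k\<close> factors use up \<open>k\<close> antiderivatives.\<close>

lemma convolve_hat1_antiderivative:
  assumes u: "0 < u" "u \<le> 1"
  shows "iterated_antiderivative k F G \<Longrightarrow> 1 \<le> k \<Longrightarrow> convolve (\<lambda>t. hat1 k t u) F x = central_diff u k G x"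
proof (induction arbitrary: x rule: iterated_antiderivative.induct)
  case (Suc k F G H)
  have F: "bounded_borel F" using Suc.hyps(1) by (induction rule: iterated_antiderivative.induct)
  have ab: "x - u/2 \<le> x + u/2" using u by simp
  show ?case
  proof (cases "k = 0")
    case True
    \<comment> \<open>One factor is the true base case: \<open>hat1 0\<close> is a dummy and not a
      unit for convolution.\<close>
    with Suc.hyps have "G = F" by (auto elim: iterated_antiderivative.cases)
    with Suc.hyps(2) ab True show ?thesis by (simp add: convolve_hat1_1[simplified] antiderivative_def)
  next
    case False
    hence k: "1 \<le> k" by simp
    show ?thesis
      unfolding convolve_hat1_Suc[OF u k F] Suc.IH[OF k]
      using antiderivative_central_diff[OF Suc.hyps(2), of u k] ab by (simp add: antiderivative_def)
  qed
qed simp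

section \<open>Dyadic bump functions\<close>

text \<open>On [0, 1) this is the product of the first \<open>r\<close> Rademacher functions;
  outside it vanishes. It depends on the first \<open>r\<close> binary digits only, and each of them
  controls its sign.\<close>

fun rademacher :: "nat \<Rightarrow> real \<Rightarrow> real" where
  "rademacher 0 x = indicator {0..<1} x"
| "rademacher (Suc r) x = rademacher r (2 * x) - rademacher r (2 * x - 1)"

text \<open>This is the \<open>r\<close>-fold antiderivative of \<open>rademacher r\<close>.
  Integrating the recursion of \<open>rademacher\<close> \<open>r\<close> times gives (1/2)^r (bump
  r (2x) - bump r (2x-1)); one more integration contributes another 1/2 and the window. In this form
  nonnegativity is visible.\<close>

fun bump :: "nat \<Rightarrow> real \<Rightarrow> real" where
  "bump 0 x = indicator {0..<1} x"
| "bump (Suc r) x = (1 / 2) ^ Suc r * (LINT t|lborel. indicator {2 * x - 1<..2 * x} t * bump r t)"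

lemma rademacher_support: "rademacher r x \<noteq> 0 \<Longrightarrow> 0 \<le> x \<and> x < 1"
proof (induction r arbitrary: x)
  case (Suc r)
  hence "rademacher r (2 * x) \<noteq> 0 \<or> rademacher r (2 * x - 1) \<noteq> 0" by auto
  with Suc.IH[of "2 * x"] Suc.IH[of "2 * x - 1"] show ?case by linarith
qed (auto simp: indicator_def split: if_splits)

lemma rademacher_bound: "\<bar>rademacher r x\<bar> \<le> 1"
proof (induction r arbitrary: x)
  case (Suc r)
  have "rademacher r (2 * x) = 0 \<or> rademacher r (2 * x - 1) = 0"
    using rademacher_support[of r "2 * x"] rademacher_support[of r "2 * x - 1"] by linarith
  with Suc[of "2 * x"] Suc[of "2 * x - 1"] show ?case by auto
qed (auto simp: indicator_def)

lemma rademacher_measurable [measurable]: "rademacher r \<in> borel_measurable borel"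
proof (induction r)
  case 0
  have "rademacher 0 = indicator {0..<1}" by (rule ext) simp
  thus ?case by simp
next
  case (Suc r)
  note [measurable] = Suc
  have "rademacher (Suc r) = (\<lambda>x. rademacher r (2 * x) - rademacher r (2 * x - 1))" by (rule ext) simp
  thus ?case by simp
qed

lemma bounded_borel_rademacher: "bounded_borel (rademacher r)"
  using rademacher_bound[of r] by (auto simp: bounded_borel_def)

lemma bounded_borel_ind: "bounded_borel (indicator {0..<1})"
  by (auto simp: bounded_borel_def indicator_def intro!: exI[of _ 1])

lemma integrable_rademacher: "integrable lborel (rademacher r)"
  by (rule integrable_bounded_support[where B = 1 and R = 1])
     (use rademacher_bound rademacher_support in \<open>auto simp: abs_le_iff\<close>, fastforce+)

lemma integral_rademacher: "1 \<le> r \<Longrightarrow> (LINT y|lborel. rademacher r y) = 0"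
proof (cases r)
  case (Suc k)
  have i: "integrable lborel (\<lambda>y. rademacher k (e + 2 * y))" for e
    by (rule lborel_integrable_real_affine[OF integrable_rademacher]) simp
  have "2 * (LINT y|lborel. rademacher k (e + 2 * y)) = (LINT y|lborel. rademacher k y)" for e
    using lborel_integral_real_affine[of 2 "rademacher k" e] by simp
  from this[of 0] this[of "-1"] have "(LINT y|lborel. rademacher k (0 + 2 * y)) = (LINT y|lborel. rademacher k (-1 + 2 * y))"
    by linarith
  moreover have "rademacher r y = rademacher k (0 + 2 * y) - rademacher k (-1 + 2 * y)" for y
    by (simp add: Suc)
  ultimately show ?thesis using i[of 0] i[of "-1"] by simp
qed simp

section \<open>Primitives of functions supported in the unit interval\<close>

definition cumulative :: "(real \<Rightarrow> real) \<Rightarrow> real \<Rightarrow> real" where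
  "cumulative f y = (LINT t|lborel. indicator {..y} t * f t)"

lemma
  assumes "bounded_borel f" and "\<And>x. f x \<noteq> 0 \<Longrightarrow> 0 \<le> x \<and> x < 1"
  shows integrable_unit_support: "integrable lborel f"
    and antiderivative_cumulative: "antiderivative f (cumulative f)"
    and cumulative_low: "y \<le> 0 \<Longrightarrow> cumulative f y = 0"
    and cumulative_high: "1 \<le> y \<Longrightarrow> cumulative f y = (LINT t|lborel. f t)"
proof -
  from assms(1) obtain B where B: "\<And>x. \<bar>f x\<bar> \<le> B" and [measurable]: "f \<in> borel_measurable borel"
    by (auto simp: bounded_borel_def)
  have supp: "\<bar>x\<bar> \<le> 1" if "f x \<noteq> 0" for x using assms(2)[OF that] by auto
  show i: "integrable lborel f"
    by (rule integrable_bounded_support[where B = B and R = 1]) (use B supp in auto)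
  have ii: "integrable lborel (\<lambda>t. indicator {..y} t * f t)" for y
    by (rule integrable_bounded_support[where B = B and R = 1])
       (use B supp in \<open>auto simp: indicator_def order_trans[OF abs_ge_zero B] split: if_splits\<close>)
  show "antiderivative f (cumulative f)"
    unfolding antiderivative_def
  proof (intro conjI allI impI assms(1))
    fix a b :: real assume ab: "a \<le> b"
    have "(LINT t|lborel. indicator {a<..b} t * f t) =
      (LINT t|lborel. indicator {..b} t * f t - indicator {..a} t * f t)"
      using ab by (intro Bochner_Integration.integral_cong) (auto simp: indicator_def)
    thus "(LINT t|lborel. indicator {a<..b} t * f t) = cumulative f b - cumulative f a"
      using ii by (simp add: cumulative_def)
  qed
  show "cumulative f y = 0" if "y \<le> 0"
  proof -
    \<comment> \<open>For y = 0 the point 0 itself may carry a nonzero value, so the integrand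
      vanishes only almost everywhere.\<close>
    have "AE t in lborel. indicator {..y} t * f t = 0"
      using AE_lborel_singleton[of 0]
    proof eventually_elim
      case (elim t)
      then show ?case using assms(2)[of t] that by (cases "f t = 0") (auto simp: indicator_def)
    qed
    thus ?thesis unfolding cumulative_def by (subst integral_eq_zero_AE) auto
  qed
  show "cumulative f y = (LINT t|lborel. f t)" if "1 \<le> y"
    unfolding cumulative_def using assms(2) that
    by (intro Bochner_Integration.integral_cong) (force simp: indicator_def)+
qed

lemma cumulative_mono:
  assumes "bounded_borel f" "\<And>x. f x \<noteq> 0 \<Longrightarrow> 0 \<le> x \<and> x < 1" "\<And>x. 0 \<le> f x"
  shows "mono (cumulative f)"
proof (rule monoI)
  fix a b :: real assume "a \<le> b"
  with antiderivative_cumulative[OF assms(1,2)] 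
  have "cumulative f b - cumulative f a = (LINT t|lborel. indicator {a<..b} t * f t)" by (auto simp: antiderivative_def)
  also have "\<dots> \<ge> 0" using assms(3) by (intro integral_nonneg_AE) auto
  finally show "cumulative f a \<le> cumulative f b" by simp
qed

lemma bump_props:
  "bounded_borel (bump r) \<and> (\<forall>x. 0 \<le> bump r x \<and> bump r x \<le> 1) \<and> (\<forall>x. bump r x \<noteq> 0 \<longrightarrow> 0 \<le> x \<and> x < 1)"
proof (induction r)
  case 0
  have "bump 0 = indicator {0..<1}" by (rule ext) simp
  hence "bounded_borel (bump 0)" using bounded_borel_ind by (simp only:)
  thus ?case by (intro conjI, assumption) (auto simp: indicator_def)
next
  case (Suc r)
  hence b: "bounded_borel (bump r)" and bd: "\<And>x. 0 \<le> bump r x" "\<And>x. bump r x \<le> 1"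
    and supp: "\<And>x. bump r x \<noteq> 0 \<Longrightarrow> 0 \<le> x \<and> x < 1" by auto
  have nn: "0 \<le> bump (Suc r) x" for x
    using bd by (auto intro!: mult_nonneg_nonneg integral_nonneg_AE)
  have le: "bump (Suc r) x \<le> 1" for x
  proof -
    have "(LINT t|lborel. indicator {2 * x - 1<..2 * x} t * bump r t) \<le> (LINT t|lborel. indicator {2 * x - 1<..2 * x} t)"
    proof (rule integral_mono_AE')
      show "integrable lborel (indicator {2 * x - 1<..2 * x} :: real \<Rightarrow> real)"
        by (rule integrable_real_indicator) simp_all
    qed (use bd in \<open>auto simp: indicator_def\<close>)
    also have "\<dots> = 1" by simp
    finally have "(LINT t|lborel. indicator {2 * x - 1<..2 * x} t * bump r t) \<le> 1" .
    moreover have "(1/2)^Suc r \<le> (1::real)" by (rule power_le_one) auto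
    ultimately have "(1/2)^Suc r * (LINT t|lborel. indicator {2 * x - 1<..2 * x} t * bump r t) \<le> 1 * 1"
      using bd by (intro mult_mono integral_nonneg_AE) auto
    thus ?thesis by simp
  qed
  have sp: "0 \<le> x \<and> x < 1" if "bump (Suc r) x \<noteq> 0" for x
  proof (rule ccontr)
    assume "\<not> ?thesis"
    hence "indicator {2 * x - 1<..2 * x} t * bump r t = 0" for t
      using supp[of t] by (cases "bump r t = 0") (auto simp: indicator_def)
    hence "(\<lambda>t. indicator {2 * x - 1<..2 * x} t * bump r t) = (\<lambda>_. 0)" by (rule ext)
    hence "bump (Suc r) x = 0" by (simp only: bump.simps Bochner_Integration.integral_zero mult_zero_right)
    with that show False by contradiction
  qed
  \<comment> \<open>Measurability is taken from the primitive, which is monotone since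
    \<open>bump r\<close> is nonnegative.\<close>
  have "bump (Suc r) x = (1/2)^Suc r * (cumulative (bump r) (2 * x) - cumulative (bump r) (2 * x - 1))" for x
    using antiderivative_cumulative[OF b supp] by (simp add: antiderivative_def)
  moreover have [measurable]: "cumulative (bump r) \<in> borel_measurable borel"
    by (rule borel_measurable_mono[OF cumulative_mono[OF b supp bd(1)]])
  ultimately have "bump (Suc r) = (\<lambda>x. (1/2)^Suc r * (cumulative (bump r) (2 * x) - cumulative (bump r) (2 * x - 1)))"
    by blast
  also have "\<dots> \<in> borel_measurable borel" by measurable
  finally have "bounded_borel (bump (Suc r))"
    unfolding bounded_borel_def using nn le by (intro conjI exI[of _ 1]) auto
  with nn le sp show ?case by blast
qed

lemma bounded_borel_bump: "bounded_borel (bump r)" and bump_nonneg: "0 \<le> bump r x"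
  and bump_support: "bump r x \<noteq> 0 \<Longrightarrow> 0 \<le> x \<and> x < 1"
  using bump_props[of r] by auto

lemma iterated_antiderivative_bump: "iterated_antiderivative r (rademacher r) (bump r)"
proof (induction r)
  case 0
  have "bump 0 = rademacher 0" by (rule ext) simp
  thus ?case using iterated_antiderivative.zero[OF bounded_borel_rademacher, of 0] by (simp only:)
next
  case (Suc r)
  let ?A = "cumulative (bump r)"
  have A: "antiderivative (bump r) ?A" by (rule antiderivative_cumulative[OF bounded_borel_bump bump_support])
  have 1: "iterated_antiderivative r (\<lambda>x. rademacher r (2 * x + 0) - rademacher r (2 * x + (-1)))
     (\<lambda>x. (1/2)^r * bump r (2 * x + 0) - (1/2)^r * bump r (2 * x + (-1)))"
    by (intro iterated_antiderivative_diff iterated_antiderivative_affine Suc) auto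
  have 2: "antiderivative (\<lambda>x. (1/2)^r * bump r (2 * x + 0) - (1/2)^r * bump r (2 * x + (-1)))
     (\<lambda>x. (1/2)^r * (?A (2 * x + 0) / 2) - (1/2)^r * (?A (2 * x + (-1)) / 2))"
    by (intro antiderivative_diff antiderivative_scale antiderivative_affine A) auto
  have "bump (Suc r) = (\<lambda>x. (1/2)^r * (?A (2 * x + 0) / 2) - (1/2)^r * (?A (2 * x + (-1)) / 2))"
    using A by (intro ext) (simp add: antiderivative_def field_simps)
  moreover have "rademacher (Suc r) = (\<lambda>x. rademacher r (2 * x + 0) - rademacher r (2 * x + (-1)))"
    by (intro ext) simp
  ultimately show ?case using iterated_antiderivative.Suc[OF 1 2] by simp
qed

definition bump_mass :: "nat \<Rightarrow> real" where
  "bump_mass r = (LINT t|lborel. bump r t)"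

text \<open>A positive lower bound on the middle half survives the recursion: for \<open>x\<close>
  there, the window (2x-1, 2x] contains (1/4, 1/2] or (1/2, 3/4], each of which lies in the middle
  half again. This makes the mass of the bump positive.\<close>

lemma bump_lower: "\<exists>c>0. \<forall>x\<in>{1/4..3/4}. c \<le> bump r x"
proof (induction r)
  case 0
  show ?case by (intro exI[of _ 1]) auto
next
  case (Suc r)
  then obtain c where c: "c > 0" "\<And>x. x \<in> {1/4..3/4} \<Longrightarrow> c \<le> bump r x" by blast
  have "(1/2)^Suc r * (c / 4) \<le> bump (Suc r) x" if x: "x \<in> {1/4..3/4}" for x
  proof -
    define a :: real where "a = (if x \<le> 1/2 then 1/4 else 1/2)"
    have a: "{a<..a + 1/4} \<subseteq> {2 * x - 1<..2 * x}" "{a<..a+1/4} \<subseteq> {1/4..3/4}"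
      using x by (auto simp: a_def)
    have "c / 4 = (LINT t|lborel. indicator {a<..a + 1/4} t * c)"
      by (subst Bochner_Integration.integral_mult_left_zero) simp
    also have "\<dots> \<le> (LINT t|lborel. indicator {2 * x - 1<..2 * x} t * bump r t)"
      using a c bump_nonneg[of r]
      by (intro integral_mono bounded_borel_integrable_Ioc bounded_borel_bump) 
         (auto simp: indicator_def subset_iff bounded_borel_def)
    finally show ?thesis by simp
  qed
  thus ?case using c(1) by (intro exI[of _ "(1/2)^Suc r * (c / 4)"]) auto
qed

lemma bump_mass_pos: "0 < bump_mass r"
proof -
  obtain c where c: "c > 0" "\<And>x. x \<in> {1/4..3/4} \<Longrightarrow> c \<le> bump r x" using bump_lower by blast
  have "c / 2 = (LINT t|lborel. indicator {1/4<..3/4::real} t * c)"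
    by (subst Bochner_Integration.integral_mult_left_zero) simp
  also have "\<dots> \<le> bump_mass r"
    unfolding bump_mass_def using c bump_nonneg[of r]
    by (intro integral_mono bounded_borel_integrable_Ioc integrable_unit_support[OF bounded_borel_bump bump_support])
       (auto simp: indicator_def bounded_borel_def)
  finally show ?thesis using c(1) by simp
qed

lemma sum_choose_Suc:
  fixes a :: "nat \<Rightarrow> real"
  shows "(\<Sum>l\<le>Suc k. real (Suc k choose l) * a l) =
     (\<Sum>l\<le>k. real (k choose l) * a l) + (\<Sum>l\<le>k. real (k choose l) * a (Suc l))"
proof -
  have "(\<Sum>l\<le>Suc k. real (Suc k choose l) * a l) = a 0 + (\<Sum>l\<le>k. real (Suc k choose Suc l) * a (Suc l))"
    by (subst sum.atMost_Suc_shift) simp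
  also have "\<dots> = a 0 + (\<Sum>l\<le>k. real (k choose Suc l) * a (Suc l)) + (\<Sum>l\<le>k. real (k choose l) * a (Suc l))"
    by (simp add: algebra_simps sum.distrib)
  also have "a 0 + (\<Sum>l\<le>k. real (k choose Suc l) * a (Suc l)) = (\<Sum>l\<le>Suc k. real (k choose l) * a l)"
    by (subst sum.atMost_Suc_shift) simp
  finally show ?thesis by simp
qed

lemma central_diff_expand:
  "central_diff u k G x = (\<Sum>l\<le>k. (-1)^l * real (k choose l) * G (x + (real k / 2 - real l) * u))"
proof (induction k arbitrary: x)
  case (Suc k)
  have "(\<Sum>l\<le>Suc k. (-1)^l * real (Suc k choose l) * G (x + (real (Suc k) / 2 - real l) * u)) =
    (\<Sum>l\<le>Suc k. real (Suc k choose l) * ((-1)^l * G (x + (real (Suc k) / 2 - real l) * u)))"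
    by (intro sum.cong) auto
  also have "\<dots> = central_diff u (Suc k) G x"
    unfolding sum_choose_Suc central_diff.simps Suc
    by (simp add: algebra_simps add_divide_distrib sum_negf)
  finally show ?case by simp
qed simp

section \<open>Test functions in one variable\<close>

lemma int_telescope:
  fixes g :: "int \<Rightarrow> real"
  assumes "a \<le> b"
  shows "(\<Sum>n\<in>{a..b}. g (n + 1) - g n) = g (b + 1) - g a"
  using assms
proof (induction b rule: int_ge_induct)
  case (step i)
  have "{a..i + 1} = insert (i + 1) {a..i}" using step by auto
  thus ?case using step by simp
qed simp

text \<open>Here \<open>f\<close> will be a dyadic bump and r = 2 h, so that \<open>{-N..N}\<close>
  is the window of \<open>periodic_hat1\<close>. Shifts j u with |j| at most \<open>h\<close> and u
  at most 1/2 move a point by at most h/2, hence for \<open>x\<close> in [0, 1) the window contains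
  every nonzero term of the periodization.\<close>

locale unit_supported =
  fixes f :: "real \<Rightarrow> real" and h :: nat
  assumes bm: "bounded_borel f" and supp: "f x \<noteq> 0 \<Longrightarrow> 0 \<le> x \<and> x < 1"
begin

abbreviation "N \<equiv> 2 * int h + 1"
abbreviation "M \<equiv> LINT t|lborel. f t"
definition scale_integral :: "real \<Rightarrow> real \<Rightarrow> real" where
  "scale_integral x j = (LINT u|lborel. indicator {0<..1/2} u * (\<Sum>n\<in>{-N..N}. f (of_int n + x + j * u)))"

lemma integrable_scale: "integrable lborel (\<lambda>u. indicator {0<..1/2} u * f (y + j * u))"
  using bounded_borel_integrable_Ioc[OF bounded_borel_shift[OF bm, of j y], of 0 "1/2"] by (simp add: add.commute)

lemma integral_Ico: assumes "a \<le> b" shows "(LINT t|lborel. indicator {a..<b} t * f t) = cumulative f b - cumulative f a"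
proof -
  have [measurable]: "f \<in> borel_measurable borel" using bm by (auto simp: bounded_borel_def)
  have "(LINT t|lborel. indicator {a..<b} t * f t) = (LINT t|lborel. indicator {a<..b} t * f t)"
  proof (rule integral_cong_AE)
    show "AE t in lborel. indicator {a..<b} t * f t = indicator {a<..b} t * f t"
      using AE_lborel_singleton[of a] AE_lborel_singleton[of b]
      by eventually_elim (auto simp: indicator_def)
  qed measurable
  thus ?thesis using antiderivative_cumulative[OF bm supp] assms by (simp add: antiderivative_def)
qed

lemma integral_scale_pos: assumes "0 < j" shows "(LINT u|lborel. indicator {0<..1/2} u * f (y + j * u)) = (cumulative f (y + j / 2) - cumulative f y) / j"
proof -
  have "(LINT u|lborel. indicator {0<..1/2} u * f (j * u + y)) = cumulative f (j * (1/2) + y) / j - cumulative f (j * 0 + y) / j"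
    using antiderivative_affine[OF antiderivative_cumulative[OF bm supp] assms, of y] by (simp add: antiderivative_def)
  thus ?thesis by (simp add: algebra_simps diff_divide_distrib)
qed

lemma integral_scale_neg: assumes "0 < j" shows "(LINT u|lborel. indicator {0<..1/2} u * f (y - j * u)) = (cumulative f y - cumulative f (y - j / 2)) / j"
proof -
  have "(LINT t|lborel. indicator {y - j/2..<y} t * f t) =
     j * (LINT u|lborel. indicator {y - j/2..<y} (y + (-j) * u) * f (y + (-j) * u))"
    using lborel_integral_real_affine[of "-j" "\<lambda>t. indicator {y - j/2..<y} t * f t" y] assms by simp
  also have "(LINT u|lborel. indicator {y - j/2..<y} (y + (-j) * u) * f (y + (-j) * u)) =
     (LINT u|lborel. indicator {0<..1/2} u * f (y - j * u))"
    using assms by (intro Bochner_Integration.integral_cong) (auto simp: indicator_def zero_less_mult_iff)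
  finally show ?thesis using integral_Ico[of "y - j / 2" y] assms by (simp add: field_simps)
qed

lemma scale_integral_sum: "scale_integral x j = (\<Sum>n\<in>{-N..N}. LINT u|lborel. indicator {0<..1/2} u * f (of_int n + x + j * u))"
  unfolding scale_integral_def sum_distrib_left by (intro Bochner_Integration.integral_sum integrable_scale)

text \<open>A step of one full period collects the whole mass: its increments telescope in
  \<open>n\<close>, and at the two ends of the window the primitive has already reached
  \<open>M\<close> and 0. Then \<open>j\<close> such steps are added.\<close>

lemma cumulative_telescope:
  assumes "- real h / 2 \<le> y" "j \<le> h" "y + real j \<le> 1 + real h / 2"
  shows "(\<Sum>n\<in>{-N..N}. cumulative f (of_int n + y + real j) - cumulative f (of_int n + y)) = real j * M"
  using assms(2,3)
proof (induction j)
  case (Suc j)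
  have "(\<Sum>n\<in>{-N..N}. cumulative f (of_int n + y + real (Suc j)) - cumulative f (of_int n + y + real j)) =
     (\<Sum>n\<in>{-N..N}. (\<lambda>n. cumulative f (of_int n + y + real j)) (n + 1) - (\<lambda>n. cumulative f (of_int n + y + real j)) n)"
    by (intro sum.cong) (auto simp: algebra_simps)
  also have "\<dots> = cumulative f (of_int (N + 1) + y + real j) - cumulative f (of_int (-N) + y + real j)"
    by (subst int_telescope) auto
  also have "cumulative f (of_int (N + 1) + y + real j) = M"
    by (rule cumulative_high[OF bm supp]) (use assms(1) in auto)
  also have "cumulative f (of_int (-N) + y + real j) = 0"
    by (rule cumulative_low[OF bm supp]) (use Suc.prems in auto)
  finally have 1: "(\<Sum>n\<in>{-N..N}. cumulative f (of_int n + y + real (Suc j)) - cumulative f (of_int n + y + real j)) = M" by simp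
  have 2: "(\<Sum>n\<in>{-N..N}. cumulative f (of_int n + y + real j) - cumulative f (of_int n + y)) = real j * M"
    using Suc.prems by (intro Suc.IH) auto
  show ?case using 1 2 by (simp add: sum_subtractf algebra_simps)
qed simp

text \<open>Substituting t = x + j u and t = x - j u, the two averages join into 1/j times the
  integral of the periodization over [x - j/2, x + j/2], which consists of \<open>j\<close> full
  periods.\<close>

lemma scale_integral_pair:
  assumes x: "0 \<le> x" "x < 1" and j: "1 \<le> j" "j \<le> h"
  shows "scale_integral x (real j) + scale_integral x (- real j) = M"
proof -
  have "scale_integral x (real j) + scale_integral x (- real j) = (\<Sum>n\<in>{-N..N}. (cumulative f (of_int n + x + real j / 2) - cumulative f (of_int n + x - real j / 2)) / real j)"
    unfolding scale_integral_sum sum.distrib[symmetric]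
  proof (intro sum.cong refl)
    fix n
    show "(LINT u|lborel. indicator {0<..1/2} u * f (of_int n + x + real j * u)) +
      (LINT u|lborel. indicator {0<..1/2} u * f (of_int n + x + - real j * u)) =
      (cumulative f (of_int n + x + real j / 2) - cumulative f (of_int n + x - real j / 2)) / real j"
      using integral_scale_pos[of "real j" "of_int n + x"] integral_scale_neg[of "real j" "of_int n + x"] j by (simp add: field_simps)
  qed
  also have "\<dots> = (\<Sum>n\<in>{-N..N}. cumulative f (of_int n + (x - real j / 2) + real j) - cumulative f (of_int n + (x - real j / 2))) / real j"
    unfolding sum_divide_distrib by (intro sum.cong refl) (simp add: algebra_simps)
  also have "\<dots> = M"
    using x j by (subst cumulative_telescope) auto
  finally show ?thesis .
qed

lemma scale_integral_0:
  assumes x: "0 \<le> x" "x < 1"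
  shows "scale_integral x 0 = f x / 2"
proof -
  have "f (of_int n + x) = (if n = 0 then f x else 0)" for n
  proof (cases "n = 0")
    case False
    hence "of_int n + x \<ge> 1 \<or> of_int n + x < 0" using x by linarith
    thus ?thesis using supp[of "of_int n + x"] False by fastforce
  qed simp
  hence "(\<Sum>n\<in>{-N..N}. f (of_int n + x)) = f x" by simp
  thus ?thesis unfolding scale_integral_def by simp
qed

lemma central_diff_integral:
  assumes x: "0 \<le> x" "x < 1" and h: "1 \<le> h"
  shows "integrable lborel (\<lambda>u. indicator {0<..1/2} u * (\<Sum>n\<in>{-N..N}. central_diff u (2 * h) f (of_int n + x)))" (is ?A)
    and "(LINT u|lborel. indicator {0<..1/2} u * (\<Sum>n\<in>{-N..N}. central_diff u (2 * h) f (of_int n + x))) =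
       (-1) ^ h * real (2 * h choose h) / 2 * (f x - M)" (is ?B)
proof -
  let ?c = "\<lambda>l. (-1)^l * real (2 * h choose l)"
  have eq: "indicator {0<..1/2} u * (\<Sum>n\<in>{-N..N}. central_diff u (2 * h) f (of_int n + x)) =
    (\<Sum>l\<le>2 * h. ?c l * (indicator {0<..1/2} u * (\<Sum>n\<in>{-N..N}. f (of_int n + x + (real h - real l) * u))))" for u
    unfolding central_diff_expand sum_distrib_left
    by (subst sum.swap) (intro sum.cong refl, simp add: mult_ac)
  have int: "integrable lborel (\<lambda>u. indicator {0<..1/2} u * (\<Sum>n\<in>{-N..N}. f (of_int n + x + j * u)))" for j
    unfolding sum_distrib_left by (intro Bochner_Integration.integrable_sum integrable_scale)
  show ?A unfolding eq by (intro Bochner_Integration.integrable_sum integrable_mult_right int)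
  have S: "(LINT u|lborel. indicator {0<..1/2} u * (\<Sum>n\<in>{-N..N}. central_diff u (2 * h) f (of_int n + x))) =
     (\<Sum>l\<le>2 * h. ?c l * scale_integral x (real h - real l))"
    unfolding eq scale_integral_def
    by (simp only: Bochner_Integration.integral_sum[OF integrable_mult_right[OF int]] integral_mult_right_zero)
  \<comment> \<open>Only the middle term and the pairs \<open>j, -j\<close> matter; each pair averages to the mean.\<close>
  have sym: "(\<Sum>l\<le>2 * h. ?c l * scale_integral x (real h - real l)) = (\<Sum>l\<le>2 * h. ?c l * scale_integral x (real l - real h))"
  proof (rule sum.reindex_bij_witness[where i = "\<lambda>l. 2 * h - l" and j = "\<lambda>l. 2 * h - l"])
    fix l assume l: "l \<in> {..2 * h}"
    have "(-1::real)^(2 * h - l) = (-1)^l"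
      using l by (simp add: minus_one_power_iff)
    moreover have "2 * h choose (2 * h - l) = 2 * h choose l"
      using l by (simp add: binomial_symmetric[symmetric])
    ultimately show "?c (2 * h - l) * scale_integral x (real (2 * h - l) - real h) = ?c l * scale_integral x (real h - real l)"
      using l by (simp add: of_nat_diff algebra_simps)
  qed auto
  have c0: "(\<Sum>l\<le>2 * h. ?c l) = 0"
    using choose_alternating_sum[of "2 * h", where 'a = real] h by simp
  have "2 * (\<Sum>l\<le>2 * h. ?c l * scale_integral x (real h - real l)) =
     (\<Sum>l\<le>2 * h. ?c l * (scale_integral x (real h - real l) + scale_integral x (real l - real h)))"
    using sym by (simp add: distrib_left sum.distrib)
  \<comment> \<open>For l = h both members of the pair are f x / 2. Writing every pair as
    \<open>M\<close> plus a correction at l = h lets the alternating binomial sum remove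
    \<open>M\<close>.\<close>
  also have "\<dots> = (\<Sum>l\<le>2 * h. ?c l * M + (if l = h then ?c h * (f x - M) else 0))"
  proof (intro sum.cong refl)
    fix l assume l: "l \<in> {..2 * h}"
    consider "l = h" | "l < h" | "h < l" by linarith
    thus "?c l * (scale_integral x (real h - real l) + scale_integral x (real l - real h)) = ?c l * M + (if l = h then ?c h * (f x - M) else 0)"
    proof cases
      case 1
      thus ?thesis using scale_integral_0[OF x] by (simp add: algebra_simps)
    next
      case 2
      thus ?thesis using scale_integral_pair[OF x, of "h - l"] by (simp add: of_nat_diff)
    next
      case 3
      thus ?thesis using scale_integral_pair[OF x, of "l - h"] l by (simp add: of_nat_diff add.commute)
    qed
  qed
  also have "\<dots> = ?c h * (f x - M)"
    using c0 by (simp add: sum.distrib sum_distrib_right[symmetric])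
  finally show ?B unfolding S by simp
qed

end

text \<open>For \<open>u \<le> 1/2\<close> the hat function is supported in \<open>[-r/4, r/4]\<close>, so for \<open>t\<close> in \<open>(-1, 1)\<close> this finite
  window contains all nonzero terms of the periodization.\<close>

definition periodic_hat1 :: "nat \<Rightarrow> real \<Rightarrow> real \<Rightarrow> real" where
  "periodic_hat1 r t u = (\<Sum>n\<in>{- (int r + 1)..int r + 1}. hat1 r (of_int n + t) u)"

definition osc_coeff :: "nat \<Rightarrow> real" where
  "osc_coeff r = 2 * (-1) ^ (r div 2) / real (r choose (r div 2))"

text \<open>The factor (r + 1) 2^(r + 1) is the reciprocal of the integral of u^r over (0, 1/2], see
  \<open>half_power_integral\<close>; the constant function 1 is smoothed to u^r.\<close>

definition mean_coeff :: "nat \<Rightarrow> real" where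
  "mean_coeff r = real (r + 1) * 2 ^ (r + 1) * bump_mass r"

text \<open>The coefficients are dictated by \<open>atom_smoothing\<close>: the central binomial coefficient of the \<open>r\<close>-th
  central difference has to be cancelled, and the constant term restores the mean which the
  oscillating part loses.\<close>

definition atom :: "nat \<Rightarrow> nat \<Rightarrow> nat \<Rightarrow> real \<Rightarrow> real" where
  "atom r t l y = osc_coeff r * rademacher r (2 ^ t * y - real l) + mean_coeff r * (1/2) ^ ((r + 1) * t) * indicator {0..<1} y"

text \<open>The factor (1/2)^(r t) comes from \<open>r\<close> integrations under the substitution
  by 2^t y. So this is the \<open>r\<close>-fold antiderivative of the oscillating part of an atom,
  up to \<open>osc_coeff\<close>.\<close>

definition dyadic_bump :: "nat \<Rightarrow> nat \<Rightarrow> nat \<Rightarrow> real \<Rightarrow> real" where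
  "dyadic_bump r t l y = (1/2) ^ (r * t) * bump r (2 ^ t * y - real l)"

lemma dyadic_unit: assumes "l < 2 ^ t" "0 \<le> 2 ^ t * y - real l" "2 ^ t * y - real l < 1" shows "0 \<le> y \<and> y < 1"
proof -
  have "0 \<le> 2 ^ t * y" using assms(2) by (smt (verit) of_nat_0_le_iff)
  hence "0 \<le> y" using mult_le_cancel_left_pos[of "2 ^ t" 0 y] by simp
  have "real l + 1 \<le> 2 ^ t" using assms(1) by (metis Suc_leI add.commute numeral_power_eq_of_nat_cancel_iff of_nat_Suc of_nat_le_iff)
  hence "2 ^ t * y < 2 ^ t * 1" using assms(3) by linarith
  hence "y < 1" using mult_less_cancel_left_pos[of "2 ^ t" y 1] by simp
  with \<open>0 \<le> y\<close> show ?thesis by simp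
qed

lemma dyadic_bump_bounded_borel: "bounded_borel (dyadic_bump r t l)"
proof -
  have "dyadic_bump r t l = (\<lambda>y. (1/2)^(r * t) * bump r (2 ^ t * y + (- real l)))"
    by (intro ext) (simp add: dyadic_bump_def)
  thus ?thesis using bounded_borel_scale[OF bounded_borel_shift[OF bounded_borel_bump]] by (simp only:)
qed

lemma dyadic_bump_support: "l < 2 ^ t \<Longrightarrow> dyadic_bump r t l y \<noteq> 0 \<Longrightarrow> 0 \<le> y \<and> y < 1"
  using bump_support[of r "2 ^ t * y - real l"] by (intro dyadic_unit) (auto simp: dyadic_bump_def)

lemma dyadic_bump_mass: "(LINT y|lborel. dyadic_bump r t l y) = (1/2) ^ ((r + 1) * t) * bump_mass r"
proof -
  have "bump_mass r = 2 ^ t * (LINT y|lborel. bump r (- real l + 2 ^ t * y))"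
    unfolding bump_mass_def
    using lborel_integral_real_affine[of "2 ^ t" "bump r" "- real l"] by simp
  thus ?thesis by (simp add: dyadic_bump_def algebra_simps power_add power_one_over)
qed

lemma rademacher_dyadic_integral: "1 \<le> r \<Longrightarrow> (LINT y|lborel. rademacher r (2 ^ t * y - real l)) = 0"
  using lborel_integral_real_affine[of "2 ^ t" "rademacher r" "- real l"] integral_rademacher[of r] by simp

lemma rademacher_support': "l < 2 ^ t \<Longrightarrow> rademacher r (2 ^ t * y - real l) \<noteq> 0 \<Longrightarrow> 0 \<le> y \<and> y < 1"
  using rademacher_support[of r "2 ^ t * y - real l"] by (intro dyadic_unit) auto

lemma atom_support: "l < 2 ^ t \<Longrightarrow> atom r t l y \<noteq> 0 \<Longrightarrow> 0 \<le> y \<and> y < 1"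
  using rademacher_support'[of l t r y]
  by (cases "rademacher r (2 ^ t * y - real l) = 0") (auto simp: atom_def indicator_def split: if_splits)

lemma bounded_borel_rademacher': "bounded_borel (\<lambda>y. rademacher r (2 ^ t * y - real l))"
  using bounded_borel_shift[OF bounded_borel_rademacher, of r "2 ^ t" "- real l"] by simp

lemma bounded_borel_add: assumes "bounded_borel f" "bounded_borel g" shows "bounded_borel (\<lambda>x. f x + g x)"
  using bounded_borel_diff[OF assms(1) bounded_borel_scale[OF assms(2), of "-1"]] by simp

lemma bounded_borel_atom: "bounded_borel (atom r t l)"
proof -
  have "bounded_borel (\<lambda>y. osc_coeff r * rademacher r (2 ^ t * y - real l) + mean_coeff r * (1/2) ^ ((r + 1) * t) * indicator {0..<1} y)"
    by (intro bounded_borel_add bounded_borel_scale bounded_borel_rademacher' bounded_borel_ind)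
  thus ?thesis by (simp add: atom_def[abs_def])
qed

lemma atom_integrable: "l < 2 ^ t \<Longrightarrow> integrable lborel (atom r t l)"
  by (intro integrable_unit_support bounded_borel_atom atom_support)

lemma atom_integral:
  assumes "l < 2 ^ t" "1 \<le> r"
  shows "(LINT y|lborel. atom r t l y) = mean_coeff r * (1/2) ^ ((r + 1) * t)"
proof -
  have 1: "integrable lborel (\<lambda>y. osc_coeff r * rademacher r (2 ^ t * y - real l))"
    by (intro integrable_mult_right integrable_unit_support bounded_borel_rademacher' rademacher_support'[OF assms(1)])
  have 2: "integrable lborel (\<lambda>y::real. mean_coeff r * (1/2) ^ ((r + 1) * t) * indicator {0..<1} y)"
    by (rule integrable_mult_right, rule integrable_unit_support[OF bounded_borel_ind])
       (auto simp: indicator_def split: if_splits)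
  have "(LINT y|lborel. atom r t l y) = osc_coeff r * (LINT y|lborel. rademacher r (2 ^ t * y - real l)) + mean_coeff r * (1/2) ^ ((r + 1) * t) * (LINT y|lborel. indicator {0..<1::real} y)"
    unfolding atom_def by (subst Bochner_Integration.integral_add[OF 1 2]) (simp only: integral_mult_right_zero)
  thus ?thesis using rademacher_dyadic_integral[OF assms(2)] by simp
qed

lemma sum_unit_indicator:
  "(\<Sum>n\<in>{-N..N}. indicator {0..<1} (of_int n + y) :: real) = indicator {- of_int N..<of_int N + 1} (y::real)"
proof -
  have "(\<Sum>n\<in>{-N..N}. indicator {0..<1} (of_int n + y) :: real) = (\<Sum>n\<in>{-N..N}. if n = - \<lfloor>y\<rfloor> then 1 else 0)"
  proof (intro sum.cong refl)
    fix n
    have "(0 \<le> of_int n + y \<and> of_int n + y < 1) \<longleftrightarrow> n = - \<lfloor>y\<rfloor>" by linarith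
    thus "(indicator {0..<1} (of_int n + y) :: real) = (if n = - \<lfloor>y\<rfloor> then 1 else 0)"
      by (auto simp: indicator_def)
  qed
  also have "\<dots> = (if - \<lfloor>y\<rfloor> \<in> {-N..N} then 1 else 0)" by simp
  also have "\<dots> = indicator {- of_int N..<of_int N + 1} y"
  proof -
    have "- \<lfloor>y\<rfloor> \<in> {-N..N} \<longleftrightarrow> y \<in> {- of_int N..<of_int N + 1}"
      unfolding atLeastAtMost_iff atLeastLessThan_iff by linarith
    thus ?thesis by (auto simp: indicator_def)
  qed
  finally show ?thesis .
qed

lemma hat1_integral:
  assumes "0 < u" "u \<le> 1" "1 \<le> k"
  shows "(LINT y|lborel. hat1 k (x - y) u) = u ^ k" "(LINT y|lborel. hat1 k (y - x) u) = u ^ k"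
proof -
  show 1: "(LINT y|lborel. hat1 k (x - y) u) = u ^ k" for x
    using convolve_hat1_const[OF assms, of x] by (simp add: convolve_def)
  have "(LINT y|lborel. hat1 k (x - y) u) = (LINT y|lborel. hat1 k y u)" for x
    using lborel_integral_real_affine[of "-1" "\<lambda>y. hat1 k (x - y) u" x] by simp
  moreover have "(LINT y|lborel. hat1 k (y - x) u) = (LINT y|lborel. hat1 k y u)"
    using lborel_integral_real_affine[of 1 "\<lambda>y. hat1 k (y - x) u" x] by simp
  ultimately show "(LINT y|lborel. hat1 k (y - x) u) = u ^ k" using 1 by metis
qed

text \<open>The translates of [0, 1) in the window tile the support of the kernel, so the sum is the
  full integral of the kernel. This describes the fate of the constant term of an atom.\<close>

lemma convolve_hat1_periodic_unit:
  assumes u: "0 < u" "u \<le> 1/2" and k: "1 \<le> k" and x: "0 \<le> x" "x < 1"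
  shows "(\<Sum>n\<in>{-(int k + 1)..int k + 1}. convolve (\<lambda>t. hat1 k t u) (indicator {0..<1}) (of_int n + x)) = u ^ k"
proof -
  have u1: "u \<le> 1" using u by simp
  let ?N = "int k + 1"
  have c: "convolve (\<lambda>t. hat1 k t u) (indicator {0..<1}) (of_int n + x) =
     (LINT y|lborel. hat1 k (x - y) u * indicator {0..<1} (of_int n + y))" for n
    unfolding convolve_def
    using lborel_integral_real_affine[of 1 "\<lambda>y. hat1 k (of_int n + x - y) u * indicator {0..<1} y" "of_int n"]
    by (simp add: algebra_simps)
  have i: "integrable lborel (\<lambda>y. hat1 k (x - y) u * indicator {0..<1} (of_int n + y))" for n
    using convolve_hat1_integrable[OF u(1) u1 k bounded_borel_shift[OF bounded_borel_ind, of 1 "of_int n"], of x] by (simp add: add.commute)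
  have "(\<Sum>n\<in>{-?N..?N}. convolve (\<lambda>t. hat1 k t u) (indicator {0..<1}) (of_int n + x)) =
     (LINT y|lborel. hat1 k (x - y) u * (\<Sum>n\<in>{-?N..?N}. indicator {0..<1} (of_int n + y)))"
    unfolding c sum_distrib_left by (rule Bochner_Integration.integral_sum[symmetric]) (rule i)
  also have "\<dots> = (LINT y|lborel. hat1 k (x - y) u)"
  proof (intro Bochner_Integration.integral_cong refl)
    fix y
    show "hat1 k (x - y) u * (\<Sum>n\<in>{-?N..?N}. indicator {0..<1} (of_int n + y)) = hat1 k (x - y) u"
    proof (cases "hat1 k (x - y) u = 0")
      case False
      have "\<bar>x - y\<bar> \<le> real k * u / 2" by (rule hat1_support[OF u(1) u1 k False])
      also have "\<dots> \<le> real k * (1 / 2) / 2" using u by (intro divide_right_mono mult_left_mono) auto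
      also have "\<dots> \<le> real k" by simp
      finally have "\<bar>x - y\<bar> \<le> real k" .
      hence "y \<in> {- of_int ?N..<of_int ?N + 1}" using x by (auto simp: abs_le_iff)
      thus ?thesis unfolding sum_unit_indicator by simp
    qed simp
  qed
  also have "\<dots> = u ^ k" by (rule hat1_integral[OF u(1) u1 k])
  finally show ?thesis .
qed

lemma periodic_hat1_integral:
  assumes u: "0 < u" "u \<le> 1/2" and k: "1 \<le> k" and z: "0 \<le> z" "z < 1"
  shows "integrable lborel (\<lambda>x. indicator {0..<1} x * periodic_hat1 k (x - z) u)" (is ?A)
    and "(LINT x|lborel. indicator {0..<1} x * periodic_hat1 k (x - z) u) = u ^ k" (is ?B)
proof -
  have u1: "u \<le> 1" using u by simp
  let ?N = "int k + 1"
  note [measurable] = hat1_measurable[OF u(1) u1 k]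
  have i: "integrable lborel (\<lambda>y. hat1 k (y - z) u * indicator {0..<1} (-of_int n + y))" for n :: int
  proof (rule integrable_bounded_support[where B = 1 and R = "real_of_int \<bar>n\<bar> + 1"])
    show "\<bar>hat1 k (y - z) u * indicator {0..<1} (-of_int n + y)\<bar> \<le> 1" for y
      using hat1_nonneg[OF u(1) u1 k, of "y - z"] hat1_le_1[OF u(1) u1 k, of "y - z"] by (auto simp: indicator_def)
    show "\<bar>y\<bar> \<le> real_of_int \<bar>n\<bar> + 1" if "hat1 k (y - z) u * indicator {0..<1} (-of_int n + y) \<noteq> 0" for y
    proof -
      have "0 \<le> -of_int n + y" "-of_int n + y < 1" using that by (auto simp: indicator_def split: if_splits)
      thus ?thesis by linarith
    qed
  qed measurable
  have i': "integrable lborel (\<lambda>x. indicator {0..<1} x * hat1 k (of_int n + (x - z)) u)" for n :: int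
    using lborel_integrable_real_affine[OF i[of n], of 1 "of_int n"] by (simp add: algebra_simps)
  show ?A unfolding periodic_hat1_def sum_distrib_left by (intro Bochner_Integration.integrable_sum i')
  have c: "(LINT x|lborel. indicator {0..<1} x * hat1 k (of_int n + (x - z)) u) =
     (LINT y|lborel. hat1 k (y - z) u * indicator {0..<1} (- of_int n + y))" for n :: int
    using lborel_integral_real_affine[of 1 "\<lambda>y. hat1 k (y - z) u * indicator {0..<1} (- of_int n + y)" "of_int n"]
    by (simp add: algebra_simps)
  have "(LINT x|lborel. indicator {0..<1} x * periodic_hat1 k (x - z) u) =
     (\<Sum>n\<in>{-?N..?N}. (LINT x|lborel. indicator {0..<1} x * hat1 k (of_int n + (x - z)) u))"
    unfolding periodic_hat1_def sum_distrib_left by (intro Bochner_Integration.integral_sum i')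
  also have "\<dots> = (LINT y|lborel. (\<Sum>n\<in>{-?N..?N}. hat1 k (y - z) u * indicator {0..<1} (- of_int n + y)))"
    unfolding c by (rule Bochner_Integration.integral_sum[symmetric]) (rule i)
  also have "\<dots> = (LINT y|lborel. hat1 k (y - z) u)"
  proof (intro Bochner_Integration.integral_cong refl)
    fix y
    have "(\<Sum>n\<in>{-?N..?N}. hat1 k (y - z) u * indicator {0..<1} (- of_int n + y)) =
      hat1 k (y - z) u * (\<Sum>n\<in>{-?N..?N}. indicator {0..<1} (of_int n + y))"
      unfolding sum_distrib_left
      by (rule sum.reindex_bij_witness[where i = uminus and j = uminus]) auto
    also have "\<dots> = hat1 k (y - z) u"
    proof (cases "hat1 k (y - z) u = 0")
      case False
      have "\<bar>y - z\<bar> \<le> real k * u / 2" by (rule hat1_support[OF u(1) u1 k False])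
      also have "\<dots> \<le> real k * (1 / 2) / 2" using u by (intro divide_right_mono mult_left_mono) auto
      also have "\<dots> \<le> real k" by simp
      finally have "\<bar>y - z\<bar> \<le> real k" .
      hence "y \<in> {- of_int ?N..<of_int ?N + 1}" using z by (auto simp: abs_le_iff)
      thus ?thesis unfolding sum_unit_indicator by simp
    qed simp
    finally show "(\<Sum>n\<in>{-?N..?N}. hat1 k (y - z) u * indicator {0..<1} (- of_int n + y)) = hat1 k (y - z) u" .
  qed
  also have "\<dots> = u ^ k" by (rule hat1_integral[OF u(1) u1 k])
  finally show ?B .
qed

lemma
  assumes "1 \<le> r"
  shows half_power_integrable: "integrable lborel (\<lambda>u. indicator {0<..1/2} u * u ^ r :: real)"
    and half_power_integral: "(LINT u|lborel. indicator {0<..1/2} u * u ^ r :: real) = (1/2)^(r+1) / real (r + 1)"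
proof -
  have P: "((\<lambda>u. u ^ r) has_integral (1/2)^(r+1) / real (r + 1)) {0..1/2::real}"
  proof -
    have "((\<lambda>u. u ^ r) has_integral ((1/2)^(r+1) / real (r + 1) - 0^(r+1) / real (r + 1))) {0..1/2::real}"
    proof (rule fundamental_theorem_of_calculus)
      fix u :: real
      have "((\<lambda>u. u ^ (r + 1) / real (r + 1)) has_real_derivative u ^ r) (at u)"
        using DERIV_cdivide[OF DERIV_pow[of "r + 1" u], of "real (r + 1)"] by simp
      thus "((\<lambda>u. u ^ (r + 1) / real (r + 1)) has_vector_derivative u ^ r) (at u within {0..1/2})"
        by (simp add: has_real_derivative_iff_has_vector_derivative has_vector_derivative_at_within)
    qed simp
    thus ?thesis by simp
  qed
  show i2: "integrable lborel (\<lambda>u. indicator {0<..1/2} u * u ^ r :: real)"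
  proof (rule integrable_bounded_support[where B = 1 and R = 1])
    show "\<bar>indicator {0<..1/2} u * u ^ r\<bar> \<le> 1" for u :: real by (auto simp: indicator_def power_le_one)
  qed (auto simp: indicator_def split: if_splits)
  show e2: "(LINT u|lborel. indicator {0<..1/2} u * u ^ r :: real) = (1/2)^(r+1) / real (r + 1)"
  proof -
    have "((\<lambda>u. indicator {0<..1/2} u * u ^ r) has_integral (LINT u|lborel. indicator {0<..1/2} u * u ^ r :: real)) UNIV"
      by (rule has_integral_integral_lborel[OF i2])
    moreover have "((\<lambda>u. indicator {0<..1/2} u * u ^ r) has_integral (1/2)^(r+1) / real (r + 1)) UNIV"
    proof -
      have "((\<lambda>u. if u \<in> {0..1/2} then u ^ r else 0) has_integral (1/2)^(r+1) / real (r + 1)) (UNIV :: real set)"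
        using P by (simp only: has_integral_restrict_UNIV)
      moreover have "(\<lambda>u. if u \<in> {0..1/2} then u ^ r else 0) = (\<lambda>u. indicator {0<..1/2::real} u * u ^ r)"
        using assms by (intro ext) (auto simp: indicator_def power_0_left)
      ultimately show ?thesis by (simp only:)
    qed
    ultimately show ?thesis by (rule has_integral_unique)
  qed
qed

text \<open>The oscillating part becomes a periodized central difference of the bump, and its
  average is the bump minus its mean; the average of the constant part is exactly this mean. Fixed
  scale and average are stated separately because the pairing integrates over \<open>z\<close> first
  and over \<open>u\<close> afterwards.\<close>

lemma atom_smoothing:
  assumes r: "even r" "1 \<le> r" and l: "l < 2 ^ t" and x: "0 \<le> x" "x < 1"
  defines "Q \<equiv> \<lambda>u. osc_coeff r * (\<Sum>n\<in>{-(int r + 1)..int r + 1}. central_diff u r (dyadic_bump r t l) (of_int n + x)) + mean_coeff r * (1/2) ^ ((r + 1) * t) * u ^ r"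
  shows "\<And>u. 0 < u \<Longrightarrow> u \<le> 1/2 \<Longrightarrow> integrable lborel (\<lambda>z. periodic_hat1 r (x - z) u * atom r t l z) \<and>
      (LINT z|lborel. periodic_hat1 r (x - z) u * atom r t l z) = Q u"
    and "integrable lborel (\<lambda>u. indicator {0<..1/2} u * Q u)"
    and "(LINT u|lborel. indicator {0<..1/2} u * Q u) = dyadic_bump r t l x"
proof -
  let ?N = "int r + 1"
  fix u :: real assume u: "0 < u" "u \<le> 1/2"
  hence u1: "u \<le> 1" by simp
  have eq: "periodic_hat1 r (x - z) u * atom r t l z = (\<Sum>n\<in>{-?N..?N}. hat1 r (of_int n + x - z) u * atom r t l z)" for z
    unfolding periodic_hat1_def sum_distrib_right by (simp add: algebra_simps)
  have i: "integrable lborel (\<lambda>z. hat1 r (of_int n + x - z) u * atom r t l z)" for n :: int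
    by (rule convolve_hat1_integrable[OF u(1) u1 r(2) bounded_borel_atom])
  have "(LINT z|lborel. periodic_hat1 r (x - z) u * atom r t l z) = (\<Sum>n\<in>{-?N..?N}. convolve (\<lambda>t. hat1 r t u) (atom r t l) (of_int n + x))"
    unfolding eq convolve_def by (rule Bochner_Integration.integral_sum) (rule i)
  also have "\<dots> = (\<Sum>n\<in>{-?N..?N}. osc_coeff r * central_diff u r (dyadic_bump r t l) (of_int n + x) + mean_coeff r * (1/2) ^ ((r + 1) * t) * convolve (\<lambda>t. hat1 r t u) (indicator {0..<1}) (of_int n + x))"
  proof (intro sum.cong refl)
    fix n :: int
    let ?y = "of_int n + x"
    have A: "iterated_antiderivative r (\<lambda>y. rademacher r (2 ^ t * y - real l)) (dyadic_bump r t l)"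
    proof -
      have "dyadic_bump r t l = (\<lambda>y. (1 / 2 ^ t) ^ r * bump r (2 ^ t * y + (- real l)))"
        by (intro ext) (simp add: dyadic_bump_def power_one_over power_mult[symmetric] mult.commute)
      thus ?thesis using iterated_antiderivative_affine[OF iterated_antiderivative_bump, of "2 ^ t" r "- real l"] by simp
    qed
    have "convolve (\<lambda>t. hat1 r t u) (atom r t l) ?y =
       (LINT y|lborel. osc_coeff r * (hat1 r (?y - y) u * rademacher r (2 ^ t * y - real l)) + mean_coeff r * (1/2) ^ ((r + 1) * t) * (hat1 r (?y - y) u * indicator {0..<1} y))"
      unfolding convolve_def atom_def by (intro Bochner_Integration.integral_cong) (auto simp: algebra_simps)
    also have "\<dots> = osc_coeff r * convolve (\<lambda>t. hat1 r t u) (\<lambda>y. rademacher r (2 ^ t * y - real l)) ?y + mean_coeff r * (1/2) ^ ((r + 1) * t) * convolve (\<lambda>t. hat1 r t u) (indicator {0..<1}) ?y"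
      unfolding convolve_def
      by (subst Bochner_Integration.integral_add)
         (auto simp only: integral_mult_right_zero intro!: integrable_mult_right convolve_hat1_integrable[OF u(1) u1 r(2)] bounded_borel_rademacher' bounded_borel_ind)
    also have "convolve (\<lambda>t. hat1 r t u) (\<lambda>y. rademacher r (2 ^ t * y - real l)) ?y = central_diff u r (dyadic_bump r t l) ?y"
      by (rule convolve_hat1_antiderivative[OF u(1) u1 A r(2)])
    finally show "convolve (\<lambda>t. hat1 r t u) (atom r t l) ?y = osc_coeff r * central_diff u r (dyadic_bump r t l) ?y + mean_coeff r * (1/2) ^ ((r + 1) * t) * convolve (\<lambda>t. hat1 r t u) (indicator {0..<1}) ?y" .
  qed
  also have "\<dots> = Q u"
    unfolding sum.distrib sum_distrib_left[symmetric] convolve_hat1_periodic_unit[OF u r(2) x] Q_def by simp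
  finally show "integrable lborel (\<lambda>z. periodic_hat1 r (x - z) u * atom r t l z) \<and> (LINT z|lborel. periodic_hat1 r (x - z) u * atom r t l z) = Q u"
    unfolding eq using i by (auto intro!: Bochner_Integration.integrable_sum)
next
  let ?N = "int r + 1"
  let ?\<beta> = "mean_coeff r * (1/2) ^ ((r + 1) * t)"
  obtain h where h: "r = 2 * h" using r(1) by blast
  have h1: "1 \<le> h" using h r(2) by simp
  interpret unit_supported "dyadic_bump r t l" h by unfold_locales (auto simp: dyadic_bump_bounded_borel dest: dyadic_bump_support[OF l])
  have N: "?N = 2 * int h + 1" using h by simp
  let ?D = "\<lambda>u. \<Sum>n\<in>{-?N..?N}. central_diff u r (dyadic_bump r t l) (of_int n + x)"
  have i1: "integrable lborel (\<lambda>u. indicator {0<..1/2} u * ?D u)"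
    using central_diff_integral(1)[OF x h1] by (simp only: N[symmetric] h[symmetric])
  have e1: "(LINT u|lborel. indicator {0<..1/2} u * ?D u) = (-1)^h * real (2 * h choose h) / 2 * (dyadic_bump r t l x - (LINT y|lborel. dyadic_bump r t l y))"
    using central_diff_integral(2)[OF x h1] by (simp only: N[symmetric] h[symmetric])
  note i2 = half_power_integrable[OF r(2)] and e2 = half_power_integral[OF r(2)]
  have Q: "indicator {0<..1/2} u * Q u = osc_coeff r * (indicator {0<..1/2} u * ?D u) + ?\<beta> * (indicator {0<..1/2} u * u ^ r)" for u
    by (simp add: Q_def algebra_simps)
  show "integrable lborel (\<lambda>u. indicator {0<..1/2} u * Q u)"
    unfolding Q by (intro Bochner_Integration.integrable_add integrable_mult_right i1 i2)
  have "(LINT u|lborel. indicator {0<..1/2} u * Q u) = osc_coeff r * ((-1)^h * real (2 * h choose h) / 2 * (dyadic_bump r t l x - (LINT y|lborel. dyadic_bump r t l y))) + ?\<beta> * ((1/2)^(r+1) / real (r + 1))"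
    unfolding Q
    by (subst Bochner_Integration.integral_add) (auto simp only: integral_mult_right_zero e1 e2 intro!: integrable_mult_right i1 i2)
  also have "osc_coeff r * ((-1)^h * real (2 * h choose h) / 2 * (dyadic_bump r t l x - (LINT y|lborel. dyadic_bump r t l y))) = dyadic_bump r t l x - (LINT y|lborel. dyadic_bump r t l y)"
  proof -
    have "osc_coeff r * ((-1)^h * real (2 * h choose h) / 2) = 1"
      by (simp add: osc_coeff_def h flip: power_add mult_2)
    thus ?thesis by (metis mult.assoc mult_1)
  qed
  also have "?\<beta> * ((1/2)^(r+1) / real (r + 1)) = (LINT y|lborel. dyadic_bump r t l y)"
  proof -
    have pq: "(2::real) ^ (r + 1) * (1/2) ^ (r + 1) = 1" by (simp flip: power_mult_distrib)
    have gen: "R * p * m * x * (q / R) = x * m" if "p * q = 1" "R \<noteq> 0" for R p q m x :: real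
      using that by (simp add: mult_ac)
    show ?thesis unfolding dyadic_bump_mass mean_coeff_def by (rule gen[OF pq]) simp
  qed
  finally show "(LINT u|lborel. indicator {0<..1/2} u * Q u) = dyadic_bump r t l x" by simp
qed

section \<open>A type 2 inequality for even moments\<close>

text \<open>Changes the \<open>p\<close>-th binary digit of \<open>x\<close> after the point.\<close>

definition digit_flip :: "nat \<Rightarrow> real \<Rightarrow> real" where
  "digit_flip p x = (if even \<lfloor>2 ^ p * x\<rfloor> then x + 1 / 2 ^ p else x - 1 / 2 ^ p)"

lemma digit_flip_measurable [measurable]: "digit_flip p \<in> borel_measurable borel"
  unfolding digit_flip_def[abs_def] by measurable

text \<open>The flip exchanges \<open>E\<close>, where the digit is 0, with its complement by two
  translations, hence it preserves Lebesgue measure.\<close>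

lemma digit_flip_nn_integral:
  assumes [measurable]: "F \<in> borel_measurable borel"
  shows "(\<integral>\<^sup>+x. F (digit_flip p x) \<partial>lborel) = (\<integral>\<^sup>+x. F x \<partial>lborel)"
proof -
  define E where "E = {x::real. even \<lfloor>2 ^ p * x\<rfloor>}"
  have [measurable]: "E \<in> sets borel"
  proof -
    have "E = {x \<in> space borel. even \<lfloor>2 ^ p * x\<rfloor>}" by (simp add: E_def)
    also have "\<dots> \<in> sets borel" by measurable
    finally show ?thesis .
  qed
  have fl: "\<lfloor>2 ^ p * (1 / 2 ^ p + x)\<rfloor> = \<lfloor>2 ^ p * x\<rfloor> + 1" "\<lfloor>2 ^ p * (- (1 / 2 ^ p) + x)\<rfloor> = \<lfloor>2 ^ p * x\<rfloor> - 1" for x :: real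
  proof -
    have "2 ^ p * (1 / 2 ^ p + x) = 2 ^ p * x + 1" "2 ^ p * (- (1 / 2 ^ p) + x) = 2 ^ p * x - 1"
      by (simp_all add: field_simps)
    thus "\<lfloor>2 ^ p * (1 / 2 ^ p + x)\<rfloor> = \<lfloor>2 ^ p * x\<rfloor> + 1" "\<lfloor>2 ^ p * (- (1 / 2 ^ p) + x)\<rfloor> = \<lfloor>2 ^ p * x\<rfloor> - 1" 
      by simp_all
  qed
  have "(\<integral>\<^sup>+x. F (digit_flip p x) \<partial>lborel) =
    (\<integral>\<^sup>+x. F (1 / 2 ^ p + x) * indicator (-E) (1 / 2 ^ p + x) + F (- (1 / 2 ^ p) + x) * indicator E (- (1 / 2 ^ p) + x) \<partial>lborel)"
    by (intro nn_integral_cong) (auto simp: digit_flip_def E_def indicator_def fl algebra_simps)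
  also have "\<dots> = (\<integral>\<^sup>+x. F (1 / 2 ^ p + x) * indicator (-E) (1 / 2 ^ p + x) \<partial>lborel) +
     (\<integral>\<^sup>+x. F (- (1 / 2 ^ p) + x) * indicator E (- (1 / 2 ^ p) + x) \<partial>lborel)"
    by (intro nn_integral_add) measurable
  also have "(\<integral>\<^sup>+x. F (1 / 2 ^ p + x) * indicator (-E) (1 / 2 ^ p + x) \<partial>lborel) = (\<integral>\<^sup>+x. F x * indicator (-E) x \<partial>lborel)"
    using nn_integral_real_affine[of "\<lambda>x. F x * indicator (-E) x" 1 "1 / 2 ^ p"] by simp
  also have "(\<integral>\<^sup>+x. F (- (1 / 2 ^ p) + x) * indicator E (- (1 / 2 ^ p) + x) \<partial>lborel) = (\<integral>\<^sup>+x. F x * indicator E x \<partial>lborel)"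
    using nn_integral_real_affine[of "\<lambda>x. F x * indicator E x" 1 "- (1 / 2 ^ p)"] by simp
  also have "(\<integral>\<^sup>+x. F x * indicator (-E) x \<partial>lborel) + (\<integral>\<^sup>+x. F x * indicator E x \<partial>lborel) =
     (\<integral>\<^sup>+x. F x * indicator (-E) x + F x * indicator E x \<partial>lborel)"
    by (intro nn_integral_add[symmetric]) measurable
  also have "\<dots> = (\<integral>\<^sup>+x. F x \<partial>lborel)"
    by (intro nn_integral_cong) (auto simp: indicator_def)
  finally show ?thesis .
qed

lemma digit_flip_scale: "2 ^ s * digit_flip (s + p) x = digit_flip p (2 ^ s * x)"
  by (simp add: digit_flip_def power_add field_simps)

lemma digit_flip_shift: "1 \<le> p \<Longrightarrow> digit_flip p (y - real l) = digit_flip p y - real l"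
proof -
  assume "1 \<le> p"
  then obtain q where q: "p = Suc q" by (cases p) auto
  have "2 ^ p * (y - real l) = 2 ^ p * y - of_int (2 * (2 ^ q * int l))"
    by (simp add: q algebra_simps)
  hence "\<lfloor>2 ^ p * (y - real l)\<rfloor> = \<lfloor>2 ^ p * y\<rfloor> - 2 * (2 ^ q * int l)"
    by (simp only: floor_diff_of_int)
  thus ?thesis by (simp add: digit_flip_def)
qed

text \<open>The flip exchanges the values 2 m and 2 m + 1 of the floor of 2^p y. The bounds 0 and 2
  * 2^q that describe the unit interval are even, so they separate no such pair.\<close>

lemma rademacher_0_digit_flip: "1 \<le> p \<Longrightarrow> rademacher 0 (digit_flip p y) = rademacher 0 y"
proof -
  assume "1 \<le> p"
  then obtain q where q: "p = Suc q" by (cases p) auto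
  define k where "k = \<lfloor>2 ^ p * y\<rfloor>"
  have in_iff: "0 \<le> x \<and> x < 1 \<longleftrightarrow> 0 \<le> \<lfloor>2 ^ p * x\<rfloor> \<and> \<lfloor>2 ^ p * x\<rfloor> < 2 * 2 ^ q" for x :: real
  proof -
    have "2 ^ p * x < of_int (2 * 2 ^ q) \<longleftrightarrow> x < 1" by (simp add: q)
    moreover have "\<not> (2::real) ^ p \<le> 0" by (simp add: not_le)
    ultimately show ?thesis by (simp add: floor_less_iff zero_le_mult_iff)
  qed
  have "2 ^ p * digit_flip p y = 2 ^ p * y + of_int (if even k then 1 else -1)"
    by (simp add: digit_flip_def k_def field_simps)
  hence "\<lfloor>2 ^ p * digit_flip p y\<rfloor> = k + (if even k then 1 else -1)"
    by (simp only: k_def floor_add_int[symmetric])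
  moreover have "0 \<le> k + (if even k then 1 else -1) \<and> k + (if even k then 1 else -1) < 2 * 2 ^ q \<longleftrightarrow> 0 \<le> k \<and> k < 2 * 2 ^ q"
  proof (cases "even k")
    case True
    then obtain m where "k = 2 * m" by blast
    thus ?thesis by auto
  next
    case False
    then obtain m where "k = 2 * m + 1" by (auto elim: oddE)
    thus ?thesis by auto
  qed
  ultimately show ?thesis
    using in_iff[of y] in_iff[of "digit_flip p y"] by (auto simp: indicator_def k_def)
qed

text \<open>Only the unit interval and the first \<open>r\<close> digits enter, and the flip touches
  a later digit.\<close>

lemma rademacher_digit_flip_invariant: "r < p \<Longrightarrow> rademacher r (digit_flip p y) = rademacher r y"
proof (induction r arbitrary: p y)
  case 0
  thus ?case by (intro rademacher_0_digit_flip) simp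
next
  case (Suc r)
  then obtain q where q: "p = Suc q" by (cases p) auto
  with Suc.prems have "r < q" by simp
  have 2: "2 * digit_flip p y = digit_flip q (2 * y)" using digit_flip_scale[of 1 q y] q by simp
  have "2 * digit_flip p y - 1 = digit_flip q (2 * y - 1)" using digit_flip_shift[of q "2 * y" 1] \<open>r < q\<close> 2 by simp
  with 2 show ?case using Suc.IH[OF \<open>r < q\<close>] by simp
qed

lemma rademacher_digit_flip_flip: "1 \<le> r \<Longrightarrow> rademacher r (digit_flip r y) = - rademacher r y"
proof (induction r arbitrary: y rule: nat_induct_at_least)
  case base
  define k where "k = \<lfloor>2 * y\<rfloor>"
  have rk: "rademacher 1 x = of_bool (\<lfloor>2 * x\<rfloor> = 0) - of_bool (\<lfloor>2 * x\<rfloor> = 1)" for x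
    by (auto simp: indicator_def floor_eq_iff)
  have "2 * digit_flip 1 y = 2 * y + of_int (if even k then 1 else -1)"
    by (simp add: digit_flip_def k_def field_simps)
  hence t: "\<lfloor>2 * digit_flip 1 y\<rfloor> = k + (if even k then 1 else -1)"
    by (simp only: k_def floor_add_int[symmetric])
  have "even k \<Longrightarrow> k + 1 \<noteq> 0" "even k \<Longrightarrow> k \<noteq> 1" "odd k \<Longrightarrow> k - 1 \<noteq> 1" "odd k \<Longrightarrow> k \<noteq> 0"
    by presburger+
  then show ?case unfolding rk t k_def[symmetric]
    by (cases "even k") (auto simp: of_bool_def)
next
  case (Suc r)
  have 2: "2 * digit_flip (Suc r) y = digit_flip r (2 * y)" using digit_flip_scale[of 1 r y] by simp
  have "2 * digit_flip (Suc r) y - 1 = digit_flip r (2 * y - 1)" using digit_flip_shift[of r "2 * y" 1] Suc.hyps 2 by simp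
  with 2 show ?case using Suc.IH by simp
qed

text \<open>Digit \<open>r\<close> of 2^t y - l is digit t + r of \<open>y\<close> for every
  position \<open>l\<close>. One and the same flip therefore reverses a whole level, whatever the
  coefficients of its positions are. A level s < t involves digits only up to s + r and does not see
  it.\<close>

lemma rademacher_dyadic_flip: "1 \<le> r \<Longrightarrow> rademacher r (2 ^ t * digit_flip (t + r) y - real l) = - rademacher r (2 ^ t * y - real l)"
  using rademacher_digit_flip_flip[of r "2 ^ t * y - real l"] by (simp add: digit_flip_scale digit_flip_shift)

lemma rademacher_dyadic_invariant:
  assumes "s < t" "1 \<le> r" shows "rademacher r (2 ^ s * digit_flip (t + r) y - real l) = rademacher r (2 ^ s * y - real l)"
proof -
  have "2 ^ s * digit_flip (t + r) y = digit_flip (t - s + r) (2 ^ s * y)"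
    using digit_flip_scale[of s "t - s + r" y] assms by simp
  thus ?thesis using rademacher_digit_flip_invariant[of r "t - s + r" "2 ^ s * y - real l"] assms by (simp add: digit_flip_shift)
qed

section \<open>Inequalities for even powers\<close>

lemma sum_even_odd: "(\<Sum>k\<le>2 * n. f k) = (\<Sum>i\<le>n. f (2 * i)) + (\<Sum>i<n. f (2 * i + 1 :: nat) :: real)"
  by (induction n) (auto simp: algebra_simps)

lemma power_mult_le_sum:
  fixes x y :: real
  assumes "0 \<le> x" "0 \<le> y" "i \<le> N"
  shows "x ^ (N - i) * y ^ i \<le> x ^ N + y ^ N"
proof (cases "x \<le> y")
  case True
  have "x ^ (N - i) * y ^ i \<le> y ^ (N - i) * y ^ i"
    using assms True by (intro mult_right_mono power_mono) auto
  also have "\<dots> = y ^ N" using assms by (simp flip: power_add)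
  finally show ?thesis using assms by (simp add: add_increasing)
next
  case False
  have "x ^ (N - i) * y ^ i \<le> x ^ (N - i) * x ^ i"
    using assms False by (intro mult_left_mono power_mono) auto
  also have "\<dots> = x ^ N" using assms by (simp flip: power_add)
  finally show ?thesis using assms by (simp add: add_increasing2)
qed

text \<open>The odd powers of \<open>Y\<close> cancel, and weighted powers \<open>X^(2(N-i)) Y^(2i)\<close> are compared with the
  expansion of \<open>(a + K b)^N\<close>, where \<open>a\<close> and \<open>b\<close> stand for the squared norms of \<open>X\<close> and \<open>Y\<close>.\<close>

lemma two_point_inequality:
  fixes X Y a b :: real and N :: nat
  assumes ab: "0 < a" "0 < b"
  defines "K \<equiv> 2 * 4 ^ N"
  shows "(X + Y) ^ (2 * N) + (X - Y) ^ (2 * N)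
     \<le> 2 * X ^ (2 * N) + ((a + K * b) ^ N - a ^ N) * (X ^ (2 * N) / a ^ N + Y ^ (2 * N) / b ^ N)"
proof -
  let ?W = "X ^ (2 * N) / a ^ N + Y ^ (2 * N) / b ^ N"
  have W0: "0 \<le> ?W" using ab by (simp add: power_mult)
  have K1: "1 \<le> K" unfolding K_def using one_le_power[of "4::real" N] by linarith
  have "(X + Y) ^ (2 * N) + (X - Y) ^ (2 * N) =
    (\<Sum>k\<le>2 * N. real (2 * N choose k) * Y ^ k * X ^ (2 * N - k) + real (2 * N choose k) * (- Y) ^ k * X ^ (2 * N - k))"
    using binomial_ring[of Y X "2 * N"] binomial_ring[of "- Y" X "2 * N"] by (simp add: sum.distrib add.commute)
  also have "\<dots> = (\<Sum>i\<le>N. 2 * (real (2 * N choose (2 * i)) * (Y ^ (2 * i) * X ^ (2 * (N - i)))))"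
    by (subst sum_even_odd) (simp add: diff_mult_distrib diff_mult_distrib2 mult_ac)
  also have "\<dots> = 2 * X ^ (2 * N) + (\<Sum>i\<in>{1..N}. 2 * (real (2 * N choose (2 * i)) * (Y ^ (2 * i) * X ^ (2 * (N - i)))))"
    by (subst atMost_atLeast0, subst sum.atLeast_Suc_atMost) auto
  also have "\<dots> \<le> 2 * X ^ (2 * N) + (\<Sum>i\<in>{1..N}. real (N choose i) * (K * b) ^ i * a ^ (N - i) * ?W)"
  proof (intro add_left_mono sum_mono)
    fix i assume i: "i \<in> {1..N}"
    have "Y ^ (2 * i) * X ^ (2 * (N - i)) = a ^ (N - i) * b ^ i * ((X\<^sup>2 / a) ^ (N - i) * (Y\<^sup>2 / b) ^ i)"
      using ab by (simp add: power_mult power_divide)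
    also have "\<dots> \<le> a ^ (N - i) * b ^ i * ((X\<^sup>2 / a) ^ N + (Y\<^sup>2 / b) ^ N)"
      using ab i by (intro mult_left_mono power_mult_le_sum) auto
    also have "(X\<^sup>2 / a) ^ N + (Y\<^sup>2 / b) ^ N = ?W" by (simp add: power_divide power_mult)
    finally have 1: "Y ^ (2 * i) * X ^ (2 * (N - i)) \<le> a ^ (N - i) * b ^ i * ?W" .
    have "2 * N choose (2 * i) \<le> 2 ^ (2 * N)" by (rule binomial_le_pow2)
    hence "real (2 * N choose (2 * i)) \<le> real (2 ^ (2 * N))" by (simp only: of_nat_le_iff)
    hence 2: "real (2 * N choose (2 * i)) \<le> 4 ^ N" by (simp add: power_mult)
    \<comment> \<open>The constant \<open>K\<close> is at least twice every binomial coefficient of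
      order 2 N. As i is at least 1 here, \<open>K\<close> may then be replaced by K^i, to fit the
      expansion of (a + K b)^N.\<close>
    have "2 * (real (2 * N choose (2 * i)) * (Y ^ (2 * i) * X ^ (2 * (N - i)))) \<le> 2 * (4 ^ N * (a ^ (N - i) * b ^ i * ?W))"
      by (intro mult_left_mono mult_mono 1 2) (simp_all add: power_mult)
    also have "\<dots> = 1 * K ^ 1 * b ^ i * a ^ (N - i) * ?W" by (simp add: K_def)
    also have "\<dots> \<le> real (N choose i) * K ^ i * b ^ i * a ^ (N - i) * ?W"
    proof -
      have "0 < N choose i" using i by simp
      hence "1 \<le> N choose i" by linarith
      hence "1 * K ^ 1 \<le> real (N choose i) * K ^ i"
        using i K1 by (intro mult_mono power_increasing) auto
      thus ?thesis using ab W0 by (intro mult_right_mono) auto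
    qed
    finally show "2 * (real (2 * N choose (2 * i)) * (Y ^ (2 * i) * X ^ (2 * (N - i)))) \<le> real (N choose i) * (K * b) ^ i * a ^ (N - i) * ?W"
      by (simp add: power_mult_distrib mult_ac)
  qed
  also have "(\<Sum>i\<in>{1..N}. real (N choose i) * (K * b) ^ i * a ^ (N - i) * ?W) = ((a + K * b) ^ N - a ^ N) * ?W"
  proof -
    have "(K * b + a) ^ N = (\<Sum>i\<le>N. real (N choose i) * (K * b) ^ i * a ^ (N - i))"
      by (rule binomial_ring)
    also have "\<dots> = a ^ N + (\<Sum>i\<in>{1..N}. real (N choose i) * (K * b) ^ i * a ^ (N - i))"
      by (subst atMost_atLeast0, subst sum.atLeast_Suc_atMost) auto
    finally show ?thesis by (simp add: sum_distrib_right add.commute)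
  qed
  finally show ?thesis by simp
qed

text \<open>The symmetry assumption replaces the orthogonality of martingale differences.\<close>

lemma type2_step:
  fixes X Y :: "'a \<Rightarrow> real"
  assumes [measurable]: "X \<in> borel_measurable Q" "Y \<in> borel_measurable Q"
    and ab: "0 < a" "0 < b"
    and sym: "(\<integral>\<^sup>+x. ennreal ((X x - Y x) ^ (2 * N)) \<partial>Q) = (\<integral>\<^sup>+x. ennreal ((X x + Y x) ^ (2 * N)) \<partial>Q)"
    and X: "(\<integral>\<^sup>+x. ennreal (X x ^ (2 * N)) \<partial>Q) \<le> ennreal (a ^ N)"
    and Y: "(\<integral>\<^sup>+x. ennreal (Y x ^ (2 * N)) \<partial>Q) \<le> ennreal (b ^ N)"
  shows "(\<integral>\<^sup>+x. ennreal ((X x + Y x) ^ (2 * N)) \<partial>Q) \<le> ennreal ((a + 2 * 4 ^ N * b) ^ N)"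
proof -
  \<comment> \<open>Both normalized moments are at most 1, so the two-point inequality gives 2 a^N +
    2 c, twice the target. That \<open>a\<close> enters the result with coefficient 1 is what allows
    iteration without exponential loss.\<close>
  define c where "c = (a + 2 * 4 ^ N * b) ^ N - a ^ N"
  have c: "0 \<le> c" unfolding c_def using ab by (simp add: power_mono)
  have ev: "0 \<le> (x::real) ^ (2 * N)" for x by (simp add: power_mult)
  let ?I = "\<integral>\<^sup>+x. ennreal ((X x + Y x) ^ (2 * N)) \<partial>Q"
  have "2 * ?I = ?I + (\<integral>\<^sup>+x. ennreal ((X x - Y x) ^ (2 * N)) \<partial>Q)"
    unfolding sym by (simp add: mult_2)
  also have "\<dots> = (\<integral>\<^sup>+x. ennreal ((X x + Y x) ^ (2 * N) + (X x - Y x) ^ (2 * N)) \<partial>Q)"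
    by (subst nn_integral_add[symmetric]) (auto simp: ev)
  also have "\<dots> \<le> (\<integral>\<^sup>+x. ennreal ((2 + c / a ^ N) * X x ^ (2 * N) + (c / b ^ N) * Y x ^ (2 * N)) \<partial>Q)"
  proof (intro nn_integral_mono ennreal_leI)
    fix x
    show "(X x + Y x) ^ (2 * N) + (X x - Y x) ^ (2 * N) \<le> (2 + c / a ^ N) * X x ^ (2 * N) + (c / b ^ N) * Y x ^ (2 * N)"
    proof -
      have "2 * X x ^ (2 * N) + c * (X x ^ (2 * N) / a ^ N + Y x ^ (2 * N) / b ^ N) = (2 + c / a ^ N) * X x ^ (2 * N) + (c / b ^ N) * Y x ^ (2 * N)"
        by (simp only: distrib_left distrib_right times_divide_eq_right times_divide_eq_left add.assoc)
      thus ?thesis using two_point_inequality[OF ab, of "X x" "Y x" N, folded c_def] by (simp only:)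
    qed
  qed
  also have "\<dots> = ennreal (2 + c / a ^ N) * (\<integral>\<^sup>+x. ennreal (X x ^ (2 * N)) \<partial>Q) + ennreal (c / b ^ N) * (\<integral>\<^sup>+x. ennreal (Y x ^ (2 * N)) \<partial>Q)"
  proof -
    have p: "0 \<le> 2 + c / a ^ N" "0 \<le> c / b ^ N" using c ab by auto
    have "(\<integral>\<^sup>+x. ennreal ((2 + c / a ^ N) * X x ^ (2 * N) + (c / b ^ N) * Y x ^ (2 * N)) \<partial>Q) =
      (\<integral>\<^sup>+x. ennreal (2 + c / a ^ N) * ennreal (X x ^ (2 * N)) + ennreal (c / b ^ N) * ennreal (Y x ^ (2 * N)) \<partial>Q)"
      by (intro nn_integral_cong) (simp only: ennreal_mult[OF p(1) ev] ennreal_mult[OF p(2) ev] ennreal_plus[OF mult_nonneg_nonneg[OF p(1) ev] mult_nonneg_nonneg[OF p(2) ev]])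
    thus ?thesis by (simp only:) (subst nn_integral_add, measurable, simp add: nn_integral_cmult)
  qed
  also have "\<dots> \<le> ennreal (2 + c / a ^ N) * ennreal (a ^ N) + ennreal (c / b ^ N) * ennreal (b ^ N)"
    by (intro add_mono mult_left_mono X Y) auto
  also have "\<dots> = ennreal ((2 + c / a ^ N) * a ^ N + (c / b ^ N) * b ^ N)"
  proof -
    have p: "0 \<le> 2 + c / a ^ N" "0 \<le> c / b ^ N" "0 \<le> a ^ N" "0 \<le> b ^ N" using c ab by auto
    show ?thesis
      by (simp only: ennreal_mult[OF p(1,3)] ennreal_mult[OF p(2,4)]
            ennreal_plus[OF mult_nonneg_nonneg[OF p(1,3)] mult_nonneg_nonneg[OF p(2,4)]])
  qed
  also have "(2 + c / a ^ N) * a ^ N + (c / b ^ N) * b ^ N = 2 * (a + 2 * 4 ^ N * b) ^ N"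
  proof -
    have "(2 + c / a ^ N) * a ^ N + (c / b ^ N) * b ^ N = 2 * a ^ N + 2 * c"
      using ab by (simp add: distrib_right)
    thus ?thesis by (simp add: c_def)
  qed
  also have "ennreal (2 * (a + 2 * 4 ^ N * b) ^ N) = 2 * ennreal ((a + 2 * 4 ^ N * b) ^ N)"
    using ab by (simp add: ennreal_mult)
  finally show ?thesis
    by (subst (asm) ennreal_mult_le_mult_iff) auto
qed

text \<open>Squared norms add up, at the fixed price 2 * 4^N per term. The bound has t + 1 in place
  of t because \<open>type2_step\<close> needs a positive \<open>a\<close>, also for the empty sum
  at the start.\<close>

lemma type2_sum:
  fixes D :: "nat \<Rightarrow> 'a \<Rightarrow> real"
  assumes m: "\<And>t. t < T \<Longrightarrow> D t \<in> borel_measurable Q"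
    and b: "0 < b" and N: "1 \<le> N"
    and sym: "\<And>t. t < T \<Longrightarrow> (\<integral>\<^sup>+x. ennreal (((\<Sum>s<t. D s x) - D t x) ^ (2 * N)) \<partial>Q) = (\<integral>\<^sup>+x. ennreal (((\<Sum>s<t. D s x) + D t x) ^ (2 * N)) \<partial>Q)"
    and bd: "\<And>t. t < T \<Longrightarrow> (\<integral>\<^sup>+x. ennreal (D t x ^ (2 * N)) \<partial>Q) \<le> ennreal (b ^ N)"
    and t: "t \<le> T"
  shows "(\<integral>\<^sup>+x. ennreal ((\<Sum>s<t. D s x) ^ (2 * N)) \<partial>Q) \<le> ennreal ((2 * 4 ^ N * b * (real t + 1)) ^ N)"
  using t
proof (induction t)
  case 0
  thus ?case using N by (simp add: power_0_left)
next
  case (Suc t)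
  hence t: "t < T" by simp
  have "(\<integral>\<^sup>+x. ennreal (((\<Sum>s<t. D s x) + D t x) ^ (2 * N)) \<partial>Q) \<le> ennreal ((2 * 4 ^ N * b * (real t + 1) + 2 * 4 ^ N * b) ^ N)"
    using Suc t m b by (intro type2_step sym bd) (auto intro!: borel_measurable_sum)
  thus ?case by (simp add: algebra_simps)
qed

text \<open>Convexity of an even power; the missing weight (1/2)^T sits at 0, where the power
  vanishes. It serves the constant parts of atoms, whose levels have no sign symmetry but decaying
  weights.\<close>

lemma dyadic_jensen:
  fixes A :: "nat \<Rightarrow> real"
  assumes "1 \<le> N"
  shows "(\<Sum>t<T. (1/2) ^ Suc t * A t) ^ (2 * N) \<le> (\<Sum>t<T. (1/2) ^ Suc t * A t ^ (2 * N))"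
proof (induction T arbitrary: A)
  case 0
  thus ?case using assms by (simp add: power_0_left)
next
  case (Suc T)
  define S where "S = (\<Sum>t<T. (1/2) ^ Suc t * A (Suc t))"
  have mid: "((x + y) / 2) ^ (2 * N) \<le> (x ^ (2 * N) + y ^ (2 * N)) / 2" for x y :: real
  proof -
    have "((1 - 1/2) *\<^sub>R x + (1/2) *\<^sub>R y) ^ (2 * N) \<le> (1 - 1/2) * x ^ (2 * N) + (1/2) * y ^ (2 * N)"
      by (rule convex_onD[OF convex_power_even]) auto
    thus ?thesis by (simp add: add_divide_distrib)
  qed
  have eq: "(\<Sum>t<Suc T. (1/2) ^ Suc t * A t) = (A 0 + S) / 2"
    unfolding S_def by (subst sum.lessThan_Suc_shift) (simp add: sum_divide_distrib sum_distrib_left add_divide_distrib)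
  have "(\<Sum>t<Suc T. (1/2) ^ Suc t * A t) ^ (2 * N) \<le> (A 0 ^ (2 * N) + S ^ (2 * N)) / 2"
    unfolding eq by (rule mid)
  also have "\<dots> \<le> (A 0 ^ (2 * N) + (\<Sum>t<T. (1/2) ^ Suc t * A (Suc t) ^ (2 * N))) / 2"
    unfolding S_def by (intro divide_right_mono add_left_mono Suc) auto
  also have "\<dots> = (\<Sum>t<Suc T. (1/2) ^ Suc t * A t ^ (2 * N))"
    by (subst sum.lessThan_Suc_shift) (simp add: sum_divide_distrib sum_distrib_left add_divide_distrib)
  finally show ?case .
qed

section \<open>Sums over dyadic boxes\<close>

text \<open>The shapes \<open>s\<close> are unconstrained; the restriction to \<open>s\<^sub>1 + \<dots> + s\<^sub>d = n\<close> is imposed later through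
  the coefficients \<open>c\<close>. This keeps the class of these sums closed under freezing a variable.\<close>

definition dyadic_sum :: "nat \<Rightarrow> 'a set \<Rightarrow> nat \<Rightarrow> (('a \<Rightarrow> nat) \<Rightarrow> ('a \<Rightarrow> nat) \<Rightarrow> real) \<Rightarrow> ('a \<Rightarrow> real) \<Rightarrow> real" where
  "dyadic_sum r J T c x = (\<Sum>s\<in>PiE J (\<lambda>_. {..<T}). \<Sum>i\<in>PiE J (\<lambda>j. {..<2 ^ s j}).
      c s i * (\<Prod>j\<in>J. atom r (s j) (i j) (x j)))"

lemma atom_measurable [measurable]: "atom r t l \<in> borel_measurable borel"
  using bounded_borel_atom by (auto simp: bounded_borel_def)

lemma dyadic_sum_measurable:
  assumes "finite J"
  shows "dyadic_sum r J T c \<in> borel_measurable (PiM J (\<lambda>_. lborel))"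
proof -
  have "(\<lambda>x. dyadic_sum r J T c x) \<in> borel_measurable (PiM J (\<lambda>_. lborel))"
    unfolding dyadic_sum_def
  proof (intro borel_measurable_sum borel_measurable_times borel_measurable_const borel_measurable_prod)
    fix s i j assume j: "j \<in> J"
    show "(\<lambda>x. atom r (s j) (i j) (x j)) \<in> borel_measurable (PiM J (\<lambda>_. lborel))"
      by (rule measurable_compose[OF measurable_component_singleton[OF j]]) simp
  qed
  thus ?thesis by simp
qed

lemma sum_PiE_insert:
  fixes f :: "('a \<Rightarrow> 'b) \<Rightarrow> real"
  assumes "j \<notin> J"
  shows "(\<Sum>g\<in>PiE (insert j J) B. f g) = (\<Sum>y\<in>B j. \<Sum>g\<in>PiE J B. f (g(j := y)))"
  unfolding PiE_insert_eq sum.cartesian_product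
  by (subst sum.reindex[OF inj_combinator[OF assms]]) (auto intro!: sum.cong)

lemma dyadic_sum_insert:
  assumes "finite J" "j \<notin> J"
  shows "dyadic_sum r (insert j J) T c x =
    (\<Sum>t<T. \<Sum>l<2 ^ t. atom r t l (x j) * dyadic_sum r J T (\<lambda>s i. c (s(j := t)) (i(j := l))) x)"
proof -
  have inner: "(\<Sum>i\<in>PiE (insert j J) (\<lambda>k. {..<2 ^ (s(j := t)) k}). c (s(j := t)) i * (\<Prod>k\<in>insert j J. atom r ((s(j := t)) k) (i k) (x k))) =
     (\<Sum>l<2 ^ t. atom r t l (x j) * (\<Sum>i\<in>PiE J (\<lambda>k. {..<2 ^ s k}). c (s(j := t)) (i(j := l)) * (\<Prod>k\<in>J. atom r (s k) (i k) (x k))))" for s t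
  proof -
    have P: "PiE J (\<lambda>k. {..<2 ^ (s(j := t)) k}) = PiE J (\<lambda>k. {..<2 ^ s k})"
      using assms(2) by (intro PiE_cong) auto
    have Q: "(\<Prod>k\<in>J. atom r ((s(j := t)) k) ((i(j := l)) k) (x k)) = (\<Prod>k\<in>J. atom r (s k) (i k) (x k))" for i l
      using assms(2) by (intro prod.cong) auto
    show ?thesis
      unfolding sum_PiE_insert[OF assms(2)] P sum_distrib_left prod.insert[OF assms] Q
      by (intro sum.cong) auto
  qed
  have "dyadic_sum r (insert j J) T c x = (\<Sum>t<T. \<Sum>s\<in>PiE J (\<lambda>_. {..<T}). \<Sum>l<2 ^ t. atom r t l (x j) * (\<Sum>i\<in>PiE J (\<lambda>k. {..<2 ^ s k}). c (s(j := t)) (i(j := l)) * (\<Prod>k\<in>J. atom r (s k) (i k) (x k))))"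
    unfolding dyadic_sum_def sum_PiE_insert[OF assms(2), of _ "\<lambda>_. {..<T}"] inner ..
  also have "\<dots> = (\<Sum>t<T. \<Sum>l<2 ^ t. \<Sum>s\<in>PiE J (\<lambda>_. {..<T}). atom r t l (x j) * (\<Sum>i\<in>PiE J (\<lambda>k. {..<2 ^ s k}). c (s(j := t)) (i(j := l)) * (\<Prod>k\<in>J. atom r (s k) (i k) (x k))))"
    by (intro sum.cong refl sum.swap)
  finally show ?thesis unfolding dyadic_sum_def sum_distrib_left .
qed

section \<open>Splitting off one variable\<close>

lemma dyadic_sum_cong: "(\<And>j. j \<in> J \<Longrightarrow> x j = y j) \<Longrightarrow> dyadic_sum r J T c x = dyadic_sum r J T c y"
  unfolding dyadic_sum_def by (intro sum.cong refl arg_cong2[where f = "(*)"] prod.cong) auto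

lemma dyadic_sum_sum: "(\<Sum>a\<in>A. w a * dyadic_sum r J T (c a) x) = dyadic_sum r J T (\<lambda>s i. \<Sum>a\<in>A. w a * c a s i) x"
proof -
  have "dyadic_sum r J T (\<lambda>s i. \<Sum>a\<in>A. w a * c a s i) x =
    (\<Sum>s\<in>PiE J (\<lambda>_. {..<T}). \<Sum>i\<in>PiE J (\<lambda>j. {..<2 ^ s j}). \<Sum>a\<in>A. w a * (c a s i * (\<Prod>j\<in>J. atom r (s j) (i j) (x j))))"
    unfolding dyadic_sum_def sum_distrib_right by (simp add: mult_ac)
  also have "\<dots> = (\<Sum>s\<in>PiE J (\<lambda>_. {..<T}). \<Sum>a\<in>A. \<Sum>i\<in>PiE J (\<lambda>j. {..<2 ^ s j}). w a * (c a s i * (\<Prod>j\<in>J. atom r (s j) (i j) (x j))))"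
    by (intro sum.cong refl sum.swap)
  also have "\<dots> = (\<Sum>a\<in>A. w a * dyadic_sum r J T (c a) x)"
    unfolding dyadic_sum_def sum_distrib_left by (rule sum.swap)
  finally show ?thesis by simp
qed

lemma dyadic_sum_scale: "k * dyadic_sum r J T c x = dyadic_sum r J T (\<lambda>s i. k * c s i) x"
  unfolding dyadic_sum_def sum_distrib_left by (simp add: mult_ac)

text \<open>The dyadic intervals of one level are disjoint, so at most one term is nonzero. Hence
  freezing a variable does not enlarge the bound on the coefficients.\<close>

lemma sum_rademacher_le_1: "(\<Sum>l<2 ^ t. \<bar>rademacher r (2 ^ t * y - real l)\<bar>) \<le> 1"
proof -
  have "(\<Sum>l<2 ^ t. \<bar>rademacher r (2 ^ t * y - real l)\<bar>) \<le> (\<Sum>l<2 ^ t. if l = nat \<lfloor>2 ^ t * y\<rfloor> then 1 else 0)"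
  proof (intro sum_mono)
    fix l :: nat
    show "\<bar>rademacher r (2 ^ t * y - real l)\<bar> \<le> (if l = nat \<lfloor>2 ^ t * y\<rfloor> then 1 else 0)"
    proof (cases "rademacher r (2 ^ t * y - real l) = 0")
      case False
      hence "0 \<le> 2 ^ t * y - real l" "2 ^ t * y - real l < 1" using rademacher_support by blast+
      hence "\<lfloor>2 ^ t * y\<rfloor> = int l" by linarith
      thus ?thesis using rademacher_bound by simp
    qed simp
  qed
  also have "\<dots> \<le> 1" by simp
  finally show ?thesis .
qed

lemma rademacher_unit_zero: "l < 2 ^ t \<Longrightarrow> \<not> (0 \<le> y \<and> y < 1) \<Longrightarrow> rademacher r (2 ^ t * y - real l) = 0"
  using rademacher_support'[of l t r y] by blast

text \<open>The oscillating parts have disjoint supports, and each of the 2^t constant parts carries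
  a factor (1/2)^((r+1)t).\<close>

lemma sum_atom_le:
  "(\<Sum>l<2 ^ t. \<bar>atom r t l y\<bar>) \<le> (\<bar>osc_coeff r\<bar> + mean_coeff r) * indicator {0..<1} y" if "1 \<le> r"
proof (cases "0 \<le> y \<and> y < 1")
  case True
  have mean_coeff: "0 \<le> mean_coeff r" using bump_mass_pos[of r] by (simp add: mean_coeff_def)
  have "(\<Sum>l<2 ^ t. \<bar>atom r t l y\<bar>) \<le> (\<Sum>l<2 ^ t. \<bar>osc_coeff r\<bar> * \<bar>rademacher r (2 ^ t * y - real l)\<bar> + mean_coeff r * (1/2) ^ ((r + 1) * t))"
  proof (intro sum_mono)
    fix l
    have "\<bar>atom r t l y\<bar> \<le> \<bar>osc_coeff r * rademacher r (2 ^ t * y - real l)\<bar> + \<bar>mean_coeff r * (1/2) ^ ((r + 1) * t)\<bar>"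
      using True abs_triangle_ineq by (simp add: atom_def)
    thus "\<bar>atom r t l y\<bar> \<le> \<bar>osc_coeff r\<bar> * \<bar>rademacher r (2 ^ t * y - real l)\<bar> + mean_coeff r * (1/2) ^ ((r + 1) * t)"
      using mean_coeff by (simp add: abs_mult)
  qed
  also have "\<dots> = \<bar>osc_coeff r\<bar> * (\<Sum>l<2 ^ t. \<bar>rademacher r (2 ^ t * y - real l)\<bar>) + 2 ^ t * (mean_coeff r * (1/2) ^ ((r + 1) * t))"
    by (simp add: sum.distrib sum_distrib_left)
  also have "\<dots> \<le> \<bar>osc_coeff r\<bar> * 1 + mean_coeff r * 1"
  proof (intro add_mono mult_left_mono sum_rademacher_le_1)
    have "2 ^ t * (1/2) ^ ((r + 1) * t) = (1/2::real) ^ (r * t)"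
      by (simp add: power_add power_one_over)
    also have "\<dots> \<le> 1" by (simp add: power_le_one)
    finally have "mean_coeff r * (2 ^ t * (1/2) ^ ((r + 1) * t)) \<le> mean_coeff r * 1" using mean_coeff by (rule mult_left_mono)
    thus "2 ^ t * (mean_coeff r * (1/2) ^ ((r + 1) * t)) \<le> mean_coeff r * 1" by (simp add: mult_ac)
  qed simp
  finally show ?thesis using True by simp
next
  case False
  have "atom r t l y = 0" if "l < 2 ^ t" for l
    using False atom_support[OF that] by blast
  thus ?thesis using False by (auto simp: indicator_def)
qed

text \<open>The weight (1/2)^((r+1)t) of the constant part is shared out: (1/2)^t averages over the
  positions, (1/2)^((r-1)t) is at most 1, and the last (1/2)^t, written as twice (1/2)^Suc t, is the
  weight for \<open>dyadic_jensen\<close>. In both parts the new coefficients are bounded by 1 if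
  the old ones are.\<close>

lemma atom_split:
  assumes "1 \<le> r"
  shows "(\<Sum>l<2 ^ t. atom r t l y * dyadic_sum r J T (c l) x) =
    osc_coeff r * dyadic_sum r J T (\<lambda>s i. \<Sum>l<2 ^ t. rademacher r (2 ^ t * y - real l) * c l s i) x +
    2 * mean_coeff r * indicator {0..<1} y * ((1/2) ^ Suc t * dyadic_sum r J T (\<lambda>s i. (1/2) ^ ((r - 1) * t) * (\<Sum>l<2 ^ t. (1/2) ^ t * c l s i)) x)"
proof -
  have e: "(1/2::real) ^ ((r + 1) * t) = (1/2) ^ t * ((1/2) ^ ((r - 1) * t) * (1/2) ^ t)"
    using assms by (cases r) (auto simp: power_add algebra_simps)
  have "(\<Sum>l<2 ^ t. atom r t l y * dyadic_sum r J T (c l) x) =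
    osc_coeff r * (\<Sum>l<2 ^ t. rademacher r (2 ^ t * y - real l) * dyadic_sum r J T (c l) x) + mean_coeff r * indicator {0..<1} y * ((1/2) ^ t * ((1/2) ^ ((r - 1) * t) * (\<Sum>l<2 ^ t. (1/2) ^ t * dyadic_sum r J T (c l) x)))"
    unfolding atom_def e sum_distrib_left by (simp add: algebra_simps sum.distrib)
  also have "(\<Sum>l<2 ^ t. rademacher r (2 ^ t * y - real l) * dyadic_sum r J T (c l) x) = dyadic_sum r J T (\<lambda>s i. \<Sum>l<2 ^ t. rademacher r (2 ^ t * y - real l) * c l s i) x"
    by (rule dyadic_sum_sum)
  also have "(\<Sum>l<2 ^ t. (1/2) ^ t * dyadic_sum r J T (c l) x) = dyadic_sum r J T (\<lambda>s i. \<Sum>l<2 ^ t. (1/2) ^ t * c l s i) x"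
    by (rule dyadic_sum_sum)
  also have "(1/2) ^ ((r - 1) * t) * \<dots> = dyadic_sum r J T (\<lambda>s i. (1/2) ^ ((r - 1) * t) * (\<Sum>l<2 ^ t. (1/2) ^ t * c l s i)) x" (is "_ = ?H")
    by (rule dyadic_sum_scale)
  also have "mean_coeff r * indicator {0..<1} y * ((1/2) ^ t * ?H) = 2 * mean_coeff r * indicator {0..<1} y * ((1/2) ^ Suc t * ?H)"
    by simp
  finally show ?thesis .
qed

lemma even_power_add_le:
  fixes u v :: real
  shows "(u + v) ^ (2 * N) \<le> 4 ^ N * (u ^ (2 * N) + v ^ (2 * N))"
proof -
  have "\<bar>u + v\<bar> ^ (2 * N) \<le> (2 * max \<bar>u\<bar> \<bar>v\<bar>) ^ (2 * N)"
    by (intro power_mono) auto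
  also have "\<dots> = 4 ^ N * max \<bar>u\<bar> \<bar>v\<bar> ^ (2 * N)" by (simp add: power_mult_distrib power_mult)
  also have "\<dots> \<le> 4 ^ N * (u ^ (2 * N) + v ^ (2 * N))"
    by (intro mult_left_mono) (auto simp: max_def power_even_abs zero_le_even_power)
  finally show ?thesis by (simp add: power_even_abs)
qed

lemma power_add_superadditive:
  fixes a b :: real
  assumes "0 \<le> a" "0 \<le> b" "1 \<le> N"
  shows "a ^ N + b ^ N \<le> (a + b) ^ N"
  using assms(3)
proof (induction N rule: nat_induct_at_least)
  case (Suc n)
  have "a ^ Suc n + b ^ Suc n \<le> (a + b) * (a ^ n + b ^ n)"
    using assms by (simp add: algebra_simps)
  also have "\<dots> \<le> (a + b) * (a + b) ^ n" using assms Suc by (intro mult_left_mono) auto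
  finally show ?case by simp
qed simp

lemma osc_coeff_nonzero: "osc_coeff r \<noteq> 0"
  by (simp add: osc_coeff_def)

lemma mean_coeff_pos: "0 < mean_coeff r"
  using bump_mass_pos[of r] by (simp add: mean_coeff_def)

text \<open>The outer 4 is due to \<open>even_power_add_le\<close>, 2 * 4^N to
  \<open>type2_step\<close>, the 2 before it to T + 1 \<le> 2 T, and the last 4 to the factor 2 of
  the constant part in \<open>atom_split\<close>.\<close>

definition moment_const :: "nat \<Rightarrow> nat \<Rightarrow> real" where
  "moment_const r N = 4 * (2 * (2 * 4 ^ N) * (osc_coeff r)\<^sup>2 + 4 * (mean_coeff r)\<^sup>2)"

lemma moment_const_pos: "0 < moment_const r N"
  unfolding moment_const_def using mean_coeff_pos[of r] by (intro mult_pos_pos add_nonneg_pos) auto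

text \<open>With the split-off variable as second component of a pair, Fubini is available in both
  orders: it is integrated last when moments are bounded with it frozen, and first when one of its
  digits is flipped.\<close>

lemma PiM_insert_pair:
  fixes f :: "('a \<Rightarrow> real) \<Rightarrow> ennreal"
  assumes "finite J" "j \<notin> J" "f \<in> borel_measurable (PiM (insert j J) (\<lambda>_. lborel))"
  shows "(\<integral>\<^sup>+x. f x \<partial>PiM (insert j J) (\<lambda>_. lborel)) = (\<integral>\<^sup>+z. f ((fst z)(j := snd z)) \<partial>(PiM J (\<lambda>_. lborel) \<Otimes>\<^sub>M lborel))"
proof -
  interpret product_sigma_finite "\<lambda>_::'a. lborel :: real measure" ..
  have [measurable]: "(\<lambda>z. (fst z)(j := snd z)) \<in> measurable (PiM J (\<lambda>_. lborel) \<Otimes>\<^sub>M (lborel :: real measure)) (PiM (insert j J) (\<lambda>_. lborel))"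
    using measurable_add_dim[of j J "\<lambda>_. lborel :: real measure"] by (simp add: case_prod_beta')
  note [measurable] = assms(3)
  show ?thesis
    unfolding product_nn_integral_insert[OF assms]
    by (subst lborel.nn_integral_fst[symmetric]) auto
qed

lemma pair_nn_integral_le:
  fixes F :: "('a \<Rightarrow> real) \<times> real \<Rightarrow> ennreal"
  assumes "finite J" "F \<in> borel_measurable (PiM J (\<lambda>_. lborel) \<Otimes>\<^sub>M lborel)"
    and "\<And>y. (\<integral>\<^sup>+x. F (x, y) \<partial>PiM J (\<lambda>_. lborel)) \<le> B * indicator {0..<1::real} y"
  shows "(\<integral>\<^sup>+z. F z \<partial>(PiM J (\<lambda>_. lborel) \<Otimes>\<^sub>M lborel)) \<le> B"
proof -
  interpret product_sigma_finite "\<lambda>_::'a. lborel :: real measure" ..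
  interpret J: sigma_finite_measure "PiM J (\<lambda>_::'a. lborel :: real measure)" by (rule sigma_finite[OF assms(1)])
  interpret pair_sigma_finite "PiM J (\<lambda>_::'a. lborel :: real measure)" "lborel :: real measure" ..
  have "(\<integral>\<^sup>+z. F z \<partial>(PiM J (\<lambda>_. lborel) \<Otimes>\<^sub>M lborel)) = (\<integral>\<^sup>+y. (\<integral>\<^sup>+x. F (x, y) \<partial>PiM J (\<lambda>_. lborel)) \<partial>lborel)"
    by (rule nn_integral_snd[symmetric, OF assms(2)])
  also have "\<dots> \<le> (\<integral>\<^sup>+y. B * indicator {0..<1::real} y \<partial>lborel)"
    by (intro nn_integral_mono assms(3))
  also have "\<dots> = B" by (subst nn_integral_cmult_indicator) auto
  finally show ?thesis .
qed

lemma dyadic_sum_zero: "dyadic_sum r J T (\<lambda>s i. 0) x = 0"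
  unfolding dyadic_sum_def by simp

text \<open>Every variable costs one factor \<open>T\<close> in the squared norm. With the new
  variable frozen, each level \<open>D t\<close> is a sum over \<open>J\<close> with bounded
  coefficients, to which the induction hypothesis applies; the type 2 inequality in the new variable
  then adds the \<open>T\<close> levels. The constant parts, collected in \<open>V\<close>, form an
  average of such sums and cost no factor \<open>T\<close>.\<close>

lemma dyadic_sum_moment:
  fixes J :: "'a set"
  assumes J: "finite J" and r: "1 \<le> r" and N: "1 \<le> N" and T: "1 \<le> T" and c: "\<And>s i. \<bar>c s i\<bar> \<le> 1"
  shows "(\<integral>\<^sup>+x. ennreal (dyadic_sum r J T c x ^ (2 * N)) \<partial>PiM J (\<lambda>_. lborel))
     \<le> ennreal ((moment_const r N ^ card J * real T ^ card J) ^ N)"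
  using J c
proof (induction J arbitrary: c rule: finite_induct)
  case empty
  have le: "dyadic_sum r {} T c x ^ (2 * N) \<le> 1" for x :: "'a \<Rightarrow> real"
  proof -
    have "\<bar>dyadic_sum r {} T c x\<bar> \<le> 1" using empty by (simp add: dyadic_sum_def)
    hence "\<bar>dyadic_sum r {} T c x\<bar> ^ (2 * N) \<le> 1" by (rule power_le_one[OF abs_ge_zero])
    thus ?thesis by (simp add: power_even_abs)
  qed
  have "(\<integral>\<^sup>+x. ennreal (dyadic_sum r {} T c x ^ (2 * N)) \<partial>PiM {} (\<lambda>_::'a. lborel)) \<le> (\<integral>\<^sup>+x. 1 \<partial>PiM {} (\<lambda>_::'a. lborel :: real measure))"
    by (intro nn_integral_mono) (simp add: ennreal_le_1 le)
  also have "\<dots> = 1" by (simp add: PiM_empty)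
  finally show ?case by simp
next
  case (insert j J)
  note j = insert.hyps
  note c = insert.prems
  let ?M = "PiM J (\<lambda>_::'a. lborel :: real measure)"
  let ?Q = "?M \<Otimes>\<^sub>M (lborel :: real measure)"
  let ?C = "moment_const r N"
  define B where "B = ?C ^ card J * real T ^ card J"
  have B: "0 < B" using moment_const_pos[of r N] T by (simp add: B_def)
  have IH: "(\<integral>\<^sup>+x. ennreal (dyadic_sum r J T c x ^ (2 * N)) \<partial>?M) \<le> ennreal (B ^ N)" if "\<And>s i. \<bar>c s i\<bar> \<le> 1" for c
    unfolding B_def by (rule insert.IH) (rule that)
  have [measurable]: "dyadic_sum r J T c \<in> borel_measurable ?M" for c by (rule dyadic_sum_measurable[OF j(1)])
  define ct where "ct = (\<lambda>t l s i. c (s(j := t)) (i(j := l)))"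
  have ct: "\<bar>ct t l s i\<bar> \<le> 1" for t l s i by (simp add: ct_def c)
  define P where "P = (\<lambda>t y x. dyadic_sum r J T (\<lambda>s i. \<Sum>l<2 ^ t. rademacher r (2 ^ t * y - real l) * ct t l s i) x)"
  define R where "R = (\<lambda>t x. dyadic_sum r J T (\<lambda>s i. (1/2) ^ ((r - 1) * t) * (\<Sum>l<2 ^ t. (1/2) ^ t * ct t l s i)) x)"
  define D where "D = (\<lambda>t z. osc_coeff r * P t (snd z) (fst z))"
  define V where "V = (\<lambda>z :: ('a \<Rightarrow> real) \<times> real. 2 * mean_coeff r * indicator {0..<1} (snd z) * (\<Sum>t<T. (1/2) ^ Suc t * R t (fst z)))"
  have Psum: "P t y x = (\<Sum>l<2 ^ t. rademacher r (2 ^ t * y - real l) * dyadic_sum r J T (ct t l) x)" for t y x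
    unfolding P_def by (rule dyadic_sum_sum[symmetric])
  have Pm [measurable]: "(\<lambda>z. P t (snd z) (fst z)) \<in> borel_measurable ?Q" for t
    unfolding Psum by measurable
  have Rm [measurable]: "R t \<in> borel_measurable ?M" for t
    unfolding R_def by measurable
  have Dm [measurable]: "D t \<in> borel_measurable ?Q" for t
    unfolding D_def by measurable
  have Vm [measurable]: "V \<in> borel_measurable ?Q"
    unfolding V_def by measurable
  have H: "dyadic_sum r (insert j J) T c ((fst z)(j := snd z)) = (\<Sum>t<T. D t z) + V z" for z
  proof -
    have e: "dyadic_sum r J T c' ((fst z)(j := snd z)) = dyadic_sum r J T c' (fst z)" for c'
      by (rule dyadic_sum_cong) (use j in auto)
    have "dyadic_sum r (insert j J) T c ((fst z)(j := snd z)) = (\<Sum>t<T. \<Sum>l<2 ^ t. atom r t l (snd z) * dyadic_sum r J T (ct t l) (fst z))"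
      unfolding dyadic_sum_insert[OF j] e ct_def by simp
    also have "\<dots> = (\<Sum>t<T. D t z + 2 * mean_coeff r * indicator {0..<1} (snd z) * ((1/2) ^ Suc t * R t (fst z)))"
      unfolding atom_split[OF r] D_def P_def R_def ..
    finally show ?thesis unfolding V_def sum.distrib sum_distrib_left .
  qed
  \<comment> \<open>The indicator is kept because the later integration over \<open>y\<close> runs
    over the whole line.\<close>
  have Pbound: "(\<integral>\<^sup>+x. ennreal (P t y x ^ (2 * N)) \<partial>?M) \<le> ennreal (B ^ N) * indicator {0..<1} y" for t y
  proof (cases "0 \<le> y \<and> y < 1")
    case True
    have "\<bar>\<Sum>l<2 ^ t. rademacher r (2 ^ t * y - real l) * ct t l s i\<bar> \<le> 1" for s i
    proof -
      have "\<bar>\<Sum>l<2 ^ t. rademacher r (2 ^ t * y - real l) * ct t l s i\<bar> \<le> (\<Sum>l<2 ^ t. \<bar>rademacher r (2 ^ t * y - real l) * ct t l s i\<bar>)"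
        by (rule sum_abs)
      also have "\<dots> \<le> (\<Sum>l<2 ^ t. \<bar>rademacher r (2 ^ t * y - real l)\<bar>)"
        by (intro sum_mono) (auto simp: abs_mult intro!: mult_left_le ct)
      also have "\<dots> \<le> 1" by (rule sum_rademacher_le_1)
      finally show ?thesis .
    qed
    from IH[OF this] show ?thesis using True unfolding P_def by simp
  next
    case False
    have "P t y x = 0" for x
      unfolding Psum using rademacher_unit_zero[OF _ False] by (intro sum.neutral) auto
    thus ?thesis using N by (simp add: power_0_left)
  qed
  have Rbound: "(\<integral>\<^sup>+x. ennreal (R t x ^ (2 * N)) \<partial>?M) \<le> ennreal (B ^ N)" for t
    unfolding R_def
  proof (rule IH)
    fix s i
    have "\<bar>\<Sum>l<2 ^ t. (1/2) ^ t * ct t l s i\<bar> \<le> (\<Sum>l<2 ^ t. \<bar>(1/2) ^ t * ct t l s i\<bar>)" by (rule sum_abs)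
    also have "\<dots> \<le> (\<Sum>l<(2::nat) ^ t. (1/2) ^ t)"
      by (intro sum_mono) (auto simp: abs_mult power_abs intro!: mult_left_le ct)
    also have "\<dots> = 1" by (simp add: power_one_over)
    finally have "(1/2) ^ ((r - 1) * t) * \<bar>\<Sum>l<2 ^ t. (1/2) ^ t * ct t l s i\<bar> \<le> 1 * 1"
      by (intro mult_mono) (auto simp: power_le_one)
    thus "\<bar>(1/2) ^ ((r - 1) * t) * (\<Sum>l<2 ^ t. (1/2) ^ t * ct t l s i)\<bar> \<le> 1"
      by (simp add: abs_mult power_abs)
  qed
  have Dbound: "(\<integral>\<^sup>+z. ennreal (D t z ^ (2 * N)) \<partial>?Q) \<le> ennreal (((osc_coeff r)\<^sup>2 * B) ^ N)" for t
  proof (rule pair_nn_integral_le[OF j(1)])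
    fix y
    have "(\<integral>\<^sup>+x. ennreal (D t (x, y) ^ (2 * N)) \<partial>?M) = (\<integral>\<^sup>+x. ennreal (osc_coeff r ^ (2 * N)) * ennreal (P t y x ^ (2 * N)) \<partial>?M)"
      by (intro nn_integral_cong) (simp add: D_def power_mult_distrib ennreal_mult zero_le_even_power)
    also have "\<dots> = ennreal (osc_coeff r ^ (2 * N)) * (\<integral>\<^sup>+x. ennreal (P t y x ^ (2 * N)) \<partial>?M)"
      unfolding P_def by (intro nn_integral_cmult) measurable
    also have "\<dots> \<le> ennreal (osc_coeff r ^ (2 * N)) * (ennreal (B ^ N) * indicator {0..<1} y)"
      by (intro mult_left_mono Pbound) auto
    also have "\<dots> = ennreal (osc_coeff r ^ (2 * N)) * ennreal (B ^ N) * indicator {0..<1} y" by (simp only: mult.assoc)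
    also have "ennreal (osc_coeff r ^ (2 * N)) * ennreal (B ^ N) = ennreal (((osc_coeff r)\<^sup>2 * B) ^ N)"
      using B by (simp add: ennreal_mult[symmetric] zero_le_even_power power_mult_distrib power_mult)
    finally show "(\<integral>\<^sup>+x. ennreal (D t (x, y) ^ (2 * N)) \<partial>?M) \<le> ennreal (((osc_coeff r)\<^sup>2 * B) ^ N) * indicator {0..<1} y" .
  qed measurable
  have Vbound: "(\<integral>\<^sup>+z. ennreal (V z ^ (2 * N)) \<partial>?Q) \<le> ennreal ((4 * (mean_coeff r)\<^sup>2 * B) ^ N)"
  proof (rule pair_nn_integral_le[OF j(1)])
    fix y :: real
    let ?k = "(2 * mean_coeff r * indicator {0..<1} y) ^ (2 * N)"
    have k0: "0 \<le> ?k" by (simp add: zero_le_even_power)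
    have "(\<integral>\<^sup>+x. ennreal (V (x, y) ^ (2 * N)) \<partial>?M) \<le> (\<integral>\<^sup>+x. ennreal ?k * (\<Sum>t<T. ennreal ((1/2) ^ Suc t) * ennreal (R t x ^ (2 * N))) \<partial>?M)"
    proof (rule nn_integral_mono)
      fix x
      have "V (x, y) ^ (2 * N) = ?k * (\<Sum>t<T. (1/2) ^ Suc t * R t x) ^ (2 * N)"
        by (simp add: V_def power_mult_distrib)
      also have "\<dots> \<le> ?k * (\<Sum>t<T. (1/2) ^ Suc t * R t x ^ (2 * N))"
        by (intro mult_left_mono dyadic_jensen N k0)
      finally have "ennreal (V (x, y) ^ (2 * N)) \<le> ennreal (?k * (\<Sum>t<T. (1/2) ^ Suc t * R t x ^ (2 * N)))"
        by (rule ennreal_leI)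
      also have "\<dots> = ennreal ?k * (\<Sum>t<T. ennreal ((1/2) ^ Suc t * R t x ^ (2 * N)))"
        by (subst sum_ennreal) (auto simp: ennreal_mult k0 zero_le_even_power sum_nonneg)
      also have "\<dots> = ennreal ?k * (\<Sum>t<T. ennreal ((1/2) ^ Suc t) * ennreal (R t x ^ (2 * N)))"
        by (intro arg_cong2[where f = "(*)"] sum.cong refl ennreal_mult) (auto simp: zero_le_even_power)
      finally show "ennreal (V (x, y) ^ (2 * N)) \<le> ennreal ?k * (\<Sum>t<T. ennreal ((1/2) ^ Suc t) * ennreal (R t x ^ (2 * N)))" .
    qed
    also have "\<dots> = ennreal ?k * (\<Sum>t<T. ennreal ((1/2) ^ Suc t) * (\<integral>\<^sup>+x. ennreal (R t x ^ (2 * N)) \<partial>?M))"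
      by (subst nn_integral_cmult) (auto simp: nn_integral_sum nn_integral_cmult)
    also have "\<dots> \<le> ennreal ?k * (\<Sum>t<T. ennreal ((1/2) ^ Suc t) * ennreal (B ^ N))"
      by (intro mult_left_mono sum_mono Rbound) auto
    also have "\<dots> \<le> ennreal ?k * ennreal (B ^ N)"
    proof (rule mult_left_mono)
      have "(\<Sum>t<T. ennreal ((1/2) ^ Suc t) * ennreal (B ^ N)) = (\<Sum>t<T. ennreal ((1/2) ^ Suc t * B ^ N))"
        using B by (intro sum.cong refl ennreal_mult[symmetric]) auto
      also have "\<dots> = ennreal (\<Sum>t<T. (1/2) ^ Suc t * B ^ N)"
        using B by (intro sum_ennreal) auto
      also have "(\<Sum>t<T. (1/2) ^ Suc t * B ^ N) = (\<Sum>t<T. (1/2) ^ Suc t) * B ^ N"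
        by (simp only: sum_distrib_right)
      also have "(\<Sum>t<T. (1/2::real) ^ Suc t) = 1 - (1/2) ^ T"
        by (induction T) auto
      also have "ennreal ((1 - (1/2) ^ T) * B ^ N) \<le> ennreal (1 * B ^ N)"
        using B by (intro ennreal_leI mult_right_mono) auto
      finally show "(\<Sum>t<T. ennreal ((1/2) ^ Suc t) * ennreal (B ^ N)) \<le> ennreal (B ^ N)" by simp
    qed simp
    also have "\<dots> = ennreal ((4 * (mean_coeff r)\<^sup>2 * B) ^ N) * indicator {0..<1} y"
    proof (cases "0 \<le> y \<and> y < 1")
      case True
      hence "?k * B ^ N = (4 * (mean_coeff r)\<^sup>2 * B) ^ N" by (simp add: power_mult_distrib power_mult)
      thus ?thesis using True B k0 by (simp add: ennreal_mult[symmetric])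
    qed (use N in \<open>auto simp: indicator_def power_0_left\<close>)
    finally show "(\<integral>\<^sup>+x. ennreal (V (x, y) ^ (2 * N)) \<partial>?M) \<le> ennreal ((4 * (mean_coeff r)\<^sup>2 * B) ^ N) * indicator {0..<1} y" .
  qed measurable
  have Ubound: "(\<integral>\<^sup>+z. ennreal ((\<Sum>t<T. D t z) ^ (2 * N)) \<partial>?Q) \<le> ennreal ((2 * 4 ^ N * ((osc_coeff r)\<^sup>2 * B) * (real T + 1)) ^ N)"
  proof (rule type2_sum[where T = T])
    fix t assume "t < T"
    show "(\<integral>\<^sup>+z. ennreal (((\<Sum>s<t. D s z) - D t z) ^ (2 * N)) \<partial>?Q) = (\<integral>\<^sup>+z. ennreal (((\<Sum>s<t. D s z) + D t z) ^ (2 * N)) \<partial>?Q)"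
    proof -
      define F where "F = (\<lambda>z. ennreal (((\<Sum>s<t. D s z) + D t z) ^ (2 * N)))"
      have [measurable]: "F \<in> borel_measurable ?Q" unfolding F_def by measurable
      have flip: "((\<Sum>s<t. D s (x, y)) - D t (x, y)) = (\<Sum>s<t. D s (x, digit_flip (t + r) y)) + D t (x, digit_flip (t + r) y)" for x y
      proof -
        have "D s (x, digit_flip (t + r) y) = D s (x, y)" if "s < t" for s
          unfolding D_def Psum fst_conv snd_conv rademacher_dyadic_invariant[OF that r] ..
        moreover have "D t (x, digit_flip (t + r) y) = - D t (x, y)"
          unfolding D_def Psum fst_conv snd_conv rademacher_dyadic_flip[OF r] by (simp add: sum_negf)
        ultimately show ?thesis by simp
      qed
      have "(\<integral>\<^sup>+z. ennreal (((\<Sum>s<t. D s z) - D t z) ^ (2 * N)) \<partial>?Q) = (\<integral>\<^sup>+x. (\<integral>\<^sup>+y. F (x, digit_flip (t + r) y) \<partial>lborel) \<partial>?M)"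
        unfolding F_def flip[symmetric] by (rule lborel.nn_integral_fst[symmetric]) measurable
      also have "\<dots> = (\<integral>\<^sup>+x. (\<integral>\<^sup>+y. F (x, y) \<partial>lborel) \<partial>?M)"
        by (intro nn_integral_cong digit_flip_nn_integral) measurable
      also have "\<dots> = (\<integral>\<^sup>+z. F z \<partial>?Q)" by (rule lborel.nn_integral_fst) measurable
      finally show ?thesis unfolding F_def .
    qed
  qed (use B N osc_coeff_nonzero[of r] in \<open>auto intro: Dbound\<close>)
  have m: "(\<lambda>x. ennreal (dyadic_sum r (insert j J) T c x ^ (2 * N))) \<in> borel_measurable (PiM (insert j J) (\<lambda>_. lborel))"
    using dyadic_sum_measurable[of "insert j J" r T c] j(1) by simp
  have "(\<integral>\<^sup>+x. ennreal (dyadic_sum r (insert j J) T c x ^ (2 * N)) \<partial>PiM (insert j J) (\<lambda>_. lborel)) =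
     (\<integral>\<^sup>+z. ennreal (((\<Sum>t<T. D t z) + V z) ^ (2 * N)) \<partial>?Q)"
    unfolding PiM_insert_pair[OF j m] H ..
  also have "\<dots> \<le> (\<integral>\<^sup>+z. ennreal (4 ^ N) * (ennreal ((\<Sum>t<T. D t z) ^ (2 * N)) + ennreal (V z ^ (2 * N))) \<partial>?Q)"
  proof (rule nn_integral_mono)
    fix z
    have "ennreal (((\<Sum>t<T. D t z) + V z) ^ (2 * N)) \<le> ennreal (4 ^ N * ((\<Sum>t<T. D t z) ^ (2 * N) + V z ^ (2 * N)))"
      by (intro ennreal_leI even_power_add_le)
    thus "ennreal (((\<Sum>t<T. D t z) + V z) ^ (2 * N)) \<le> ennreal (4 ^ N) * (ennreal ((\<Sum>t<T. D t z) ^ (2 * N)) + ennreal (V z ^ (2 * N)))"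
      by (simp add: ennreal_mult zero_le_even_power)
  qed
  also have "\<dots> = ennreal (4 ^ N) * ((\<integral>\<^sup>+z. ennreal ((\<Sum>t<T. D t z) ^ (2 * N)) \<partial>?Q) + (\<integral>\<^sup>+z. ennreal (V z ^ (2 * N)) \<partial>?Q))"
    by (subst nn_integral_cmult) (auto simp: nn_integral_add)
  also have "\<dots> \<le> ennreal (4 ^ N) * (ennreal ((2 * 4 ^ N * ((osc_coeff r)\<^sup>2 * B) * (real T + 1)) ^ N) + ennreal ((4 * (mean_coeff r)\<^sup>2 * B) ^ N))"
    by (intro mult_left_mono add_mono Ubound Vbound) auto
  also have "\<dots> = ennreal (4 ^ N * ((2 * 4 ^ N * ((osc_coeff r)\<^sup>2 * B) * (real T + 1)) ^ N + (4 * (mean_coeff r)\<^sup>2 * B) ^ N))"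
    using B by (simp add: ennreal_mult)
  also have "\<dots> \<le> ennreal ((?C * real T * B) ^ N)"
  proof (rule ennreal_leI)
    have "(2 * 4 ^ N * ((osc_coeff r)\<^sup>2 * B) * (real T + 1)) ^ N + (4 * (mean_coeff r)\<^sup>2 * B) ^ N \<le>
        (2 * 4 ^ N * ((osc_coeff r)\<^sup>2 * B) * (2 * real T)) ^ N + (4 * (mean_coeff r)\<^sup>2 * B * real T) ^ N"
    proof (intro add_mono power_mono mult_left_mono)
      show "4 * (mean_coeff r)\<^sup>2 * B \<le> 4 * (mean_coeff r)\<^sup>2 * B * real T" using T B mult_left_mono[of 1 "real T" "4 * (mean_coeff r)\<^sup>2 * B"] by simp
    qed (use T B in auto)
    also have "\<dots> \<le> (2 * 4 ^ N * ((osc_coeff r)\<^sup>2 * B) * (2 * real T) + 4 * (mean_coeff r)\<^sup>2 * B * real T) ^ N"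
      using B N by (intro power_add_superadditive) auto
    finally have "4 ^ N * ((2 * 4 ^ N * ((osc_coeff r)\<^sup>2 * B) * (real T + 1)) ^ N + (4 * (mean_coeff r)\<^sup>2 * B) ^ N) \<le>
       4 ^ N * (2 * 4 ^ N * ((osc_coeff r)\<^sup>2 * B) * (2 * real T) + 4 * (mean_coeff r)\<^sup>2 * B * real T) ^ N"
      by (rule mult_left_mono) simp
    also have "\<dots> = (4 * (2 * 4 ^ N * ((osc_coeff r)\<^sup>2 * B) * (2 * real T) + 4 * (mean_coeff r)\<^sup>2 * B * real T)) ^ N"
      by (simp only: power_mult_distrib)
    also have "4 * (2 * 4 ^ N * ((osc_coeff r)\<^sup>2 * B) * (2 * real T) + 4 * (mean_coeff r)\<^sup>2 * B * real T) = ?C * real T * B"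
      unfolding moment_const_def by (simp add: algebra_simps)
    finally show "4 ^ N * ((2 * 4 ^ N * ((osc_coeff r)\<^sup>2 * B) * (real T + 1)) ^ N + (4 * (mean_coeff r)\<^sup>2 * B) ^ N) \<le> (?C * real T * B) ^ N" .
  qed
  also have "?C * real T * B = ?C ^ card (insert j J) * real T ^ card (insert j J)"
    using j by (simp add: B_def)
  finally show ?case .
qed

text \<open>Since \<open>s j\<close> is determined by the other levels, freezing the variable \<open>x j\<close> leaves a sum over \<open>J\<close>
  with bounded coefficients, so this variable costs no factor \<open>n\<close>.\<close>

lemma dyadic_sum_moment_diagonal:
  fixes J :: "'a set"
  assumes J: "finite J" "j \<notin> J" and r: "1 \<le> r" and N: "1 \<le> N"
    and c: "\<And>s i. \<bar>c s i\<bar> \<le> 1" and diag: "\<And>s i. c s i \<noteq> 0 \<Longrightarrow> (\<Sum>k\<in>insert j J. s k) = n"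
  shows "(\<integral>\<^sup>+x. ennreal (dyadic_sum r (insert j J) (Suc n) c x ^ (2 * N)) \<partial>PiM (insert j J) (\<lambda>_. lborel))
     \<le> ennreal (((\<bar>osc_coeff r\<bar> + mean_coeff r)\<^sup>2 * (moment_const r N ^ card J * real (Suc n) ^ card J)) ^ N)"
proof -
  let ?M = "PiM J (\<lambda>_::'a. lborel :: real measure)"
  define B where "B = moment_const r N ^ card J * real (Suc n) ^ card J"
  define g where "g = \<bar>osc_coeff r\<bar> + mean_coeff r"
  have g: "0 < g" using mean_coeff_pos[of r] by (simp add: g_def)
  have B: "0 < B" using moment_const_pos[of r N] by (simp add: B_def)
  have [measurable]: "dyadic_sum r J (Suc n) c \<in> borel_measurable ?M" for c by (rule dyadic_sum_measurable[OF J(1)])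
  define cy where "cy = (\<lambda>y s i. \<Sum>t<Suc n. \<Sum>l<2 ^ t. atom r t l y * c (s(j := t)) (i(j := l)))"
  have m: "(\<lambda>x. ennreal (dyadic_sum r (insert j J) (Suc n) c x ^ (2 * N))) \<in> borel_measurable (PiM (insert j J) (\<lambda>_. lborel))"
    using dyadic_sum_measurable[of "insert j J" r "Suc n" c] J(1) by simp
  have H0: "dyadic_sum r (insert j J) (Suc n) c ((fst z)(j := snd z)) = (\<Sum>t<Suc n. \<Sum>l<2 ^ t. atom r t l (snd z) * dyadic_sum r J (Suc n) (\<lambda>s i. c (s(j := t)) (i(j := l))) (fst z))" for z
  proof -
    have e: "dyadic_sum r J (Suc n) c' ((fst z)(j := snd z)) = dyadic_sum r J (Suc n) c' (fst z)" for c'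
      by (rule dyadic_sum_cong) (use J in auto)
    show ?thesis unfolding dyadic_sum_insert[OF J] e by simp
  qed
  have H: "dyadic_sum r (insert j J) (Suc n) c ((fst z)(j := snd z)) = dyadic_sum r J (Suc n) (cy (snd z)) (fst z)" for z
  proof -
    have "(\<Sum>t<Suc n. \<Sum>l<2 ^ t. atom r t l (snd z) * dyadic_sum r J (Suc n) (\<lambda>s i. c (s(j := t)) (i(j := l))) (fst z)) =
      (\<Sum>t<Suc n. 1 * dyadic_sum r J (Suc n) (\<lambda>s i. \<Sum>l<2 ^ t. atom r t l (snd z) * c (s(j := t)) (i(j := l))) (fst z))"
      by (intro sum.cong refl) (simp only: dyadic_sum_sum mult_1_left)
    also have "\<dots> = dyadic_sum r J (Suc n) (cy (snd z)) (fst z)"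
      unfolding dyadic_sum_sum cy_def by simp
    finally show ?thesis unfolding H0 .
  qed
  have cy: "\<bar>cy y s i\<bar> \<le> g * indicator {0..<1} y" for y s i
  proof -
    \<comment> \<open>The subtraction truncates. If the levels in \<open>J\<close> already exceed
      \<open>n\<close>, it singles out level 0, where the estimate by \<open>sum_atom_le\<close>
      still holds although the coefficients vanish.\<close>
    have "\<bar>cy y s i\<bar> \<le> (\<Sum>t<Suc n. if t = n - (\<Sum>k\<in>J. s k) then g * indicator {0..<1} y else 0)"
    proof (unfold cy_def, rule order_trans[OF sum_abs sum_mono])
      fix t
      show "\<bar>\<Sum>l<2 ^ t. atom r t l y * c (s(j := t)) (i(j := l))\<bar> \<le> (if t = n - (\<Sum>k\<in>J. s k) then g * indicator {0..<1} y else 0)"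
      proof (cases "t = n - (\<Sum>k\<in>J. s k)")
        case True
        have "\<bar>\<Sum>l<2 ^ t. atom r t l y * c (s(j := t)) (i(j := l))\<bar> \<le> (\<Sum>l<2 ^ t. \<bar>atom r t l y * c (s(j := t)) (i(j := l))\<bar>)"
          by (rule sum_abs)
        also have "\<dots> \<le> (\<Sum>l<2 ^ t. \<bar>atom r t l y\<bar>)"
          by (intro sum_mono) (auto simp: abs_mult intro!: mult_left_le c)
        also have "\<dots> \<le> g * indicator {0..<1} y" unfolding g_def by (rule sum_atom_le[OF r])
        finally show ?thesis using True by simp
      next
        case False
        have "c (s(j := t)) (i(j := l)) = 0" for l
        proof (rule ccontr)
          assume "c (s(j := t)) (i(j := l)) \<noteq> 0"
          hence "(\<Sum>k\<in>insert j J. (s(j := t)) k) = n" by (rule diag)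
          moreover have "(\<Sum>k\<in>J. (s(j := t)) k) = (\<Sum>k\<in>J. s k)" using J by (intro sum.cong) auto
          ultimately have "t + (\<Sum>k\<in>J. s k) = n" using J by simp
          with False show False by simp
        qed
        thus ?thesis using False by simp
      qed
    qed
    also have "\<dots> \<le> g * indicator {0..<1} y" using g by simp
    finally show ?thesis .
  qed
  have main: "(\<integral>\<^sup>+x. ennreal (dyadic_sum r J (Suc n) (cy y) x ^ (2 * N)) \<partial>?M) \<le> ennreal ((g\<^sup>2 * B) ^ N) * indicator {0..<1} y" for y
    proof (cases "0 \<le> y \<and> y < 1")
      case True
      \<comment> \<open>Division by \<open>g\<close> brings the coefficients into the range required
        by \<open>dyadic_sum_moment\<close>.\<close>
      have cg: "\<bar>1 / g * cy y s i\<bar> \<le> 1" for s i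
        using cy[of y s i] True g by (simp add: abs_mult field_simps)
      have "dyadic_sum r J (Suc n) (cy y) x = g * dyadic_sum r J (Suc n) (\<lambda>s i. 1 / g * cy y s i) x" for x
        unfolding dyadic_sum_scale using g by simp
      hence "(\<integral>\<^sup>+x. ennreal (dyadic_sum r J (Suc n) (cy y) x ^ (2 * N)) \<partial>?M) = (\<integral>\<^sup>+x. ennreal (g ^ (2 * N)) * ennreal (dyadic_sum r J (Suc n) (\<lambda>s i. 1 / g * cy y s i) x ^ (2 * N)) \<partial>?M)"
        by (intro nn_integral_cong) (simp add: power_mult_distrib ennreal_mult zero_le_even_power)
      also have "\<dots> = ennreal (g ^ (2 * N)) * (\<integral>\<^sup>+x. ennreal (dyadic_sum r J (Suc n) (\<lambda>s i. 1 / g * cy y s i) x ^ (2 * N)) \<partial>?M)"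
        by (intro nn_integral_cmult) measurable
      also have "\<dots> \<le> ennreal (g ^ (2 * N)) * ennreal (B ^ N)"
        unfolding B_def by (intro mult_left_mono dyadic_sum_moment J r N cg) auto
      also have "\<dots> = ennreal ((g\<^sup>2 * B) ^ N)"
        using B by (simp add: ennreal_mult[symmetric] zero_le_even_power power_mult_distrib power_mult)
      finally show ?thesis
        using True by simp
    next
      case False
      hence "cy y = (\<lambda>s i. 0)" using cy[of y] by (intro ext) (auto simp: indicator_def)
      thus ?thesis
        using N by (simp add: dyadic_sum_zero power_0_left)
    qed
  have "(\<integral>\<^sup>+x. ennreal (dyadic_sum r (insert j J) (Suc n) c x ^ (2 * N)) \<partial>PiM (insert j J) (\<lambda>_. lborel)) =
     (\<integral>\<^sup>+z. ennreal (dyadic_sum r (insert j J) (Suc n) c ((fst z)(j := snd z)) ^ (2 * N)) \<partial>(?M \<Otimes>\<^sub>M lborel))"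
    by (rule PiM_insert_pair[OF J m])
  also have "\<dots> \<le> ennreal ((g\<^sup>2 * B) ^ N)"
  proof (rule pair_nn_integral_le[OF J(1)])
    show "(\<lambda>z. ennreal (dyadic_sum r (insert j J) (Suc n) c ((fst z)(j := snd z)) ^ (2 * N))) \<in> borel_measurable (?M \<Otimes>\<^sub>M lborel)"
      unfolding H0 by measurable
    show "(\<integral>\<^sup>+x. ennreal (dyadic_sum r (insert j J) (Suc n) c ((fst (x, y))(j := snd (x, y))) ^ (2 * N)) \<partial>?M) \<le> ennreal ((g\<^sup>2 * B) ^ N) * indicator {0..<1} y" for y
      using H[of "(_, y)"] main[of y] by (simp only: fst_conv snd_conv)
  qed
  finally show ?thesis unfolding B_def g_def .
qed

section \<open>From one variable to the cube\<close>

lemma prod_Basis_vec: "(\<Prod>b\<in>Basis. f b) = (\<Prod>j\<in>UNIV. f (axis j (1::real)))"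
  for f :: "real ^ 'n \<Rightarrow> real"
proof -
  have B: "(Basis :: (real ^ 'n) set) = (\<lambda>j. axis j 1) ` UNIV" by (auto simp: Basis_vec_def)
  have "inj (\<lambda>j::'n. axis j (1::real))" by (auto simp: inj_def axis_eq_axis)
  thus ?thesis unfolding B by (subst prod.reindex) auto
qed

lemma vec_lambda_measurable: "(\<lambda>f. \<chi> j. f j) \<in> measurable (PiM UNIV (\<lambda>_::'n::finite. lborel :: real measure)) (borel :: (real ^ 'n) measure)"
proof (rule borel_measurable_euclidean_space[THEN iffD2], rule ballI)
  fix b :: "real ^ 'n" assume "b \<in> Basis"
  then obtain k where b: "b = axis k 1" by (auto simp: Basis_vec_def)
  have "(\<lambda>f. f k) \<in> measurable (PiM UNIV (\<lambda>_::'n. lborel :: real measure)) lborel" by (rule measurable_component_singleton) simp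
  thus "(\<lambda>f. (\<chi> j. f j) \<bullet> b) \<in> borel_measurable (PiM UNIV (\<lambda>_::'n. lborel :: real measure))"
    by (simp add: b inner_axis)
qed

text \<open>Moments are estimated on the product space, where variables are split off one at a time,
  but the discrepancy lives on \<open>real ^ 'n\<close>. Lebesgue measure is determined by its
  values on boxes.\<close>

lemma lborel_vec: "(lborel :: (real ^ 'n) measure) = distr (PiM UNIV (\<lambda>_. lborel)) borel (\<lambda>f. \<chi> j. f j)"
proof (rule lborel_eqI)
  interpret product_sigma_finite "\<lambda>_::'n. lborel :: real measure" ..
  fix l u :: "real ^ 'n"
  assume lu: "\<And>b. b \<in> Basis \<Longrightarrow> l \<bullet> b \<le> u \<bullet> b"
  have le: "l $ j \<le> u $ j" for j using lu[of "axis j 1"] by (auto simp: inner_axis Basis_vec_def)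
  have "emeasure (distr (PiM UNIV (\<lambda>_. lborel)) borel (\<lambda>f. \<chi> j. f j)) (box l u) =
      emeasure (PiM UNIV (\<lambda>_::'n. lborel :: real measure)) (PiE UNIV (\<lambda>j. {l $ j<..<u $ j}))"
    by (subst emeasure_distr[OF vec_lambda_measurable])
       (auto simp: space_PiM mem_box_cart PiE_iff intro!: arg_cong2[where f = emeasure])
  also have "\<dots> = (\<Prod>j\<in>UNIV. emeasure lborel {l $ j<..<u $ j})"
    by (rule emeasure_PiM) auto
  also have "\<dots> = (\<Prod>j\<in>UNIV. ennreal (u $ j - l $ j))" using le by simp
  also have "\<dots> = ennreal (\<Prod>j\<in>UNIV. u $ j - l $ j)" using le by (intro prod_ennreal) auto
  also have "(\<Prod>j\<in>UNIV. u $ j - l $ j) = (\<Prod>b\<in>Basis. (u - l) \<bullet> b)"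
    unfolding prod_Basis_vec by (simp add: inner_axis)
  finally show "emeasure (distr (PiM UNIV (\<lambda>_. lborel)) borel (\<lambda>f. \<chi> j. f j)) (box l u) = (\<Prod>b\<in>Basis. (u - l) \<bullet> b)" .
qed simp

lemma component_measurable [measurable]: "(\<lambda>z::real ^ 'n. z $ j) \<in> borel_measurable borel"
  by (intro borel_measurable_continuous_onI continuous_intros)

lemma
  fixes f :: "'n::finite \<Rightarrow> real \<Rightarrow> real"
  assumes "\<And>j. integrable lborel (f j)"
  shows vec_prod_integrable: "integrable lborel (\<lambda>z::real ^ 'n. \<Prod>j\<in>UNIV. f j (z $ j))"
    and vec_prod_integral: "(LINT z|lborel. (\<Prod>j\<in>UNIV. f j ((z::real ^ 'n) $ j))) = (\<Prod>j\<in>UNIV. (LINT y|lborel. f j y))"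
proof -
  interpret product_sigma_finite "\<lambda>_::'n. lborel :: real measure" ..
  have [measurable]: "f j \<in> borel_measurable borel" for j using borel_measurable_integrable[OF assms[of j]] by simp
  have m: "(\<lambda>z::real ^ 'n. \<Prod>j\<in>UNIV. f j (z $ j)) \<in> borel_measurable borel" by measurable
  show "integrable lborel (\<lambda>z::real ^ 'n. \<Prod>j\<in>UNIV. f j (z $ j))"
    by (subst lborel_vec, subst integrable_distr_eq[OF vec_lambda_measurable m])
       (use product_integrable_prod[of UNIV f] assms in simp)
  show "(LINT z|lborel. (\<Prod>j\<in>UNIV. f j ((z::real ^ 'n) $ j))) = (\<Prod>j\<in>UNIV. (LINT y|lborel. f j y))"
    by (subst lborel_vec, subst integral_distr[OF vec_lambda_measurable m])
       (use product_integral_prod[of UNIV f] assms in simp)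
qed

lemma dyadic_sum_vec_measurable [measurable]: "(\<lambda>z::real ^ 'n. dyadic_sum r UNIV T c (($) z)) \<in> borel_measurable borel"
  unfolding dyadic_sum_def by measurable

lemma dyadic_sum_vec_nn_integral:
  "(\<integral>\<^sup>+z. ennreal (dyadic_sum r UNIV T c (($) (z::real ^ 'n)) ^ k) \<partial>lborel) = (\<integral>\<^sup>+x. ennreal (dyadic_sum r UNIV T c x ^ k) \<partial>PiM UNIV (\<lambda>_. lborel))"
  by (subst lborel_vec, subst nn_integral_distr[OF vec_lambda_measurable]) (auto simp: vec_lambda_inverse intro!: nn_integral_cong)

text \<open>For two points of the cube all nonzero terms lie in a finite box of lattice points, and
  a sum of products over a box is a product of sums. Everything afterwards is done coordinate by
  coordinate.\<close>

lemma periodic_hat_eq: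
  fixes x z u :: "real ^ 'n"
  assumes r: "1 \<le> r" and x: "x \<in> unit_cube" and z: "z \<in> unit_cube" and u: "u \<in> scale_cube"
  shows "periodic_hat r x z u = (\<Prod>j\<in>UNIV. periodic_hat1 r (x $ j - z $ j) (u $ j))"
proof -
  let ?N = "int r + 1"
  define A where "A = {n :: int ^ 'n. \<forall>j. n $ j \<in> {-?N..?N}}"
  define F where "F = (\<lambda>n :: int ^ 'n. hat r ((\<chi> j. real_of_int (n $ j)) + x) z u)"
  have bij: "bij_betw (\<lambda>n :: int ^ 'n. ($) n) A (PiE UNIV (\<lambda>_. {-?N..?N}))"
    by (rule bij_betwI[where g = vec_lambda]) (auto simp: A_def)
  have fin: "finite A" using bij_betw_finite[OF bij] by (simp add: finite_PiE)
  have F: "F n = (\<Prod>j\<in>UNIV. hat1 r (of_int (n $ j) + (x $ j - z $ j)) (u $ j))" for n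
    by (simp add: F_def hat_def algebra_simps)
  have zero: "F n = 0" if "n \<notin> A" for n
  proof -
    obtain j where j: "\<not> (-?N \<le> n $ j \<and> n $ j \<le> ?N)" using \<open>n \<notin> A\<close> by (auto simp: A_def)
    have uj: "0 < u $ j" "u $ j \<le> 1/2" and xz: "0 \<le> x $ j" "x $ j < 1" "0 \<le> z $ j" "z $ j < 1"
      using u x z by (auto simp: scale_cube_def unit_cube_def)
    have "hat1 r (of_int (n $ j) + (x $ j - z $ j)) (u $ j) = 0"
    proof (rule ccontr)
      assume "\<not> ?thesis"
      hence "\<bar>of_int (n $ j) + (x $ j - z $ j)\<bar> \<le> real r * u $ j / 2"
        using hat1_support[OF uj(1) _ r] uj by auto
      also have "\<dots> \<le> real r * 1 / 2" using uj by (intro divide_right_mono mult_left_mono) auto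
      also have "\<dots> \<le> real r" by simp
      finally have "\<bar>of_int (n $ j)\<bar> < real_of_int ?N" using xz by simp
      hence "\<bar>n $ j\<bar> < ?N" by linarith
      thus False using j by auto
    qed
    thus ?thesis unfolding F by (intro prod_zero) auto
  qed
  have "periodic_hat r x z u = infsum F UNIV" unfolding periodic_hat_def F_def ..
  also have "\<dots> = infsum F A" by (rule infsum_cong_neutral) (auto simp: zero)
  also have "\<dots> = (\<Sum>n\<in>A. F n)" using fin by simp
  also have "\<dots> = (\<Sum>g\<in>PiE UNIV (\<lambda>_. {-?N..?N}). \<Prod>j\<in>UNIV. hat1 r (of_int (g j) + (x $ j - z $ j)) (u $ j))"
    unfolding F by (rule sum.reindex_bij_betw[OF bij, of "\<lambda>g. \<Prod>j\<in>UNIV. hat1 r (of_int (g j) + (x $ j - z $ j)) (u $ j)"])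
  also have "\<dots> = (\<Prod>j\<in>UNIV. periodic_hat1 r (x $ j - z $ j) (u $ j))"
    unfolding periodic_hat1_def by (subst prod_sum_PiE) auto
  finally show ?thesis .
qed

lemma indicator_unit_cube: "indicator unit_cube (z::real ^ 'n) = (\<Prod>j\<in>UNIV. indicator {0..<1} (z $ j) :: real)"
  by (auto simp: indicator_def unit_cube_def)

lemma indicator_scale_cube: "indicator scale_cube (z::real ^ 'n) = (\<Prod>j\<in>UNIV. indicator {0<..1/2} (z $ j) :: real)"
  by (auto simp: indicator_def scale_cube_def)

lemma unit_cube_measurable [measurable]: "(unit_cube :: (real ^ 'n) set) \<in> sets borel"
  unfolding unit_cube_def by measurable

lemma scale_cube_measurable [measurable]: "(scale_cube :: (real ^ 'n) set) \<in> sets borel"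
  unfolding scale_cube_def by measurable

lemma cubature_error_eq:
  fixes z u :: "real ^ 'n"
  assumes r: "1 \<le> r" and \<xi>: "\<forall>\<mu>\<in>{1..m}. \<xi> \<mu> \<in> unit_cube" and z: "z \<in> unit_cube" and u: "u \<in> scale_cube"
  shows "cubature_error r m \<xi> \<Lambda> z u = (\<Prod>j\<in>UNIV. (u $ j) ^ r) - (\<Sum>\<mu>=1..m. \<Lambda> \<mu> * (\<Prod>j\<in>UNIV. periodic_hat1 r (\<xi> \<mu> $ j - z $ j) (u $ j)))"
proof -
  have uj: "0 < u $ j" "u $ j \<le> 1/2" and zj: "0 \<le> z $ j" "z $ j < 1" for j
    using u z by (auto simp: scale_cube_def unit_cube_def)
  have "(LINT x:unit_cube|lborel. periodic_hat r x z u) = (LINT x|lborel. (\<Prod>j\<in>UNIV. indicator {0..<1} (x $ j) * periodic_hat1 r (x $ j - z $ j) (u $ j)))"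
    unfolding set_lebesgue_integral_def
  proof (intro Bochner_Integration.integral_cong refl)
    fix x :: "real ^ 'n"
    show "indicator unit_cube x *\<^sub>R periodic_hat r x z u = (\<Prod>j\<in>UNIV. indicator {0..<1} (x $ j) * periodic_hat1 r (x $ j - z $ j) (u $ j))"
    proof (cases "x \<in> unit_cube")
      case True
      thus ?thesis unfolding prod.distrib indicator_unit_cube[symmetric] by (simp add: periodic_hat_eq[OF r True z u])
    next
      case False
      thus ?thesis unfolding prod.distrib indicator_unit_cube[symmetric] by simp
    qed
  qed
  also have "\<dots> = (\<Prod>j\<in>UNIV. (LINT x|lborel. indicator {0..<1} x * periodic_hat1 r (x - z $ j) (u $ j)))"
    by (rule vec_prod_integral) (rule periodic_hat1_integral(1)[OF uj r zj])
  also have "\<dots> = (\<Prod>j\<in>UNIV. (u $ j) ^ r)" by (intro prod.cong refl periodic_hat1_integral(2)[OF uj r zj])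
  finally show ?thesis
    unfolding cubature_error_def by (simp add: periodic_hat_eq[OF r bspec[OF \<xi>] z u])
qed

section \<open>Duality between the discrepancy norm and even moments\<close>

lemma ennreal_integral_le_nn_integral:
  fixes f :: "'a \<Rightarrow> real"
  assumes "integrable M f"
  shows "ennreal (integral\<^sup>L M f) \<le> (\<integral>\<^sup>+x. ennreal (f x) \<partial>M)"
proof -
  have "integral\<^sup>L M f \<le> integral\<^sup>L M (\<lambda>x. max 0 (f x))"
    by (intro integral_mono assms integrable_max) auto
  hence "ennreal (integral\<^sup>L M f) \<le> ennreal (integral\<^sup>L M (\<lambda>x. max 0 (f x)))" by (rule ennreal_leI)
  also have "\<dots> = (\<integral>\<^sup>+x. ennreal (max 0 (f x)) \<partial>M)"
    by (rule nn_integral_eq_integral[symmetric]) (use assms in auto)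
  also have "\<dots> = (\<integral>\<^sup>+x. ennreal (f x) \<partial>M)" by (intro nn_integral_cong) (simp add: max_def ennreal_neg)
  finally show ?thesis .
qed

text \<open>Either b is at most a^(p-1), and a b is at most a^p, or a is less than b^(1/(p-1)), and
  a b is at most b^(p/(p-1)). The summand 1 covers b \<le> 1, where raising the exponent to 2 N
  would decrease the power.\<close>

lemma young_crude:
  fixes a b :: real
  assumes "0 \<le> a" "0 \<le> b" "1 < p" "p / (p - 1) \<le> real (2 * N)"
  shows "a * b \<le> a powr p + (1 + b ^ (2 * N))"
proof (cases "b \<le> a powr (p - 1)")
  case True
  have "a * b \<le> a * a powr (p - 1)" using True assms by (intro mult_left_mono) auto
  also have "\<dots> = a powr p"
    using assms powr_mult_base[of a "p - 1"] by simp
  finally show ?thesis using assms by (simp add: add_increasing2)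
next
  case False
  hence b: "0 < b" using powr_ge_zero[of a "p - 1"] by linarith
  have "a \<le> b powr (1 / (p - 1))"
  proof -
    have "a = (a powr (p - 1)) powr (1 / (p - 1))" using assms by (simp add: powr_powr)
    also have "\<dots> \<le> b powr (1 / (p - 1))" using False assms by (intro powr_mono2) auto
    finally show ?thesis .
  qed
  hence "a * b \<le> b powr (1 / (p - 1)) * b" using b by (intro mult_right_mono) auto
  also have "\<dots> = b powr (p / (p - 1))"
  proof -
    have "b powr (1 / (p - 1)) * b = b powr (1 / (p - 1) + 1)" using b by (simp add: powr_add)
    also have "1 / (p - 1) + 1 = p / (p - 1)" using assms by (simp add: field_simps)
    finally show ?thesis .
  qed
  also have "\<dots> \<le> 1 + b ^ (2 * N)"
  proof (cases "b \<le> 1")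
    case True
    have "b powr (p / (p - 1)) \<le> 1 powr (p / (p - 1))" using True b assms by (intro powr_mono2) auto
    thus ?thesis using b by (simp add: add_increasing2)
  next
    case False
    have "b powr (p / (p - 1)) \<le> b powr real (2 * N)" using False assms by (intro powr_mono) auto
    also have "\<dots> = b ^ (2 * N)" using b by (rule powr_realpow)
    finally show ?thesis by simp
  qed
  also have "\<dots> \<le> a powr p + (1 + b ^ (2 * N))" by simp
  finally show ?thesis .
qed

text \<open>Hoelder's inequality with a loss. After dividing \<open>e\<close> by its norm and
  \<open>g\<close> by \<open>B\<close>, each of the three terms of \<open>young_crude\<close>
  integrates to at most 1, hence the factor 3.\<close>

lemma duality:
  fixes e g :: "'a \<Rightarrow> real"
  assumes [measurable]: "e \<in> borel_measurable M" "g \<in> borel_measurable M"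
    and M: "emeasure M (space M) \<le> 1" and p: "1 < p" "p / (p - 1) \<le> real (2 * N)"
    and B: "0 < B" "(\<integral>\<^sup>+x. ennreal (g x ^ (2 * N)) \<partial>M) \<le> ennreal (B ^ (2 * N))"
  shows "ennreal ((LINT x|M. e x * g x) / (3 * B)) \<le> Lp_norm M (ennreal p) (\<lambda>x. ennreal \<bar>e x\<bar>)"
proof -
  define I where "I = (\<integral>\<^sup>+x. ennreal (\<bar>e x\<bar> powr p) \<partial>M)"
  have pp: "enn2real (ennreal p) = p" using p by simp
  have L: "Lp_norm M (ennreal p) (\<lambda>x. ennreal \<bar>e x\<bar>) = ennpowr I (1 / p)"
    unfolding Lp_norm_def I_def ennpowr_def pp by simp
  show ?thesis
  proof (cases "I = \<infinity>")
    case True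
    thus ?thesis unfolding L by (simp add: ennpowr_def)
  next
    case False
    then obtain i where i: "I = ennreal i" "0 \<le> i" by (cases I) auto
    define A where "A = i powr (1 / p)"
    have LA: "Lp_norm M (ennreal p) (\<lambda>x. ennreal \<bar>e x\<bar>) = ennreal A"
      unfolding L i A_def ennpowr_def using i by simp
    show ?thesis
    proof (cases "i = 0")
      case True
      hence "(\<integral>\<^sup>+x. ennreal (\<bar>e x\<bar> powr p) \<partial>M) = 0" using i unfolding I_def by simp
      hence "AE x in M. ennreal (\<bar>e x\<bar> powr p) = 0"
        by (subst (asm) nn_integral_0_iff_AE) auto
      hence "AE x in M. e x * g x = 0" by eventually_elim auto
      hence "(LINT x|M. e x * g x) = 0" by (rule integral_eq_zero_AE)
      thus ?thesis by simp
    next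
      case False
      hence A: "0 < A" "A powr p = i" using i p by (auto simp: A_def powr_powr)
      have ev: "0 \<le> (x::real) ^ (2 * N)" for x by (simp add: zero_le_even_power)
      have "(\<integral>\<^sup>+x. ennreal (norm (e x * g x)) \<partial>M) \<le>
         (\<integral>\<^sup>+x. ennreal (A * B) * (ennreal (1 / i) * ennreal (\<bar>e x\<bar> powr p) + (1 + ennreal (1 / B ^ (2 * N)) * ennreal (g x ^ (2 * N)))) \<partial>M)"
      proof (rule nn_integral_mono)
        fix x
        have "\<bar>e x\<bar> / A * (\<bar>g x\<bar> / B) \<le> (\<bar>e x\<bar> / A) powr p + (1 + (\<bar>g x\<bar> / B) ^ (2 * N))"
          using A B p by (intro young_crude) auto
        also have "\<dots> = 1 / i * \<bar>e x\<bar> powr p + (1 + 1 / B ^ (2 * N) * g x ^ (2 * N))"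
          using A B by (simp add: powr_divide power_divide power_even_abs)
        finally have "norm (e x * g x) \<le> A * B * (1 / i * \<bar>e x\<bar> powr p + (1 + 1 / B ^ (2 * N) * g x ^ (2 * N)))"
          using A B by (simp add: abs_mult pos_divide_le_eq mult_ac)
        hence "ennreal (norm (e x * g x)) \<le> ennreal (A * B * (1 / i * \<bar>e x\<bar> powr p + (1 + 1 / B ^ (2 * N) * g x ^ (2 * N))))"
          by (rule ennreal_leI)
        also have "\<dots> = ennreal (A * B) * (ennreal (1 / i) * ennreal (\<bar>e x\<bar> powr p) + (1 + ennreal (1 / B ^ (2 * N)) * ennreal (g x ^ (2 * N))))"
        proof -
          have n: "0 \<le> A * B" "0 \<le> 1 / i" "0 \<le> \<bar>e x\<bar> powr p" "0 \<le> 1 / B ^ (2 * N)" "0 \<le> g x ^ (2 * N)"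
            using A B i ev by auto
          have n2: "0 \<le> 1 / B ^ (2 * N) * g x ^ (2 * N)" "0 \<le> 1 / i * \<bar>e x\<bar> powr p"
            using n by (auto intro: mult_nonneg_nonneg)
          hence n3: "0 \<le> 1 + 1 / B ^ (2 * N) * g x ^ (2 * N)" by simp
          show ?thesis
            unfolding ennreal_mult[OF n(1) add_nonneg_nonneg[OF n2(2) n3]] ennreal_plus[OF n2(2) n3]
              ennreal_plus[OF zero_le_one n2(1)] ennreal_mult[OF n(2,3)] ennreal_mult[OF n(4,5)] by simp
        qed
        finally show "ennreal (norm (e x * g x)) \<le> ennreal (A * B) * (ennreal (1 / i) * ennreal (\<bar>e x\<bar> powr p) + (1 + ennreal (1 / B ^ (2 * N)) * ennreal (g x ^ (2 * N))))" .
      qed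
      also have "\<dots> = ennreal (A * B) * (ennreal (1 / i) * I + (emeasure M (space M) + ennreal (1 / B ^ (2 * N)) * (\<integral>\<^sup>+x. ennreal (g x ^ (2 * N)) \<partial>M)))"
        unfolding I_def by (subst nn_integral_cmult, measurable) (subst nn_integral_add, measurable, simp add: nn_integral_add nn_integral_cmult)
      also have "\<dots> \<le> ennreal (A * B) * (ennreal (1 / i) * ennreal i + (1 + ennreal (1 / B ^ (2 * N)) * ennreal (B ^ (2 * N))))"
        unfolding i(1) by (intro mult_left_mono add_mono M B(2)) auto
      also have "\<dots> = ennreal (A * B) * 3"
      proof -
        have "ennreal (1 / i) * ennreal i = 1" using False i by (simp flip: ennreal_mult)
        moreover have "ennreal (1 / B ^ (2 * N)) * ennreal (B ^ (2 * N)) = 1" using B by (simp flip: ennreal_mult)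
        ultimately show ?thesis by simp
      qed
      also have "\<dots> = ennreal (A * (3 * B))" using A B by (simp add: ennreal_mult mult_ac)
      finally have bound: "(\<integral>\<^sup>+x. ennreal (norm (e x * g x)) \<partial>M) \<le> ennreal (A * (3 * B))" .
      \<comment> \<open>Integrability of the product is a consequence of the bound, so the integral
        estimated next is not a default value.\<close>
      have int: "integrable M (\<lambda>x. e x * g x)"
        unfolding integrable_iff_bounded using bound by (auto intro: le_less_trans)
      have "ennreal (norm (LINT x|M. e x * g x)) \<le> ennreal (A * (3 * B))"
        using integral_norm_bound_ennreal[OF int] bound by (rule order_trans)
      hence "\<bar>LINT x|M. e x * g x\<bar> \<le> A * (3 * B)" using A B by (simp add: ennreal_le_iff)
      hence "(LINT x|M. e x * g x) / (3 * B) \<le> A" using B by (simp add: pos_divide_le_eq)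
      thus ?thesis unfolding LA by (rule ennreal_leI)
    qed
  qed
qed

lemma Lp_norm_1: "Lp_norm M 1 f = (\<integral>\<^sup>+x. f x \<partial>M)"
proof -
  have "ennpowr x 1 = x" for x by (cases x) (auto simp: ennpowr_def)
  thus ?thesis by (simp add: Lp_norm_def)
qed

section \<open>Testing the cubature error\<close>

definition smoothed_atom :: "nat \<Rightarrow> nat \<Rightarrow> nat \<Rightarrow> real \<Rightarrow> real \<Rightarrow> real" where
  "smoothed_atom r t l x u = osc_coeff r * (\<Sum>n\<in>{-(int r + 1)..int r + 1}. central_diff u r (dyadic_bump r t l) (of_int n + x)) + mean_coeff r * (1/2) ^ ((r + 1) * t) * u ^ r"

text \<open>This is the error at one scale \<open>u\<close> tested against the dyadic sum, with
  \<open>z\<close> already integrated out in every coordinate. Its sign is not controlled before the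
  average over \<open>u\<close> is taken.\<close>

definition paired_error :: "nat \<Rightarrow> nat \<Rightarrow> (nat \<Rightarrow> real ^ 'n) \<Rightarrow> (nat \<Rightarrow> real) \<Rightarrow> nat \<Rightarrow> (('n \<Rightarrow> nat) \<Rightarrow> ('n \<Rightarrow> nat) \<Rightarrow> real) \<Rightarrow> real ^ 'n \<Rightarrow> real" where
  "paired_error r m \<xi> \<Lambda> T c u = (\<Sum>s\<in>PiE UNIV (\<lambda>_. {..<T}). \<Sum>i\<in>PiE UNIV (\<lambda>j. {..<2 ^ s j}). c s i *
     ((\<Prod>j\<in>UNIV. (u $ j) ^ r * (mean_coeff r * (1/2) ^ ((r + 1) * s j))) - (\<Sum>\<mu>=1..m. \<Lambda> \<mu> * (\<Prod>j\<in>UNIV. smoothed_atom r (s j) (i j) (\<xi> \<mu> $ j) (u $ j)))))"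

lemma error_pairing:
  fixes u :: "real ^ 'n"
  assumes r: "even r" "1 \<le> r" and \<xi>: "\<forall>\<mu>\<in>{1..m}. \<xi> \<mu> \<in> unit_cube" and u: "u \<in> scale_cube"
  shows "(LINT z|restrict_space lborel unit_cube. cubature_error r m \<xi> \<Lambda> z u * dyadic_sum r UNIV T c (($) z)) = paired_error r m \<xi> \<Lambda> T c u"
proof -
  have uj: "0 < u $ j" "u $ j \<le> 1/2" for j using u by (auto simp: scale_cube_def)
  have xj: "0 \<le> \<xi> \<mu> $ j" "\<xi> \<mu> $ j < 1" if "\<mu> \<in> {1..m}" for \<mu> j using bspec[OF \<xi> that] by (auto simp: unit_cube_def)
  define p0 where "p0 = (\<lambda>s i (z::real ^ 'n). \<Prod>j\<in>UNIV. (u $ j) ^ r * atom r (s j) (i j) (z $ j))"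
  define p1 where "p1 = (\<lambda>\<mu> s i (z::real ^ 'n). \<Prod>j\<in>UNIV. periodic_hat1 r (\<xi> \<mu> $ j - z $ j) (u $ j) * atom r (s j) (i j) (z $ j))"
  let ?S = "PiE UNIV (\<lambda>_::'n. {..<T})" and ?I = "\<lambda>s. PiE UNIV (\<lambda>j::'n. {..<2 ^ s j::nat})"
  have p0: "integrable lborel (p0 s i)" "(LINT z|lborel. p0 s i z) = (\<Prod>j\<in>UNIV. (u $ j) ^ r * (mean_coeff r * (1/2) ^ ((r + 1) * s j)))" if "i \<in> ?I s" for s i
  proof -
    have l: "i j < 2 ^ s j" for j using that by (auto simp: PiE_iff)
    have int: "integrable lborel (\<lambda>y. (u $ j) ^ r * atom r (s j) (i j) y)" for j
      by (intro integrable_mult_right atom_integrable l)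
    show "integrable lborel (p0 s i)" unfolding p0_def by (rule vec_prod_integrable) (rule int)
    show "(LINT z|lborel. p0 s i z) = (\<Prod>j\<in>UNIV. (u $ j) ^ r * (mean_coeff r * (1/2) ^ ((r + 1) * s j)))"
      unfolding p0_def by (subst vec_prod_integral[OF int]) (simp only: integral_mult_right_zero atom_integral[OF l r(2)])
  qed
  have p1: "integrable lborel (p1 \<mu> s i)" "(LINT z|lborel. p1 \<mu> s i z) = (\<Prod>j\<in>UNIV. smoothed_atom r (s j) (i j) (\<xi> \<mu> $ j) (u $ j))"
    if "i \<in> ?I s" "\<mu> \<in> {1..m}" for s i \<mu>
  proof -
    have l: "i j < 2 ^ s j" for j using that by (auto simp: PiE_iff)
    note q = atom_smoothing(1)[OF r l xj[OF that(2)] uj, folded smoothed_atom_def]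
    have int: "integrable lborel (\<lambda>y. periodic_hat1 r (\<xi> \<mu> $ j - y) (u $ j) * atom r (s j) (i j) y)" for j
      using q[of j j j] by blast
    show "integrable lborel (p1 \<mu> s i)" unfolding p1_def by (rule vec_prod_integrable) (rule int)
    show "(LINT z|lborel. p1 \<mu> s i z) = (\<Prod>j\<in>UNIV. smoothed_atom r (s j) (i j) (\<xi> \<mu> $ j) (u $ j))"
      unfolding p1_def by (subst vec_prod_integral[OF int]) (intro prod.cong refl conjunct2[OF q])
  qed
  \<comment> \<open>Atoms vanish off [0, 1), so the integral over the cube extends to the whole
    space, where products integrate coordinate by coordinate.\<close>
  have pt: "indicator unit_cube z *\<^sub>R (cubature_error r m \<xi> \<Lambda> z u * dyadic_sum r UNIV T c (($) z)) =
    (\<Sum>s\<in>?S. \<Sum>i\<in>?I s. c s i * (p0 s i z - (\<Sum>\<mu>=1..m. \<Lambda> \<mu> * p1 \<mu> s i z)))" for z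
  proof (cases "z \<in> unit_cube")
    case True
    have "p0 s i z = (\<Prod>j\<in>UNIV. (u $ j) ^ r) * (\<Prod>j\<in>UNIV. atom r (s j) (i j) (z $ j))"
      "p1 \<mu> s i z = (\<Prod>j\<in>UNIV. periodic_hat1 r (\<xi> \<mu> $ j - z $ j) (u $ j)) * (\<Prod>j\<in>UNIV. atom r (s j) (i j) (z $ j))" for s i \<mu>
      by (simp_all add: p0_def p1_def prod.distrib)
    hence eq: "cubature_error r m \<xi> \<Lambda> z u * (c s i * (\<Prod>j\<in>UNIV. atom r (s j) (i j) (z $ j))) = c s i * (p0 s i z - (\<Sum>\<mu>=1..m. \<Lambda> \<mu> * p1 \<mu> s i z))" for s i
      unfolding cubature_error_eq[OF r(2) \<xi> True u]
      by (simp add: sum_distrib_left sum_distrib_right algebra_simps)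
    show ?thesis using True unfolding dyadic_sum_def sum_distrib_left eq by simp
  next
    case False
    then obtain j where j: "\<not> (0 \<le> z $ j \<and> z $ j < 1)" by (auto simp: unit_cube_def)
    have z0: "atom r (s j) (i j) (z $ j) = 0" if "i \<in> ?I s" for s i
    proof -
      have "i j < 2 ^ s j" using that by (auto simp: PiE_iff)
      thus ?thesis using atom_support[of "i j" "s j" r "z $ j"] j by blast
    qed
    have "p0 s i z = 0" "p1 \<mu> s i z = 0" if "i \<in> ?I s" for s i \<mu>
      using z0[OF that] unfolding p0_def p1_def by (auto intro!: prod_zero)
    thus ?thesis using False by simp
  qed
  have "(LINT z|restrict_space lborel unit_cube. cubature_error r m \<xi> \<Lambda> z u * dyadic_sum r UNIV T c (($) z)) =
    (LINT z|lborel. (\<Sum>s\<in>?S. \<Sum>i\<in>?I s. c s i * (p0 s i z - (\<Sum>\<mu>=1..m. \<Lambda> \<mu> * p1 \<mu> s i z))))"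
    by (subst integral_restrict_space) (auto simp: pt simp del: real_scaleR_def)
  also have "\<dots> = (\<Sum>s\<in>?S. \<Sum>i\<in>?I s. (LINT z|lborel. c s i * (p0 s i z - (\<Sum>\<mu>=1..m. \<Lambda> \<mu> * p1 \<mu> s i z))))"
    by (subst Bochner_Integration.integral_sum, intro Bochner_Integration.integrable_sum integrable_mult_right Bochner_Integration.integrable_diff p0 p1, assumption+,
        intro sum.cong refl Bochner_Integration.integral_sum integrable_mult_right Bochner_Integration.integrable_diff Bochner_Integration.integrable_sum p0 p1)
  also have "\<dots> = paired_error r m \<xi> \<Lambda> T c u"
    unfolding paired_error_def
  proof (intro sum.cong refl)
    fix s i assume i: "i \<in> ?I s"
    have "(LINT z|lborel. c s i * (p0 s i z - (\<Sum>\<mu>=1..m. \<Lambda> \<mu> * p1 \<mu> s i z))) = c s i * ((LINT z|lborel. p0 s i z) - (\<Sum>\<mu>=1..m. \<Lambda> \<mu> * (LINT z|lborel. p1 \<mu> s i z)))"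
    proof -
      have S: "integrable lborel (\<lambda>z. \<Sum>\<mu>=1..m. \<Lambda> \<mu> * p1 \<mu> s i z)"
        by (intro Bochner_Integration.integrable_sum integrable_mult_right p1(1)[OF i])
      have "(LINT z|lborel. (\<Sum>\<mu>=1..m. \<Lambda> \<mu> * p1 \<mu> s i z)) = (\<Sum>\<mu>=1..m. (LINT z|lborel. \<Lambda> \<mu> * p1 \<mu> s i z))"
        by (intro Bochner_Integration.integral_sum integrable_mult_right p1(1)[OF i])
      thus ?thesis
        by (simp only: integral_mult_right_zero Bochner_Integration.integral_diff[OF p0(1)[OF i] S])
    qed
    thus "(LINT z|lborel. c s i * (p0 s i z - (\<Sum>\<mu>=1..m. \<Lambda> \<mu> * p1 \<mu> s i z))) = c s i * ((\<Prod>j\<in>UNIV. (u $ j) ^ r * (mean_coeff r * (1/2) ^ ((r + 1) * s j))) - (\<Sum>\<mu>=1..m. \<Lambda> \<mu> * (\<Prod>j\<in>UNIV. smoothed_atom r (s j) (i j) (\<xi> \<mu> $ j) (u $ j))))"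
      by (simp add: p0(2)[OF i] p1(2)[OF i])
  qed
  finally show ?thesis .
qed

text \<open>The scales of different coordinates are averaged independently, so every smoothed atom
  turns into a bump and every mean into the mass of a bump. The right-hand side is the cubature
  error of the sum of products of bumps.\<close>

lemma paired_error_integral:
  fixes \<xi> :: "nat \<Rightarrow> real ^ 'n"
  assumes r: "even r" "1 \<le> r" and \<xi>: "\<forall>\<mu>\<in>{1..m}. \<xi> \<mu> \<in> unit_cube"
  shows "integrable (restrict_space lborel scale_cube) (paired_error r m \<xi> \<Lambda> T c)"
    and "(LINT u|restrict_space lborel scale_cube. paired_error r m \<xi> \<Lambda> T c u) =
      (\<Sum>s\<in>PiE UNIV (\<lambda>_. {..<T}). \<Sum>i\<in>PiE UNIV (\<lambda>j. {..<2 ^ s j}). c s i *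
       ((\<Prod>j\<in>UNIV. (1/2) ^ ((r + 1) * s j) * bump_mass r) - (\<Sum>\<mu>=1..m. \<Lambda> \<mu> * (\<Prod>j\<in>UNIV. dyadic_bump r (s j) (i j) (\<xi> \<mu> $ j)))))"
proof -
  have xj: "0 \<le> \<xi> \<mu> $ j" "\<xi> \<mu> $ j < 1" if "\<mu> \<in> {1..m}" for \<mu> j using bspec[OF \<xi> that] by (auto simp: unit_cube_def)
  define p0 where "p0 = (\<lambda>s (u::real ^ 'n). \<Prod>j\<in>UNIV. indicator {0<..1/2} (u $ j) * (u $ j) ^ r * (mean_coeff r * (1/2) ^ ((r + 1) * s j)))"
  define p1 where "p1 = (\<lambda>\<mu> s i (u::real ^ 'n). \<Prod>j\<in>UNIV. indicator {0<..1/2} (u $ j) * smoothed_atom r (s j) (i j) (\<xi> \<mu> $ j) (u $ j))"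
  let ?S = "PiE UNIV (\<lambda>_::'n. {..<T})" and ?I = "\<lambda>s. PiE UNIV (\<lambda>j::'n. {..<2 ^ s j::nat})"
  have p0: "integrable lborel (p0 s)" "(LINT z|lborel. p0 s z) = (\<Prod>j\<in>UNIV. (1/2) ^ ((r + 1) * s j) * bump_mass r)" for s
  proof -
    have int: "integrable lborel (\<lambda>y. indicator {0<..1/2} y * y ^ r * (mean_coeff r * (1/2) ^ ((r + 1) * s j)))" for j
      by (intro integrable_mult_left half_power_integrable r)
    show "integrable lborel (p0 s)" unfolding p0_def by (rule vec_prod_integrable) (rule int)
    have v: "(LINT y|lborel. indicator {0<..1/2} y * y ^ r * (mean_coeff r * (1/2) ^ ((r + 1) * s j))) = (1/2) ^ ((r + 1) * s j) * bump_mass r" for j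
    proof -
      have pq: "(1/2) ^ (r + 1) * (2::real) ^ (r + 1) = 1" by (simp flip: power_mult_distrib)
      have gen: "q / R * (R * p * m * x) = x * m" if "q * p = 1" "R \<noteq> 0" for R p q m x :: real
        using that by (simp add: field_simps)
      show ?thesis unfolding integral_mult_left_zero half_power_integral[OF r(2)] mean_coeff_def by (rule gen[OF pq]) simp
    qed
    show "(LINT z|lborel. p0 s z) = (\<Prod>j\<in>UNIV. (1/2) ^ ((r + 1) * s j) * bump_mass r)"
      unfolding p0_def by (subst vec_prod_integral[OF int]) (simp only: v)
  qed
  have p1: "integrable lborel (p1 \<mu> s i)" "(LINT z|lborel. p1 \<mu> s i z) = (\<Prod>j\<in>UNIV. dyadic_bump r (s j) (i j) (\<xi> \<mu> $ j))"
    if "i \<in> ?I s" "\<mu> \<in> {1..m}" for s i \<mu>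
  proof -
    have l: "i j < 2 ^ s j" for j using that by (auto simp: PiE_iff)
    note q = atom_smoothing(2,3)[OF r l xj[OF that(2)], folded smoothed_atom_def]
    show "integrable lborel (p1 \<mu> s i)" unfolding p1_def by (rule vec_prod_integrable) (rule q(1))
    show "(LINT z|lborel. p1 \<mu> s i z) = (\<Prod>j\<in>UNIV. dyadic_bump r (s j) (i j) (\<xi> \<mu> $ j))"
      unfolding p1_def by (subst vec_prod_integral[OF q(1)]) (simp only: q(2))
  qed
  have pt: "indicator scale_cube u *\<^sub>R paired_error r m \<xi> \<Lambda> T c u =
    (\<Sum>s\<in>?S. \<Sum>i\<in>?I s. c s i * (p0 s u - (\<Sum>\<mu>=1..m. \<Lambda> \<mu> * p1 \<mu> s i u)))" for u
  proof -
    have "p0 s u = indicator scale_cube u * (\<Prod>j\<in>UNIV. (u $ j) ^ r * (mean_coeff r * (1/2) ^ ((r + 1) * s j)))"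
      "p1 \<mu> s i u = indicator scale_cube u * (\<Prod>j\<in>UNIV. smoothed_atom r (s j) (i j) (\<xi> \<mu> $ j) (u $ j))" for s i \<mu>
      by (simp_all add: p0_def p1_def prod.distrib indicator_scale_cube)
    thus ?thesis unfolding paired_error_def
      by (simp add: sum_distrib_left sum_distrib_right algebra_simps)
  qed
  have int: "integrable lborel (\<lambda>u. c s i * (p0 s u - (\<Sum>\<mu>=1..m. \<Lambda> \<mu> * p1 \<mu> s i u)))" if "i \<in> ?I s" for s i
    by (intro Bochner_Integration.integrable_sum integrable_mult_right Bochner_Integration.integrable_diff p0 p1 that)
  show "integrable (restrict_space lborel scale_cube) (paired_error r m \<xi> \<Lambda> T c)"
    by (subst integrable_restrict_space, simp, simp only: set_integrable_def pt)
       (intro Bochner_Integration.integrable_sum int)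
  have "(LINT u|restrict_space lborel scale_cube. paired_error r m \<xi> \<Lambda> T c u) =
    (LINT u|lborel. (\<Sum>s\<in>?S. \<Sum>i\<in>?I s. c s i * (p0 s u - (\<Sum>\<mu>=1..m. \<Lambda> \<mu> * p1 \<mu> s i u))))"
    by (subst integral_restrict_space) (auto simp: pt simp del: real_scaleR_def)
  also have "\<dots> = (\<Sum>s\<in>?S. \<Sum>i\<in>?I s. (LINT u|lborel. c s i * (p0 s u - (\<Sum>\<mu>=1..m. \<Lambda> \<mu> * p1 \<mu> s i u))))"
    by (subst Bochner_Integration.integral_sum, intro Bochner_Integration.integrable_sum int, assumption,
        intro sum.cong refl Bochner_Integration.integral_sum int)
  also have "\<dots> = (\<Sum>s\<in>?S. \<Sum>i\<in>?I s. c s i *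
       ((\<Prod>j\<in>UNIV. (1/2) ^ ((r + 1) * s j) * bump_mass r) - (\<Sum>\<mu>=1..m. \<Lambda> \<mu> * (\<Prod>j\<in>UNIV. dyadic_bump r (s j) (i j) (\<xi> \<mu> $ j)))))"
  proof (intro sum.cong refl)
    fix s i assume i: "i \<in> ?I s"
    have "(LINT z|lborel. c s i * (p0 s z - (\<Sum>\<mu>=1..m. \<Lambda> \<mu> * p1 \<mu> s i z))) = c s i * ((LINT z|lborel. p0 s z) - (\<Sum>\<mu>=1..m. \<Lambda> \<mu> * (LINT z|lborel. p1 \<mu> s i z)))"
    proof -
      have S: "integrable lborel (\<lambda>z. \<Sum>\<mu>=1..m. \<Lambda> \<mu> * p1 \<mu> s i z)"
        by (intro Bochner_Integration.integrable_sum integrable_mult_right p1(1)[OF i])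
      have "(LINT z|lborel. (\<Sum>\<mu>=1..m. \<Lambda> \<mu> * p1 \<mu> s i z)) = (\<Sum>\<mu>=1..m. (LINT z|lborel. \<Lambda> \<mu> * p1 \<mu> s i z))"
        by (intro Bochner_Integration.integral_sum integrable_mult_right p1(1)[OF i])
      thus ?thesis
        by (simp only: integral_mult_right_zero Bochner_Integration.integral_diff[OF p0(1) S])
    qed
    thus "(LINT z|lborel. c s i * (p0 s z - (\<Sum>\<mu>=1..m. \<Lambda> \<mu> * p1 \<mu> s i z))) = c s i * ((\<Prod>j\<in>UNIV. (1/2) ^ ((r + 1) * s j) * bump_mass r) - (\<Sum>\<mu>=1..m. \<Lambda> \<mu> * (\<Prod>j\<in>UNIV. dyadic_bump r (s j) (i j) (\<xi> \<mu> $ j))))"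
      by (simp add: p0(2) p1(2)[OF i])
  qed
  finally show "(LINT u|restrict_space lborel scale_cube. paired_error r m \<xi> \<Lambda> T c u) =
      (\<Sum>s\<in>?S. \<Sum>i\<in>?I s. c s i *
       ((\<Prod>j\<in>UNIV. (1/2) ^ ((r + 1) * s j) * bump_mass r) - (\<Sum>\<mu>=1..m. \<Lambda> \<mu> * (\<Prod>j\<in>UNIV. dyadic_bump r (s j) (i j) (\<xi> \<mu> $ j)))))" .
qed

text \<open>The box of shape \<open>s\<close> and position \<open>i\<close> counts as empty if its bump vanishes at all knots.\<close>

definition empty_box :: "nat \<Rightarrow> nat \<Rightarrow> (nat \<Rightarrow> real ^ 'n) \<Rightarrow> nat \<Rightarrow> ('n \<Rightarrow> nat) \<Rightarrow> ('n \<Rightarrow> nat) \<Rightarrow> real" where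
  "empty_box r m \<xi> n s i = of_bool (sum s UNIV = n \<and> (\<forall>\<mu>\<in>{1..m}. \<exists>j. dyadic_bump r (s j) (i j) (\<xi> \<mu> $ j) = 0))"

text \<open>Bumps of one shape have disjoint supports, so a knot spoils at most one box, whose
  position is given by the floors of 2^(s j) times its coordinates.\<close>

lemma card_empty_boxes:
  assumes "sum s (UNIV :: 'n::finite set) = n"
  shows "2 ^ n - real m \<le> (\<Sum>i\<in>PiE UNIV (\<lambda>j. {..<2 ^ s j}). empty_box r m \<xi> n s i)"
proof -
  let ?I = "PiE UNIV (\<lambda>j::'n. {..<2 ^ s j::nat})"
  define bad where "bad = {i \<in> ?I. \<exists>\<mu>\<in>{1..m}. \<forall>j. dyadic_bump r (s j) (i j) (\<xi> \<mu> $ j) \<noteq> 0}"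
  have fin: "finite ?I" by (intro finite_PiE) auto
  have card: "card ?I = 2 ^ n"
    using assms by (simp add: card_PiE power_sum[symmetric])
  have sub: "bad \<subseteq> (\<lambda>\<mu> j. nat \<lfloor>2 ^ s j * \<xi> \<mu> $ j\<rfloor>) ` {1..m}"
  proof
    fix i assume "i \<in> bad"
    then obtain \<mu> where mu: "\<mu> \<in> {1..m}" "\<And>j. dyadic_bump r (s j) (i j) (\<xi> \<mu> $ j) \<noteq> 0" by (auto simp: bad_def)
    have "i j = nat \<lfloor>2 ^ s j * \<xi> \<mu> $ j\<rfloor>" for j
    proof -
      have "0 \<le> 2 ^ s j * \<xi> \<mu> $ j - real (i j) \<and> 2 ^ s j * \<xi> \<mu> $ j - real (i j) < 1"
        using mu(2)[of j] by (intro bump_support[of r]) (auto simp: dyadic_bump_def)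
      thus ?thesis by linarith
    qed
    hence "i = (\<lambda>j. nat \<lfloor>2 ^ s j * \<xi> \<mu> $ j\<rfloor>)" by (rule ext)
    thus "i \<in> (\<lambda>\<mu> j. nat \<lfloor>2 ^ s j * \<xi> \<mu> $ j\<rfloor>) ` {1..m}" using mu(1) by blast
  qed
  have "card bad \<le> m"
    using card_mono[OF _ sub] card_image_le[of "{1..m}" "\<lambda>\<mu> j. nat \<lfloor>2 ^ s j * \<xi> \<mu> $ j\<rfloor>"] by simp
  moreover have "(\<Sum>i\<in>?I. empty_box r m \<xi> n s i) = real (card (?I - bad))"
  proof -
    have "(\<Sum>i\<in>?I. empty_box r m \<xi> n s i) = (\<Sum>i\<in>?I. if i \<in> ?I - bad then 1 else 0)"
      using assms by (intro sum.cong refl) (auto simp: empty_box_def bad_def)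
    also have "\<dots> = real (card (?I - bad))"
      using fin by (subst sum.inter_restrict[symmetric]) (auto simp: Int_Diff Int_absorb1)
    finally show ?thesis .
  qed
  moreover have "card (?I - bad) = card ?I - card bad"
    by (intro card_Diff_subset) (auto simp: bad_def intro: finite_subset[OF _ fin])
  ultimately show ?thesis using card by (simp add: of_nat_diff_if)
qed

text \<open>All levels but one can be chosen freely up to n div d; their sum does not exceed
  \<open>n\<close>, and the last level is then determined.\<close>

lemma card_shapes:
  "((real n + 1) / real CARD('n::finite)) ^ (CARD('n) - 1) \<le> real (card {s \<in> PiE UNIV (\<lambda>_::'n. {..<Suc n}). sum s UNIV = n})"
proof -
  let ?d = "CARD('n)"
  define j0 :: 'n where "j0 = undefined"
  define J where "J = UNIV - {j0}"
  define f where "f = (\<lambda>s::'n \<Rightarrow> nat. s(j0 := n - sum s J))"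
  let ?A = "PiE J (\<lambda>_. {..n div ?d})"
  have d: "0 < ?d" by simp
  have cJ: "card J = ?d - 1" by (simp add: J_def)
  have inj: "inj_on f ?A"
  proof (rule inj_onI)
    fix s t assume st: "s \<in> ?A" "t \<in> ?A" "f s = f t"
    show "s = t"
    proof (rule PiE_ext[OF st(1,2)])
      fix j assume "j \<in> J"
      thus "s j = t j" using fun_cong[OF st(3), of j] by (auto simp: f_def J_def)
    qed
  qed
  have sub: "f ` ?A \<subseteq> {s \<in> PiE UNIV (\<lambda>_::'n. {..<Suc n}). sum s UNIV = n}"
  proof (rule image_subsetI)
    fix s assume s: "s \<in> ?A"
    have "sum s J \<le> (\<Sum>j\<in>J. n div ?d)" using s by (intro sum_mono) (auto simp: PiE_iff)
    also have "\<dots> = (?d - 1) * (n div ?d)" by (simp add: cJ)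
    also have "\<dots> \<le> ?d * (n div ?d)" by (intro mult_right_mono) auto
    also have "\<dots> \<le> n" by simp
    finally have le: "sum s J \<le> n" .
    have "sum (f s) UNIV = f s j0 + sum (f s) J" by (simp add: J_def sum.remove[of UNIV j0])
    also have "sum (f s) J = sum s J" by (intro sum.cong) (auto simp: f_def J_def)
    finally have sum: "sum (f s) UNIV = n" using le by (simp add: f_def)
    have "f s j \<le> n" for j using member_le_sum[of j UNIV "f s"] sum by auto
    thus "f s \<in> {s \<in> PiE UNIV (\<lambda>_::'n. {..<Suc n}). sum s UNIV = n}"
      using sum by (auto simp: less_Suc_eq_le)
  qed
  have "real n + 1 \<le> real ?d * (real (n div ?d) + 1)"
  proof -
    have "n + 1 \<le> ?d * (n div ?d + 1)"
      using dividend_less_times_div[OF d, of n] by simp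
    hence "real (n + 1) \<le> real (?d * (n div ?d + 1))" by (simp only: of_nat_le_iff)
    thus ?thesis by (simp only: of_nat_mult of_nat_add of_nat_1)
  qed
  hence "(real n + 1) / real ?d \<le> real (n div ?d + 1)" using d by (simp add: pos_divide_le_eq mult.commute add.commute)
  hence "((real n + 1) / real ?d) ^ (?d - 1) \<le> real (n div ?d + 1) ^ (?d - 1)" by (intro power_mono) auto
  also have "\<dots> = real (card ?A)" by (simp add: card_PiE cJ J_def)
  also have "\<dots> = real (card (f ` ?A))" by (simp add: card_image[OF inj])
  also have "\<dots> \<le> real (card {s \<in> PiE UNIV (\<lambda>_::'n. {..<Suc n}). sum s UNIV = n})"
    by (intro of_nat_mono card_mono sub) (auto intro: finite_subset[OF _ finite_PiE[of UNIV "\<lambda>_. {..<Suc n}"]])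
  finally show ?thesis .
qed

lemma emeasure_unit_cube_le: "emeasure lborel (unit_cube :: (real ^ 'n) set) \<le> 1"
proof -
  have "emeasure lborel (unit_cube :: (real ^ 'n) set) \<le> emeasure lborel (cbox 0 (1 :: real ^ 'n))"
    by (intro emeasure_mono) (auto simp: unit_cube_def mem_box_cart less_imp_le)
  also have "\<dots> = ennreal (\<Prod>b\<in>Basis. ((1 :: real ^ 'n) - 0) \<bullet> b)"
    by (rule emeasure_lborel_cbox) (auto simp: Basis_vec_def inner_axis)
  also have "(\<Prod>b\<in>Basis. ((1 :: real ^ 'n) - 0) \<bullet> b) = 1"
    unfolding prod_Basis_vec by (simp add: inner_axis)
  finally show ?thesis by simp
qed

lemma periodic_hat1_measurable:
  assumes "0 < u" "u \<le> 1/2" "1 \<le> r" shows "(\<lambda>t. periodic_hat1 r t u) \<in> borel_measurable borel"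
proof -
  have [measurable]: "(\<lambda>x. hat1 r x u) \<in> borel_measurable borel"
    by (rule hat1_measurable) (use assms in auto)
  show ?thesis unfolding periodic_hat1_def by measurable
qed

lemma cubature_error_measurable:
  fixes u :: "real ^ 'n"
  assumes r: "1 \<le> r" and \<xi>: "\<forall>\<mu>\<in>{1..m}. \<xi> \<mu> \<in> unit_cube" and u: "u \<in> scale_cube"
  shows "(\<lambda>z. cubature_error r m \<xi> \<Lambda> z u) \<in> borel_measurable (restrict_space lborel unit_cube)"
proof -
  have [measurable]: "(\<lambda>t. periodic_hat1 r t (u $ j)) \<in> borel_measurable borel" for j
    using u by (intro periodic_hat1_measurable r) (auto simp: scale_cube_def)
  have "(\<lambda>z::real ^ 'n. (\<Prod>j\<in>UNIV. (u $ j) ^ r) - (\<Sum>\<mu>=1..m. \<Lambda> \<mu> * (\<Prod>j\<in>UNIV. periodic_hat1 r (\<xi> \<mu> $ j - z $ j) (u $ j)))) \<in> borel_measurable (restrict_space lborel unit_cube)"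
    by (intro measurable_restrict_space1) measurable
  thus ?thesis
    by (subst measurable_cong[OF cubature_error_eq[OF r \<xi> _ u]]) (simp_all add: space_restrict_space)
qed

lemma exists_power_two:
  fixes m :: nat
  assumes "1 \<le> m" shows "\<exists>n::nat. 2 * m \<le> 2 ^ n \<and> 2 ^ n \<le> 4 * m"
proof -
  define n where "n = (LEAST n::nat. 2 * m \<le> 2 ^ n)"
  have ex: "2 * m \<le> 2 ^ (2 * m)" by (intro less_imp_le less_exp)
  have n: "2 * m \<le> 2 ^ n" unfolding n_def by (rule LeastI[of "\<lambda>n. 2 * m \<le> 2 ^ n", OF ex])
  have "n \<noteq> 0" using n assms by (intro notI) simp
  then obtain k where k: "n = Suc k" by (cases n) auto
  have "\<not> 2 * m \<le> 2 ^ k" using not_less_Least[of k "\<lambda>n. 2 * m \<le> 2 ^ n"] k n_def by auto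
  hence "2 ^ n \<le> 4 * m" using k by simp
  with n show ?thesis by blast
qed

text \<open>At x = 0 the condition on \<open>k\<close> matters: \<open>powr\<close> is 0 there for
  every exponent, whereas a zeroth power is 1. The case occurs for m = 1, where the logarithm
  vanishes.\<close>

lemma powr_half_nat:
  fixes x :: real
  assumes "0 \<le> x" "1 \<le> k"
  shows "x powr (real k / 2) = sqrt x ^ k"
proof (cases "x = 0")
  case False
  hence "x powr (real k / 2) = (x powr (1/2)) powr real k" by (simp add: powr_powr)
  also have "\<dots> = sqrt x ^ k" using assms False by (simp add: powr_half_sqrt powr_realpow)
  finally show ?thesis .
qed (use assms in \<open>simp add: power_0_left\<close>)

text \<open>The numerator bounds the averaged pairing from below: the number of shapes, times half
  of the boxes of each shape, times the mass of one product of bumps. The denominator comes from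
  \<open>duality\<close> with the moment bound for the test function. The shapes contribute
  (n+1)^(d-1) and the moments only its square root, so half of the exponent is left.\<close>

lemma periodic_discrepancy_ge:
  fixes \<xi> :: "nat \<Rightarrow> real ^ 'n::finite"
  assumes r: "even r" "1 \<le> r" and p: "1 < p" "p / (p - 1) \<le> real (2 * N)" and N: "1 \<le> N"
    and \<xi>: "\<forall>\<mu>\<in>{1..m}. \<xi> \<mu> \<in> unit_cube" and n: "2 * m \<le> 2 ^ n"
  defines "d \<equiv> CARD('n)"
  shows "ennreal ((((real n + 1) / real d) ^ (d - 1) * (2 ^ n / 2) * ((1/2) ^ ((r + 1) * n) * bump_mass r ^ d)) /
     (3 * ((\<bar>osc_coeff r\<bar> + mean_coeff r) * sqrt (moment_const r N) ^ (d - 1) * sqrt (real n + 1) ^ (d - 1))))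
     \<le> periodic_discrepancy r (ennreal p) 1 m \<xi> \<Lambda>"
proof -
  let ?S = "PiE UNIV (\<lambda>_::'n. {..<Suc n})" and ?I = "\<lambda>s. PiE UNIV (\<lambda>j::'n. {..<2 ^ s j::nat})"
  let ?c = "empty_box r m \<xi> n"
  let ?Z = "restrict_space lborel (unit_cube :: (real ^ 'n) set)"
  let ?U = "restrict_space lborel (scale_cube :: (real ^ 'n) set)"
  define g where "g = (\<lambda>z::real ^ 'n. dyadic_sum r UNIV (Suc n) ?c (($) z))"
  define B where "B = (\<bar>osc_coeff r\<bar> + mean_coeff r) * sqrt (moment_const r N) ^ (d - 1) * sqrt (real n + 1) ^ (d - 1)"
  define V where "V = ((real n + 1) / real d) ^ (d - 1) * (2 ^ n / 2) * ((1/2) ^ ((r + 1) * n) * bump_mass r ^ d)"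
  define W where "W = paired_error r m \<xi> \<Lambda> (Suc n) ?c"
  have C: "0 < moment_const r N" by (rule moment_const_pos)
  have B: "0 < B" unfolding B_def using C mean_coeff_pos[of r] by (intro mult_pos_pos zero_less_power) auto
  have gm: "(\<integral>\<^sup>+z. ennreal (g z ^ (2 * N)) \<partial>?Z) \<le> ennreal (B ^ (2 * N))"
  proof -
    define j0 :: 'n where "j0 = undefined"
    define J where "J = UNIV - {j0}"
    have J: "insert j0 J = UNIV" "j0 \<notin> J" "finite J" "card J = d - 1" by (auto simp: J_def d_def)
    have "(\<integral>\<^sup>+z. ennreal (g z ^ (2 * N)) \<partial>?Z) = (\<integral>\<^sup>+z. ennreal (g z ^ (2 * N)) * indicator unit_cube z \<partial>lborel)"
      by (rule nn_integral_restrict_space) simp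
    also have "\<dots> \<le> (\<integral>\<^sup>+z. ennreal (g z ^ (2 * N)) \<partial>lborel)"
      by (intro nn_integral_mono) (auto simp: indicator_def)
    also have "\<dots> = (\<integral>\<^sup>+x. ennreal (dyadic_sum r UNIV (Suc n) ?c x ^ (2 * N)) \<partial>PiM UNIV (\<lambda>_. lborel))"
      unfolding g_def by (rule dyadic_sum_vec_nn_integral)
    also have "\<dots> \<le> ennreal (((\<bar>osc_coeff r\<bar> + mean_coeff r)\<^sup>2 * (moment_const r N ^ card J * real (Suc n) ^ card J)) ^ N)"
    proof (rule dyadic_sum_moment_diagonal[OF J(3,2) r(2) N, unfolded J(1)])
      show "\<bar>?c s i\<bar> \<le> 1" for s i by (simp add: empty_box_def)
      show "sum s UNIV = n" if "?c s i \<noteq> 0" for s i using that by (simp add: empty_box_def)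
    qed
    also have "(\<bar>osc_coeff r\<bar> + mean_coeff r)\<^sup>2 * (moment_const r N ^ card J * real (Suc n) ^ card J) = B\<^sup>2"
    proof -
      have q: "(sqrt x ^ k)\<^sup>2 = x ^ k" if "0 \<le> x" for x :: real and k
        using that by (metis power_mult mult.commute real_sqrt_pow2)
      show ?thesis unfolding B_def power_mult_distrib using C by (simp add: q J(4) add.commute mult.assoc)
    qed
    finally show ?thesis by (simp add: power_mult)
  qed
  have Zm: "emeasure ?Z (space ?Z) \<le> 1"
    using emeasure_unit_cube_le[where 'n = 'n] by (simp add: emeasure_restrict_space space_restrict_space)
  have gmeas: "g \<in> borel_measurable ?Z" unfolding g_def by (intro measurable_restrict_space1) measurable
  have inner: "ennreal (W u / (3 * B)) \<le> Lp_norm ?Z (ennreal p) (\<lambda>z. ennreal \<bar>cubature_error r m \<xi> \<Lambda> z u\<bar>)" if u: "u \<in> scale_cube" for u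
    using duality[OF cubature_error_measurable[OF r(2) \<xi> u] gmeas Zm p B gm, of \<Lambda>]
    unfolding W_def g_def error_pairing[OF r \<xi> u] .
  have Wi: "integrable ?U W" unfolding W_def by (rule paired_error_integral(1)[OF r \<xi>])
  have VW: "V \<le> (LINT u|?U. W u)"
  proof -
    have "(LINT u|?U. W u) = (\<Sum>s\<in>?S. \<Sum>i\<in>?I s. ?c s i *
       ((\<Prod>j\<in>UNIV. (1/2) ^ ((r + 1) * s j) * bump_mass r) - (\<Sum>\<mu>=1..m. \<Lambda> \<mu> * (\<Prod>j\<in>UNIV. dyadic_bump r (s j) (i j) (\<xi> \<mu> $ j)))))"
      unfolding W_def by (rule paired_error_integral(2)[OF r \<xi>])
    also have "\<dots> = (\<Sum>s\<in>?S. \<Sum>i\<in>?I s. ?c s i * ((1/2) ^ ((r + 1) * n) * bump_mass r ^ d))"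
    proof (intro sum.cong refl)
      fix s i
      show "?c s i * ((\<Prod>j\<in>UNIV. (1/2) ^ ((r + 1) * s j) * bump_mass r) - (\<Sum>\<mu>=1..m. \<Lambda> \<mu> * (\<Prod>j\<in>UNIV. dyadic_bump r (s j) (i j) (\<xi> \<mu> $ j)))) =
        ?c s i * ((1/2) ^ ((r + 1) * n) * bump_mass r ^ d)"
      proof (cases "?c s i = 0")
        case False
        hence s: "sum s UNIV = n" and z: "\<And>\<mu>. \<mu> \<in> {1..m} \<Longrightarrow> \<exists>j. dyadic_bump r (s j) (i j) (\<xi> \<mu> $ j) = 0"
          by (auto simp: empty_box_def)
        \<comment> \<open>Here the knots drop out, for arbitrary weights.\<close>
        have "(\<Prod>j\<in>UNIV. dyadic_bump r (s j) (i j) (\<xi> \<mu> $ j)) = 0" if "\<mu> \<in> {1..m}" for \<mu>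
          using z[OF that] by (auto intro: prod_zero)
        hence "(\<Sum>\<mu>=1..m. \<Lambda> \<mu> * (\<Prod>j\<in>UNIV. dyadic_bump r (s j) (i j) (\<xi> \<mu> $ j))) = 0" by (intro sum.neutral) auto
        moreover have "(\<Prod>j\<in>UNIV. (1/2::real) ^ ((r + 1) * s j)) = (1/2) ^ ((r + 1) * n)"
          using s by (simp only: power_sum[symmetric] sum_distrib_left[symmetric])
        ultimately show ?thesis by (simp only: prod.distrib prod_constant d_def diff_0_right)
      qed simp
    qed
    also have "\<dots> = (\<Sum>s\<in>?S. (\<Sum>i\<in>?I s. ?c s i) * ((1/2) ^ ((r + 1) * n) * bump_mass r ^ d))"
      by (simp only: sum_distrib_right)
    finally have eq: "(LINT u|?U. W u) = (\<Sum>s\<in>?S. (\<Sum>i\<in>?I s. ?c s i) * ((1/2) ^ ((r + 1) * n) * bump_mass r ^ d))" .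
    have "V \<le> real (card {s \<in> ?S. sum s UNIV = n}) * (2 ^ n / 2) * ((1/2) ^ ((r + 1) * n) * bump_mass r ^ d)"
      unfolding V_def d_def using bump_mass_pos[of r] by (intro mult_right_mono card_shapes) auto
    also have "\<dots> = (\<Sum>s\<in>?S. (if sum s UNIV = n then 2 ^ n / 2 else 0) * ((1/2) ^ ((r + 1) * n) * bump_mass r ^ d))"
      unfolding sum_distrib_right[symmetric] by (subst sum.inter_filter[symmetric]) (auto intro: finite_PiE)
    also have "\<dots> \<le> (LINT u|?U. W u)"
      unfolding eq
    proof (intro sum_mono mult_right_mono)
      fix s :: "'n \<Rightarrow> nat"
      show "(if sum s UNIV = n then 2 ^ n / 2 else 0) \<le> (\<Sum>i\<in>?I s. ?c s i)"
      proof (cases "sum s UNIV = n")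
        case True
        have "real (2 * m) \<le> real (2 ^ n)" using n by (simp only: of_nat_le_iff)
        hence "2 ^ n / 2 \<le> 2 ^ n - real m" by simp
        also have "\<dots> \<le> (\<Sum>i\<in>?I s. ?c s i)" by (rule card_empty_boxes[OF True])
        finally show ?thesis using True by simp
      qed (auto intro!: sum_nonneg simp: empty_box_def)
    qed (use bump_mass_pos[of r] in auto)
    finally show ?thesis .
  qed
  have "ennreal (V / (3 * B)) \<le> ennreal (LINT u|?U. W u / (3 * B))"
    using VW B by (intro ennreal_leI) (simp add: divide_right_mono)
  \<comment> \<open>Since \<open>W\<close> may be negative at single scales, the conversion to
    \<open>ennreal\<close> truncates; this can only enlarge the integral.\<close>
  also have "\<dots> \<le> (\<integral>\<^sup>+u. ennreal (W u / (3 * B)) \<partial>?U)"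
    by (intro ennreal_integral_le_nn_integral) (use Wi in simp)
  also have "\<dots> \<le> (\<integral>\<^sup>+u. Lp_norm ?Z (ennreal p) (\<lambda>z. ennreal \<bar>cubature_error r m \<xi> \<Lambda> z u\<bar>) \<partial>?U)"
    by (intro nn_integral_mono inner) (simp add: space_restrict_space)
  also have "\<dots> = periodic_discrepancy r (ennreal p) 1 m \<xi> \<Lambda>"
    unfolding periodic_discrepancy_def Lp_norm_1 ..
  finally show ?thesis unfolding V_def B_def .
qed

theorem theorem4p2:
  fixes r :: nat and p :: real
  assumes "CARD('n::finite) \<ge> 2"
    and "r \<ge> 1" and "even r"
    and "1 < p"
  shows "\<exists>C>0. \<forall>m\<ge>1. \<forall>(\<xi> :: nat \<Rightarrow> real ^ 'n) (\<Lambda> :: nat \<Rightarrow> real).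
           (\<forall>\<mu>\<in>{1..m}. \<xi> \<mu> \<in> unit_cube) \<longrightarrow>
           periodic_discrepancy r (ennreal p) 1 m \<xi> \<Lambda>
             \<ge> ennreal (C * real m powr (- real r) * ln (real m) powr ((real CARD('n) - 1) / 2))"
proof -
  let ?d = "CARD('n)"
  define k where "k = ?d - 1"
  \<comment> \<open>An even exponent 2 N not below the conjugate exponent of \<open>p\<close>. It
    depends on \<open>p\<close> alone, as the final constant must.\<close>
  obtain N :: nat where N: "p / (p - 1) \<le> real (2 * N)" "1 \<le> N"
  proof -
    obtain M :: nat where "p / (p - 1) \<le> real M" using real_arch_simple by blast
    thus ?thesis by (intro that[of "Suc M"]) auto
  qed
  define G where "G = (\<bar>osc_coeff r\<bar> + mean_coeff r) * sqrt (moment_const r N) ^ k"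
  \<comment> \<open>The 6 is the product of 2, for the half of the boxes that is empty, and the 3
    from \<open>duality\<close>. The later division by 4^r pays for 2^n \<le> 4 m.\<close>
  define c0 where "c0 = bump_mass r ^ ?d / (6 * real ?d ^ k * G)"
  have G: "0 < G" unfolding G_def using moment_const_pos[of r N] mean_coeff_pos[of r] by (intro mult_pos_pos zero_less_power) auto
  have c0: "0 < c0" unfolding c0_def using G bump_mass_pos[of r] by simp
  have main: "ennreal (c0 / 4 ^ r * real m powr (- real r) * ln (real m) powr ((real ?d - 1) / 2)) \<le> periodic_discrepancy r (ennreal p) 1 m \<xi> \<Lambda>"
    if m: "1 \<le> m" and \<xi>: "\<forall>\<mu>\<in>{1..m}. \<xi> \<mu> \<in> unit_cube" for m and \<xi> :: "nat \<Rightarrow> real ^ 'n" and \<Lambda>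
  proof -
    obtain n where n: "2 * m \<le> 2 ^ n" "2 ^ n \<le> 4 * m" using exists_power_two[OF m] by blast
    define L where "L = sqrt (real n + 1) ^ k"
    have L: "0 < L" "(real n + 1) ^ k = L * L"
    proof -
      show "0 < L" by (simp add: L_def)
      have "L * L = (sqrt (real n + 1) * sqrt (real n + 1)) ^ k" by (simp only: L_def power_mult_distrib)
      thus "(real n + 1) ^ k = L * L" by simp
    qed
    have pw: "(1/2::real) ^ ((r + 1) * n) * 2 ^ n = (1 / 2 ^ n) ^ r"
      by (simp add: power_add power_one_over power_mult[symmetric] mult.commute)
    have "((real n + 1) / real ?d) ^ k * (2 ^ n / 2) * ((1/2) ^ ((r + 1) * n) * bump_mass r ^ ?d) / (3 * (G * L)) =
       ((1/2) ^ ((r + 1) * n) * 2 ^ n) * (L * L / (real ?d ^ k * 2) * bump_mass r ^ ?d / (3 * (G * L)))"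
    proof -
      have "(LL / D) * (t / 2) * (h * M) / X = (h * t) * (LL / (D * 2) * M / X)" for LL D t h M X :: real
        by (simp only: divide_inverse inverse_mult_distrib mult_ac)
      thus ?thesis unfolding power_divide L(2) .
    qed
    also have "\<dots> = (1 / 2 ^ n) ^ r * (c0 * L)"
    proof -
      have "L * L / (D * 2) * M / (3 * (G * L)) = M / (6 * D * G) * L" for D M :: real
        using L(1) by (simp add: field_simps)
      thus ?thesis unfolding pw c0_def by simp
    qed
    also have "\<dots> \<ge> (c0 / 4 ^ r * real m powr (- real r)) * ln (real m) powr ((real ?d - 1) / 2)"
    proof -
      have mr: "0 < real m" using m by simp
      have "real (2 ^ n) \<le> real (4 * m)" using n(2) by (simp only: of_nat_le_iff)
      hence "1 / (4 * real m) \<le> 1 / 2 ^ n" using mr by (intro divide_left_mono) auto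
      hence "(1 / (4 * real m)) ^ r \<le> (1 / 2 ^ n) ^ r" using mr by (intro power_mono) auto
      moreover have "(1 / (4 * real m)) ^ r = 1 / 4 ^ r * real m powr (- real r)"
        using mr by (simp add: powr_minus powr_realpow power_divide power_mult_distrib field_simps)
      ultimately have 1: "1 / 4 ^ r * real m powr (- real r) \<le> (1 / 2 ^ n) ^ r" by simp
      have ln0: "0 \<le> ln (real m)" using m by simp
      have "ln (real m) \<le> ln (2 ^ n)"
      proof -
        have "m \<le> 2 ^ n" using n(1) by linarith
        thus ?thesis using mr by simp
      qed
      also have "\<dots> = real n * ln 2" by (simp add: ln_realpow)
      also have "\<dots> \<le> real n * 1" using ln_2_less_1 by (intro mult_left_mono) auto
      finally have lnn: "ln (real m) \<le> real n + 1" by simp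
      have "ln (real m) powr ((real ?d - 1) / 2) = sqrt (ln (real m)) ^ k"
        using powr_half_nat[OF ln0, of k] assms(1) by (simp add: k_def of_nat_diff)
      also have "\<dots> \<le> L" unfolding L_def using lnn ln0 by (intro power_mono) auto
      finally have 2: "ln (real m) powr ((real ?d - 1) / 2) \<le> L" .
      have "(1 / 4 ^ r * real m powr (- real r)) * (c0 * ln (real m) powr ((real ?d - 1) / 2)) \<le> (1 / 2 ^ n) ^ r * (c0 * L)"
        using c0 L(1) by (intro mult_mono 1 2 mult_left_mono) auto
      thus ?thesis by (simp add: mult_ac)
    qed
    finally have "ennreal (c0 / 4 ^ r * real m powr (- real r) * ln (real m) powr ((real ?d - 1) / 2)) \<le>
      ennreal (((real n + 1) / real ?d) ^ k * (2 ^ n / 2) * ((1/2) ^ ((r + 1) * n) * bump_mass r ^ ?d) / (3 * (G * L)))"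
      by (rule ennreal_leI)
    also have "\<dots> \<le> periodic_discrepancy r (ennreal p) 1 m \<xi> \<Lambda>"
      using periodic_discrepancy_ge[OF assms(3,2,4) N, of m \<xi> n \<Lambda>] \<xi> n(1) unfolding G_def L_def k_def by (simp only: mult.assoc)
    finally show ?thesis .
  qed
  show ?thesis
    by (rule exI[of _ "c0 / 4 ^ r"]) (use c0 main in auto)
qed

end
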